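(* Let $n\ge1$ be an integer and let $$\mathcal{P}_n=\left\{(\lambda,\alpha)\in\mathbb{R}^2:\ \lambda>-1,\ -\frac{n+2}{2}<\alpha\le\min\left[\frac14\left(3\lambda-\frac{n+1}{2}\right),\ \frac12\left(\lambda-\frac{n-1}{2}\right)\right]\right\}.$$ Let $0<\delta\le\frac12$, $\rho\ge1$ and $(\lambda,\alpha)\in\mathcal{P}_n$. Then the function $$W(\mathbf{x})=\int_0^\infty\left(1-\frac{\|\mathbf{x}\|^2}{t}\right)_+^\lambda t^\alpha\left(1-t^\delta\right)_+^\rho\,dt\qquad(\mathbf{x}\in\mathbb{R}^n)$$ has a strictly positive Fourier transform and hence induces positive definite matrices on $\mathbb{R}^n$.
   Context: $\|\cdot\|$ is the Euclidean norm on $\mathbb{R}^n$. For $s\in\mathbb{R}$ and a real exponent $p$, $(s)_+^p=s^p$ if $s>0$ and $(s)_+^p=0$ if $s\le0$. The Fourier transform is $\widehat W(\xi)=\int_{\mathbb{R}^n}W(\mathbf{x})e^{-i\xi\cdot\mathbf{x}}\,d\mathbf{x}$, $\xi\in\mathbb{R}^n$. "Induces positive definite matrices on $\mathbb{R}^n$" means that for every finite set of pairwise distinct points $\mathbf{x}_1,\dots,\mathbf{x}_N\in\mathbb{R}^n$ the matrix $\left(W(\mathbf{x}_i-\mathbf{x}_j)\right)_{i,j=1}^N$ is positive definite.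
   Formalization: For α ≤ -1 the integral gives W(0) = +∞, so the matrices are not real; there positive definiteness is read as an extended-real quadratic form with +∞ on the diagonal (0·∞ = 0). For α > -1 it is the usual notion, and the Fourier transform claim is unchanged. *)

theory Defs
  imports "HOL-Analysis.Analysis"
begin

definition pos_powr :: "real \<Rightarrow> real \<Rightarrow> real" where
  "pos_powr s p = (if s > 0 then s powr p else 0)"

definition param_region :: "nat \<Rightarrow> (real \<times> real) set" where
  "param_region n = {(l, \<alpha>). l > -1 \<and> - ((real n + 2) / 2) < \<alpha> \<and>
     \<alpha> \<le> min (1/4 * (3 * l - (real n + 1) / 2)) (1/2 * (l - (real n - 1) / 2))}"

(* The integrand is nonnegative, so its integral always exists in [0,\<infinity>].  It is kept
   extended-valued because the value at the origin is infinite when \<alpha> \<le> -1. *)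
definition W_mix :: "real \<Rightarrow> real \<Rightarrow> real \<Rightarrow> real \<Rightarrow> real ^ 'n \<Rightarrow> ennreal" where
  "W_mix l \<alpha> \<delta> \<rho> x =
     (\<integral>\<^sup>+ t \<in> {0<..}. ennreal (pos_powr (1 - (norm x)\<^sup>2 / t) l * t powr \<alpha>
        * pos_powr (1 - t powr \<delta>) \<rho>) \<partial>lborel)"

definition fourier_transform :: "(real ^ 'n \<Rightarrow> real) \<Rightarrow> real ^ 'n \<Rightarrow> complex" where
  "fourier_transform f \<xi> =
     (LINT x|lborel. complex_of_real (f x) * exp (- (\<i> * complex_of_real (\<xi> \<bullet> x))))"

(* Bochner integrals of non-integrable functions are 0, so integrability is required explicitly. *)
definition has_strictly_positive_fourier_transform :: "(real ^ 'n \<Rightarrow> real) \<Rightarrow> bool" where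
  "has_strictly_positive_fourier_transform f \<longleftrightarrow> integrable lborel f \<and>
     (\<forall>\<xi>. Im (fourier_transform f \<xi>) = 0 \<and> Re (fourier_transform f \<xi>) > 0)"

(* Positive definiteness of an N x N symmetric matrix (indices 0, ..., N-1) whose diagonal may be
   \<infinity>; with 0 * \<infinity> = 0 the quadratic form contains no \<infinity> - \<infinity>.  For real entries this is
   the usual notion, see the lemma below. *)
definition pos_def_matrix :: "nat \<Rightarrow> (nat \<Rightarrow> nat \<Rightarrow> ereal) \<Rightarrow> bool" where
  "pos_def_matrix N A \<longleftrightarrow>
     (\<forall>i<N. \<forall>j<N. A i j = A j i \<and> A i j \<noteq> - \<infinity> \<and> (i \<noteq> j \<longrightarrow> A i j \<noteq> \<infinity>)) \<and>
     (\<forall>c :: nat \<Rightarrow> real. (\<exists>i<N. c i \<noteq> 0) \<longrightarrow>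
        0 < (\<Sum>i<N. \<Sum>j<N. ereal (c i * c j) * A i j))"

lemma pos_def_matrix_ereal:
  "pos_def_matrix N (\<lambda>i j. ereal (B i j)) \<longleftrightarrow>
     (\<forall>i<N. \<forall>j<N. B i j = B j i) \<and>
     (\<forall>c. (\<exists>i<N. c i \<noteq> 0) \<longrightarrow> 0 < (\<Sum>i<N. \<Sum>j<N. c i * c j * B i j))"
  by (simp add: pos_def_matrix_def)

definition induces_pos_def_matrices :: "(real ^ 'n \<Rightarrow> ereal) \<Rightarrow> bool" where
  "induces_pos_def_matrices f \<longleftrightarrow>
     (\<forall>N (x :: nat \<Rightarrow> real ^ 'n). inj_on x {..<N} \<longrightarrow> pos_def_matrix N (\<lambda>i j. f (x i - x j)))"

end

theory Submission
  imports Defs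
begin

text \<open>
  Put \<open>\<mu> = l + n/2\<close>. The transform of \<open>(1 - |x|\<^sup>2/t)\<^sub>+\<^sup>l\<close> is a multiple of
  \<open>t\<^bsup>n/2\<^esup> (r \<surd>t)\<^bsup>-\<mu>\<^esup> J\<^sub>\<mu>(r \<surd>t)\<close> with \<open>r = |\<xi>|\<close>. After \<open>t = s\<^sup>2\<close> the
  Fourier transform of \<open>W\<close> becomes an integral of \<open>s\<^sup>\<nu> J\<^sub>\<mu>(r s)\<close> against
  \<open>s\<^bsup>-d\<^esup> (1 - s\<^bsup>2\<delta>\<^esup>)\<^sub>+\<^sup>\<rho>\<close>, where \<open>d \<ge> 0\<close> and \<open>\<nu> = min (3/2) (\<mu>/2 + 3/4)\<close>. This weight is
  convex and decreasing because \<open>2\<delta> \<le> 1 \<le> \<rho>\<close>, hence a positive mixture of the functions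
  \<open>(c - s)\<^sub>+\<close>, and it suffices that \<open>Q(x) = \<integral>\<^sub>0\<^sup>x (x - s) s\<^sup>\<nu> J\<^sub>\<mu>(s) ds\<close> is positive. With
  \<open>\<sigma> = \<mu>/2 + 3/4\<close>, the power series of \<open>Q(x)\<close> arises from that of \<open>J\<^sub>\<sigma>(x/2)\<^sup>2\<close>, up to powers of
  \<open>x\<close>, by multiplying the coefficients with two quotients of the form
  \<open>(p)\<^sub>k (q)\<^sub>k / ((p')\<^sub>k (q')\<^sub>k)\<close> where \<open>p + q = p' + q'\<close> and \<open>p q \<le> p' q'\<close>. Such a multiplier
  preserves positivity on the half-line.

  If \<open>\<alpha> > -1\<close>, then \<open>W\<close> is continuous and a Gaussian regularisation of the Fourier inversion formula
  gives positive definiteness. If \<open>\<alpha> \<le> -1\<close>, then \<open>W(0) = \<infinity>\<close> and the diagonal dominates.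
\<close>

section \<open>Power series that are positive on the half-line\<close>

text \<open>The bounds on \<alpha> translate as follows, with a = \<alpha> + n/2 + 1. The upper ones
  are the two branches of \<nu>: together they say 2a \<le> \<mu> + \<nu> + 1, so d = \<mu> + \<nu>
  + 1 - 2a is nonnegative. The lower one says a > 0, which is integrability at t = 0. The cap 3/2 on
  \<nu> is natural, since Q grows linearly on average while its oscillation has order x^(\<nu> -
  1/2). The value of \<sigma> is forced by the equal sums. With 2b = \<mu> + \<nu> + 1, the demands
  2b + 1/2 = (\<sigma> + 1/2) + (\<mu> + 1) and 2b + 5/2 = (\<sigma> + 1) + (2\<sigma> + 1) give
  \<sigma> = \<mu>/2 + 3/4 and \<nu> = \<sigma>. Beyond \<sigma> = 3/2 a product inequality fails,
  and another pair of multipliers with \<nu> = 3/2 takes over. Multipliers preserve positivity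
  because dividing the k-th coefficient by p + k is a positive integral operator: it sends f to
  z^(-p) times the integral of w^(p-1) f(w) over 0 < w < z.\<close>

definition entire_coeffs :: "(nat \<Rightarrow> real) \<Rightarrow> bool" where
  "entire_coeffs c \<longleftrightarrow> (\<forall>z. summable (\<lambda>k. c k * z ^ k))"

definition psum :: "(nat \<Rightarrow> real) \<Rightarrow> real \<Rightarrow> real" where
  "psum c z = (\<Sum>k. c k * z ^ k)"

text \<open>The positive constant term excludes the zero series and provides positivity near 0, from
  which strict positivity on the whole half-line can be propagated.\<close>

definition nonneg_entire :: "(nat \<Rightarrow> real) \<Rightarrow> bool" where
  "nonneg_entire c \<longleftrightarrow> entire_coeffs c \<and> 0 < c 0 \<and> (\<forall>z\<ge>0. 0 \<le> psum c z)"

definition pos_entire :: "(nat \<Rightarrow> real) \<Rightarrow> bool" where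
  "pos_entire c \<longleftrightarrow> entire_coeffs c \<and> (\<forall>z\<ge>0. 0 < psum c z)"

lemma psum_0 [simp]: "psum c 0 = c 0"
  by (simp add: psum_def)

lemma pos_entire_imp_nonneg: "pos_entire c \<Longrightarrow> nonneg_entire c"
  unfolding pos_entire_def nonneg_entire_def using psum_0[of c]
  by (metis less_eq_real_def order_refl)

lemma entire_coeffs_summable: "entire_coeffs c \<Longrightarrow> summable (\<lambda>k. c k * z ^ k)"
  by (simp add: entire_coeffs_def)

lemma entire_coeffs_abs_summable:
  assumes "entire_coeffs c" shows "summable (\<lambda>k. \<bar>c k\<bar> * \<bar>z\<bar> ^ k)"
proof -
  have "summable (\<lambda>k. norm (c k * z ^ k))"
    by (rule powser_insidea[of c "\<bar>z\<bar> + 1"]) (use assms in \<open>auto simp: entire_coeffs_def\<close>)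
  then show ?thesis by (simp add: abs_mult power_abs)
qed

lemma entire_coeffs_bounded_mult:
  assumes "entire_coeffs c" and "\<And>k. \<bar>m k\<bar> \<le> K"
  shows "entire_coeffs (\<lambda>k. c k * m k)"
  unfolding entire_coeffs_def
proof
  fix z :: real
  show "summable (\<lambda>k. c k * m k * z ^ k)"
  proof (rule summable_comparison_test')
    show "summable (\<lambda>k. K * (\<bar>c k\<bar> * \<bar>z\<bar> ^ k))"
      by (intro summable_mult entire_coeffs_abs_summable assms)
    show "norm (c k * m k * z ^ k) \<le> K * (\<bar>c k\<bar> * \<bar>z\<bar> ^ k)" for k
      using mult_right_mono[OF assms(2)[of k], of "\<bar>c k\<bar> * \<bar>z\<bar> ^ k"]
      by (simp add: abs_mult power_abs mult_ac)
  qed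
qed

lemma psum_has_derivative:
  "entire_coeffs c \<Longrightarrow> (psum c has_real_derivative psum (diffs c) z) (at z)"
  unfolding psum_def[abs_def] entire_coeffs_def by (rule termdiffs_strong_converges_everywhere) auto

lemma continuous_on_psum: "entire_coeffs c \<Longrightarrow> continuous_on A (psum c)"
  by (meson psum_has_derivative DERIV_isCont continuous_at_imp_continuous_on)

section \<open>Division of the k-th coefficient by p + k\<close>

lemma entire_coeffs_divide:
  assumes "entire_coeffs c" "p > 0" shows "entire_coeffs (\<lambda>k. c k / (p + real k))"
proof -
  have "entire_coeffs (\<lambda>k. c k * (1 / (p + real k)))"
  proof (rule entire_coeffs_bounded_mult[OF assms(1)])
    show "\<bar>1 / (p + real k)\<bar> \<le> 1 / p" for k
      using assms(2) by (auto intro!: divide_left_mono mult_pos_pos add_pos_nonneg)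
  qed
  then show ?thesis by simp
qed

text \<open>The Euler operator z d/dz + p multiplies the k-th coefficient by p + k, so the division
  inverts it.\<close>

lemma psum_divide_euler:
  assumes "entire_coeffs c" "p > 0"
  defines "b \<equiv> \<lambda>k. c k / (p + real k)"
  shows "z * psum (diffs b) z + p * psum b z = psum c z"
proof -
  have b: "entire_coeffs b" unfolding b_def by (rule entire_coeffs_divide) fact+
  have sm: "summable (\<lambda>n. diffs b n * z ^ n)"
    using b termdiff_converges_all[of b z] by (simp add: entire_coeffs_def)
  have "(\<lambda>n. z * (real n * b n * z ^ (n - Suc 0))) sums (z * psum (diffs b) z)"
    unfolding psum_def by (intro sums_mult diffs_equiv sm)
  moreover have "z * (real n * b n * z ^ (n - Suc 0)) = real n * b n * z ^ n" for n
    by (cases n) auto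
  ultimately have "(\<lambda>n. real n * b n * z ^ n) sums (z * psum (diffs b) z)" by simp
  moreover have "(\<lambda>n. p * (b n * z ^ n)) sums (p * psum b z)"
    unfolding psum_def by (intro sums_mult summable_sums entire_coeffs_summable b)
  ultimately have "(\<lambda>n. real n * b n * z ^ n + p * (b n * z ^ n)) sums (z * psum (diffs b) z + p * psum b z)"
    by (rule sums_add)
  moreover have "real n * b n * z ^ n + p * (b n * z ^ n) = c n * z ^ n" for n
  proof -
    have "p + real n \<noteq> 0" using assms(2) by linarith
    then have "(p + real n) * b n = c n" by (simp add: b_def)
    then show ?thesis by (metis distrib_right mult.assoc add.commute)
  qed
  ultimately show ?thesis by (simp add: psum_def sums_unique)
qed

text \<open>The Euler equation multiplied by the integrating factor z^(p-1): the divided series is,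
  up to z^p, a primitive of the original one.\<close>

lemma psum_divide_has_derivative:
  assumes "entire_coeffs c" "p > 0" "z > 0"
  shows "((\<lambda>z. z powr p * psum (\<lambda>k. c k / (p + real k)) z) has_real_derivative
    z powr (p - 1) * psum c z) (at z)"
proof -
  let ?b = "\<lambda>k. c k / (p + real k)"
  have b: "entire_coeffs ?b" by (rule entire_coeffs_divide) fact+
  have "((\<lambda>z. z powr p * psum ?b z) has_real_derivative
     (p * z powr (p - 1)) * psum ?b z + psum (diffs ?b) z * z powr p) (at z)"
    by (rule DERIV_mult[OF has_real_derivative_powr[OF assms(3)] psum_has_derivative[OF b]])
  moreover have "(p * z powr (p - 1)) * psum ?b z + psum (diffs ?b) z * z powr p
      = z powr (p - 1) * psum c z"
  proof -
    have "z powr p = z powr (p - 1) * z" using assms(3) by (simp add: powr_diff)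
    then have "(p * z powr (p - 1)) * psum ?b z + psum (diffs ?b) z * z powr p
      = z powr (p - 1) * (z * psum (diffs ?b) z + p * psum ?b z)" by (simp add: algebra_simps)
    then show ?thesis by (simp only: psum_divide_euler[OF assms(1,2), of z])
  qed
  ultimately show ?thesis by simp
qed

text \<open>Near 0 the positive constant term decides. Further out, z^p times the divided series is
  nondecreasing, because its derivative is z^(p-1) times a nonnegative function. Thus nonnegativity
  improves to strict positivity.\<close>

lemma pos_entire_divide:
  assumes "nonneg_entire c" "p > 0"
  shows "pos_entire (\<lambda>k. c k / (p + real k))"
proof -
  let ?b = "\<lambda>k. c k / (p + real k)"
  have c: "entire_coeffs c" "c 0 > 0" "\<And>z. z \<ge> 0 \<Longrightarrow> 0 \<le> psum c z"
    using assms(1) by (auto simp: nonneg_entire_def)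
  have b: "entire_coeffs ?b" by (rule entire_coeffs_divide) fact+
  have "psum ?b 0 > 0" using c assms by simp
  then have "eventually (\<lambda>z. psum ?b z > 0) (nhds 0)"
    using DERIV_isCont[OF psum_has_derivative[OF b, of 0]] order_tendstoD(1)
    unfolding isCont_def tendsto_at_iff_tendsto_nhds by blast
  then obtain e where e: "e > 0" "\<And>z. \<bar>z\<bar> < e \<Longrightarrow> psum ?b z > 0"
    by (auto simp: eventually_nhds_metric dist_real_def)
  have "psum ?b z > 0" if "z \<ge> 0" for z
  proof (cases "z < e")
    case True then show ?thesis using e that by auto
  next
    case False
    have "(e/2) powr p * psum ?b (e/2) \<le> z powr p * psum ?b z"
    proof (rule DERIV_nonneg_imp_nondecreasing[of "e/2" z])
      show "e/2 \<le> z" using False e(1) by linarith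
      fix x assume "e/2 \<le> x" "x \<le> z"
      then have "x > 0" using e(1) by linarith
      then have "0 \<le> x powr (p - 1) * psum c x" using c(3)[of x] by simp
      then show "\<exists>y. ((\<lambda>z. z powr p * psum ?b z) has_real_derivative y) (at x) \<and> 0 \<le> y"
        using psum_divide_has_derivative[OF c(1) assms(2) \<open>x > 0\<close>] by blast
    qed
    moreover have "0 < (e/2) powr p * psum ?b (e/2)" using e by auto
    ultimately have "0 < z powr p * psum ?b z" by linarith
    then show ?thesis by (simp add: zero_less_mult_iff)
  qed
  then show ?thesis using b by (simp add: pos_entire_def)
qed

section \<open>Multipliers given by balanced quotients\<close>

lemma psum_add:
  "entire_coeffs c \<Longrightarrow> entire_coeffs d \<Longrightarrow> psum (\<lambda>k. c k + d k) z = psum c z + psum d z"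
  unfolding psum_def by (subst suminf_add) (auto simp: entire_coeffs_def algebra_simps)

lemma entire_coeffs_add:
  "entire_coeffs c \<Longrightarrow> entire_coeffs d \<Longrightarrow> entire_coeffs (\<lambda>k. c k + d k)"
  unfolding entire_coeffs_def by (auto simp: algebra_simps intro: summable_add)

lemma entire_coeffs_cmult: "entire_coeffs c \<Longrightarrow> entire_coeffs (\<lambda>k. C * c k)"
  unfolding entire_coeffs_def by (auto simp: mult.assoc intro: summable_mult)

lemma psum_cmult: "entire_coeffs c \<Longrightarrow> psum (\<lambda>k. C * c k) z = C * psum c z"
  unfolding psum_def by (subst suminf_mult [symmetric]) (auto simp: entire_coeffs_def mult.assoc)

lemma pos_entire_cmult: "pos_entire c \<Longrightarrow> C > 0 \<Longrightarrow> pos_entire (\<lambda>k. C * c k)"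
  by (auto simp: pos_entire_def entire_coeffs_cmult psum_cmult)

lemma nonneg_entire_cmult: "nonneg_entire c \<Longrightarrow> C > 0 \<Longrightarrow> nonneg_entire (\<lambda>k. C * c k)"
  by (auto simp: nonneg_entire_def entire_coeffs_cmult psum_cmult)

lemma pos_entire_divide2:
  assumes "nonneg_entire c" "p > 0" "q > 0"
  shows "pos_entire (\<lambda>k. c k / ((p + real k) * (q + real k)))"
  using pos_entire_divide[OF pos_entire_imp_nonneg[OF pos_entire_divide[OF assms(1,2)]] assms(3)]
  by simp

text \<open>With equal sums the two quadratic polynomials in k have the same linear term and differ
  by the constant p' q' - p q. The quotient is therefore the identity plus a multiple of two
  successive divisions.\<close>

lemma quotient_factor_eq:
  fixes p q p' q' :: real
  assumes "p > 0" "q > 0" "p + q = p' + q'"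
  shows "x * ((p' + real k) * (q' + real k) / ((p + real k) * (q + real k)))
    = x + (p' * q' - p * q) * (x / ((p + real k) * (q + real k)))"
proof -
  have "p + real k \<noteq> 0" "q + real k \<noteq> 0" using assms by auto
  then have nz: "(p + real k) * (q + real k) \<noteq> 0" by simp
  have "(p' + real k) * (q' + real k) = (p + real k) * (q + real k) + (p' * q' - p * q)"
    using assms(3) by algebra
  moreover have "x * ((P + C) / P) = x + C * (x / P)" if "P \<noteq> 0" for P C :: real
    using that by (simp add: field_simps)
  ultimately show ?thesis using nz by simp
qed

lemma nonneg_entire_add:
  assumes "nonneg_entire c" "pos_entire d" "C \<ge> 0"
  shows "nonneg_entire (\<lambda>k. c k + C * d k)"
proof -
  have d: "entire_coeffs d" "\<And>z. z \<ge> 0 \<Longrightarrow> psum d z > 0" and c: "entire_coeffs c" "c 0 > 0" "\<And>z. z \<ge> 0 \<Longrightarrow> psum c z \<ge> 0"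
    using assms by (auto simp: nonneg_entire_def pos_entire_def)
  have "d 0 > 0" using d(2)[of 0] by simp
  then have "c 0 + C * d 0 > 0" using c(2) assms(3) by (simp add: add_pos_nonneg)
  moreover have "psum (\<lambda>k. c k + C * d k) z = psum c z + C * psum d z" for z
    using c(1) d(1) by (simp add: psum_add psum_cmult entire_coeffs_cmult)
  moreover have "psum c z + C * psum d z \<ge> 0" if "z \<ge> 0" for z
    using c(3)[OF that] d(2)[OF that] assms(3) by (simp add: add_nonneg_nonneg)
  ultimately show ?thesis using c d by (simp add: nonneg_entire_def entire_coeffs_add entire_coeffs_cmult)
qed

lemma pos_entire_add:
  assumes "nonneg_entire c" "pos_entire d" "C > 0"
  shows "pos_entire (\<lambda>k. c k + C * d k)"
proof -
  have d: "entire_coeffs d" "\<And>z. z \<ge> 0 \<Longrightarrow> psum d z > 0" and c: "entire_coeffs c" "\<And>z. z \<ge> 0 \<Longrightarrow> psum c z \<ge> 0"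
    using assms by (auto simp: nonneg_entire_def pos_entire_def)
  have "psum (\<lambda>k. c k + C * d k) z = psum c z + C * psum d z" for z
    using c(1) d(1) by (simp add: psum_add psum_cmult entire_coeffs_cmult)
  moreover have "psum c z + C * psum d z > 0" if "z \<ge> 0" for z
    using c(2)[OF that] d(2)[OF that] assms(3) by (simp add: add_nonneg_pos)
  ultimately show ?thesis using c d by (simp add: pos_entire_def entire_coeffs_add entire_coeffs_cmult)
qed

lemma nonneg_entire_factor:
  assumes "nonneg_entire c" "p > 0" "q > 0" "p + q = p' + q'" "p * q \<le> p' * q'"
  shows "nonneg_entire (\<lambda>k. c k * ((p' + real k) * (q' + real k) / ((p + real k) * (q + real k))))"
  unfolding quotient_factor_eq[OF assms(2-4)]
  by (rule nonneg_entire_add[OF assms(1) pos_entire_divide2[OF assms(1-3)]]) (use assms(5) in simp)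

lemma pos_entire_factor:
  assumes "nonneg_entire c" "p > 0" "q > 0" "p + q = p' + q'" "p * q < p' * q'"
  shows "pos_entire (\<lambda>k. c k * ((p' + real k) * (q' + real k) / ((p + real k) * (q + real k))))"
  unfolding quotient_factor_eq[OF assms(2-4)]
  by (rule pos_entire_add[OF assms(1) pos_entire_divide2[OF assms(1-3)]]) (use assms(5) in simp)

text \<open>Both orders of splitting the Pochhammer symbol with N + k factors are compared. This
  identifies the first N factors of the infinite product for the multiplier.\<close>

lemma pochhammer_shift_ratio:
  fixes p :: real
  assumes "p > 0"
  shows "pochhammer (p + real N) k / pochhammer p k = (\<Prod>i<N. (p + real i + real k) / (p + real i))"
proof -
  have *: "pochhammer p n = (\<Prod>i<n. p + real i)" for n
    by (simp add: pochhammer_prod atLeast0LessThan)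
  have pos: "pochhammer p n > 0" for n by (rule pochhammer_pos) fact
  have "pochhammer p N * pochhammer (p + real N) k = pochhammer p k * pochhammer (p + real k) N"
    using pochhammer_product'[of p N k] pochhammer_product'[of p k N] by (simp add: add.commute)
  then have "pochhammer (p + real N) k / pochhammer p k = pochhammer (p + real k) N / pochhammer p N"
    using pos[of N] pos[of k] by (simp add: field_simps)
  then show ?thesis
    by (simp add: * pochhammer_prod atLeast0LessThan prod_dividef add_ac)
qed

text \<open>For fixed k there are 2k linear factors in N above and below, and each matched pair has
  quotient tending to 1. This is the error of truncating the infinite product after N
  factors.\<close>

lemma pochhammer_shift_tendsto:
  fixes p q p' q' :: real
  shows "(\<lambda>N. pochhammer (p + real N) k * pochhammer (q + real N) k /
    (pochhammer (p' + real N) k * pochhammer (q' + real N) k)) \<longlonglongrightarrow> 1"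
proof -
  have 1: "(\<lambda>N. (s + real N) / (s' + real N)) \<longlonglongrightarrow> 1" for s s' :: real
  proof -
    have *: "filterlim (\<lambda>N. s' + real N) at_top sequentially"
      by (intro filterlim_tendsto_add_at_top[OF tendsto_const] filterlim_real_sequentially)
    have "(\<lambda>N. 1 + (s - s') / (s' + real N)) \<longlonglongrightarrow> 1 + 0"
      by (intro tendsto_add tendsto_const tendsto_divide_0[OF tendsto_const]
          filterlim_at_top_imp_at_infinity *)
    moreover have "\<forall>\<^sub>F N in sequentially. 1 + (s - s') / (s' + real N) = (s + real N) / (s' + real N)"
      using filterlim_at_top_dense[THEN iffD1, OF *, rule_format, of 0]
      by eventually_elim (simp add: field_simps)
    ultimately show ?thesis by (simp add: filterlim_cong)
  qed
  have 2: "(\<lambda>N. pochhammer (s + real N) k / pochhammer (s' + real N) k) \<longlonglongrightarrow> 1" for s s' :: real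
  proof -
    have "(\<lambda>N. \<Prod>i<k. ((s + real i) + real N) / ((s' + real i) + real N)) \<longlonglongrightarrow> (\<Prod>i<k. 1)"
      by (intro tendsto_prod 1)
    then show ?thesis by (simp add: pochhammer_prod atLeast0LessThan prod_dividef add_ac)
  qed
  show ?thesis using tendsto_mult[OF 2[of p p'] 2[of q q']] by simp
qed

text \<open>Shifting all four parameters by N adds (p + q) N + N^2 to both products, so equal sums
  keep the gap p' q' - p q unchanged and every factor can be treated alike.\<close>

lemma nonneg_entire_prod:
  assumes "nonneg_entire c" "p > 0" "q > 0" "p + q = p' + q'" "p * q \<le> p' * q'"
  shows "nonneg_entire (\<lambda>k. c k * (\<Prod>i<N. (p' + real i + real k) * (q' + real i + real k) /
     ((p + real i + real k) * (q + real i + real k))))"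
proof (induction N)
  case 0 then show ?case using assms by simp
next
  case (Suc N)
  have "(p + real N) * (q + real N) \<le> (p' + real N) * (q' + real N)"
  proof -
    have "(p + real N) * (q + real N) = p * q + (p + q) * real N + real N * real N" for p q
      by (simp add: algebra_simps)
    then show ?thesis using assms(4,5) by simp
  qed
  with nonneg_entire_factor[OF Suc.IH, of "p + real N" "q + real N" "p' + real N" "q' + real N"]
  show ?case using assms by (simp add: mult.assoc)
qed

text \<open>
  The pairs with equal sums make the infinite product of the factors
  \<open>(p' + i + k) (q' + i + k) / ((p + i + k) (q + i + k))\<close> converge, and each factor exceeds 1
  by a positive multiple of \<open>1 / ((p + i + k) (q + i + k))\<close>.
\<close>
lemma nonneg_entire_transfer:
  assumes "nonneg_entire c" "p > 0" "q > 0" "p' > 0" "q' > 0" "p + q = p' + q'" "p * q \<le> p' * q'"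
  shows "nonneg_entire (\<lambda>k. c k * (pochhammer p k * pochhammer q k / (pochhammer p' k * pochhammer q' k)))"
    (is "nonneg_entire (\<lambda>k. c k * ?m k)")
proof -
  define f where "f i k = (p' + real i + real k) * (q' + real i + real k) /
     ((p + real i + real k) * (q + real i + real k))" for i k :: nat
  \<comment> \<open>Dividing by the value at k = 0 bounds every factor by 1 and turns the limit,
    otherwise a quotient of Gamma values, into the quotient of Pochhammer symbols.\<close>
  define g where "g N k = (\<Prod>i<N. f i k / f i 0)" for N k
  have fpos: "f i k > 0" for i k using assms unfolding f_def
    by (intro divide_pos_pos mult_pos_pos) auto
  have f_eq: "f i k = 1 + (p' * q' - p * q) / ((p + real i + real k) * (q + real i + real k))" for i k
  proof -
    have "p + real i + real k \<noteq> 0" "q + real i + real k \<noteq> 0" using assms by auto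
    then have nz: "(p + real i + real k) * (q + real i + real k) \<noteq> 0" by simp
    have "(p' + real i + real k) * (q' + real i + real k)
        = (p + real i + real k) * (q + real i + real k) + (p' * q' - p * q)"
      using assms(6) by algebra
    then show ?thesis by (simp only: f_def add_divide_distrib divide_self[OF nz])
  qed
  have fle: "f i k \<le> f i 0" for i k unfolding f_eq
    using assms by (intro add_left_mono divide_left_mono mult_mono mult_pos_pos) auto
  have "0 \<le> f i k / f i 0 \<and> f i k / f i 0 \<le> 1" for i k
    using fpos[of i k] fpos[of i 0] fle[of i k] by simp
  then have g01: "0 \<le> g N k" "g N k \<le> 1" for N k unfolding g_def
    by (auto intro!: prod_nonneg prod_le_1)
  have pos: "pochhammer x k > 0" if "x > 0" for x :: real and k by (rule pochhammer_pos) fact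
  have g_eq: "g N k = ?m k * (pochhammer (p' + real N) k * pochhammer (q' + real N) k /
    (pochhammer (p + real N) k * pochhammer (q + real N) k))" for N k
  proof -
    have "g N k = ((\<Prod>i<N. (p' + real i + real k) / (p' + real i)) * (\<Prod>i<N. (q' + real i + real k) / (q' + real i)))
      / ((\<Prod>i<N. (p + real i + real k) / (p + real i)) * (\<Prod>i<N. (q + real i + real k) / (q + real i)))"
      unfolding g_def f_def prod.distrib[symmetric] prod_dividef[symmetric]
      by (intro prod.cong) (auto simp: field_simps)
    also have "\<dots> = pochhammer (p' + real N) k / pochhammer p' k * (pochhammer (q' + real N) k / pochhammer q' k) /
        (pochhammer (p + real N) k / pochhammer p k * (pochhammer (q + real N) k / pochhammer q k))"
      using assms by (simp add: pochhammer_shift_ratio)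
    finally show ?thesis using pos assms by (simp add: field_simps)
  qed
  have lim: "(\<lambda>N. g N k) \<longlonglongrightarrow> ?m k" for k
    unfolding g_eq using tendsto_mult[OF tendsto_const[of "?m k"] pochhammer_shift_tendsto[of p' k q' p q]]
    by (simp only: mult_1_right)
  have m01: "0 \<le> ?m k" "?m k \<le> 1" for k
    by (rule LIMSEQ_le_const[OF lim], use g01 in blast) (rule LIMSEQ_le_const2[OF lim], use g01 in blast)
  have c: "entire_coeffs c" "c 0 > 0" using assms by (auto simp: nonneg_entire_def)
  have ng: "0 \<le> psum (\<lambda>k. c k * g N k) z" if "z \<ge> 0" for N z
  proof -
    have "0 < 1 / (\<Prod>i<N. f i 0)" using fpos by (simp add: prod_pos)
    with nonneg_entire_prod[OF assms(1-3,6,7), of N, folded f_def]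
    have "nonneg_entire (\<lambda>k. (1 / (\<Prod>i<N. f i 0)) * (c k * (\<Prod>i<N. f i k)))"
      by (rule nonneg_entire_cmult)
    moreover have "(1 / (\<Prod>i<N. f i 0)) * (c k * (\<Prod>i<N. f i k)) = c k * g N k" for k
      by (simp add: g_def prod_dividef)
    ultimately show ?thesis using that by (simp add: nonneg_entire_def)
  qed
  have "psum (\<lambda>k. c k * ?m k) z \<ge> 0" if "z \<ge> 0" for z
  proof (rule LIMSEQ_le_const)
    \<comment> \<open>The bound \<open>g N k \<le> 1\<close> is uniform in N, so the coefficients of
      c themselves give a summable majorant for interchanging limit and sum.\<close>
    have "((\<lambda>N. suminf (\<lambda>k. c k * g N k * z ^ k)) \<longlonglongrightarrow> suminf (\<lambda>k. c k * ?m k * z ^ k))"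
    proof (rule tannerys_theorem[THEN conjunct2, THEN conjunct2])
      show "((\<lambda>N. c k * g N k * z ^ k) \<longlonglongrightarrow> c k * ?m k * z ^ k)" for k
        by (intro tendsto_intros lim)
      show "\<forall>\<^sub>F (k, N) in sequentially \<times>\<^sub>F sequentially. norm (c k * g N k * z ^ k) \<le> \<bar>c k\<bar> * \<bar>z\<bar> ^ k"
      proof (intro always_eventually allI, clarify)
        fix k N
        show "norm (c k * g N k * z ^ k) \<le> \<bar>c k\<bar> * \<bar>z\<bar> ^ k"
          using mult_right_mono[OF g01(2)[of N k], of "\<bar>c k\<bar> * \<bar>z\<bar> ^ k"] g01(1)[of N k]
          by (simp add: abs_mult power_abs mult_ac)
      qed
      show "summable (\<lambda>k. \<bar>c k\<bar> * \<bar>z\<bar> ^ k)" by (rule entire_coeffs_abs_summable) fact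
    qed auto
    then show "(\<lambda>N. psum (\<lambda>k. c k * g N k) z) \<longlonglongrightarrow> psum (\<lambda>k. c k * ?m k) z"
      by (simp add: psum_def)
    show "\<exists>N. \<forall>n\<ge>N. 0 \<le> psum (\<lambda>k. c k * g n k) z" using ng that by blast
  qed
  moreover have "entire_coeffs (\<lambda>k. c k * ?m k)"
    by (rule entire_coeffs_bounded_mult[OF c(1), where K = 1]) (simp only: abs_of_nonneg m01)
  ultimately show ?thesis using c by (simp add: nonneg_entire_def)
qed

text \<open>Limits of the partial products only preserve weak inequalities. The factor with i = 0 is
  therefore split off: the rest is the same multiplier with all parameters raised by 1, and this one
  factor adds a strictly positive series because its gap p' q' - p q is positive.\<close>

lemma pos_entire_transfer:
  assumes "nonneg_entire c" "p > 0" "q > 0" "p' > 0" "q' > 0" "p + q = p' + q'" "p * q < p' * q'"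
  shows "pos_entire (\<lambda>k. c k * (pochhammer p k * pochhammer q k / (pochhammer p' k * pochhammer q' k)))"
proof -
  have "(p + 1) * (q + 1) \<le> (p' + 1) * (q' + 1)" using assms by (simp add: algebra_simps)
  then have "nonneg_entire (\<lambda>k. c k * (pochhammer (p+1) k * pochhammer (q+1) k / (pochhammer (p'+1) k * pochhammer (q'+1) k)))"
    using assms by (intro nonneg_entire_transfer) auto
  note * = pos_entire_cmult[OF pos_entire_factor[OF this assms(2,3,6,7)], of "p * q / (p' * q')"]
  have P: "pos_entire (\<lambda>k. p * q / (p' * q') * (c k * (pochhammer (p+1) k * pochhammer (q+1) k / (pochhammer (p'+1) k * pochhammer (q'+1) k))
     * ((p' + real k) * (q' + real k) / ((p + real k) * (q + real k)))))"
    by (rule *) (use assms in simp)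
  have sh: "pochhammer x k = x * pochhammer (x + 1) k / (x + real k)" if "x > 0" for x :: real and k
  proof -
    have "x + real k > 0" using that by auto
    moreover have "pochhammer x (Suc k) = x * pochhammer (x + 1) k" by (rule pochhammer_rec)
    moreover have "pochhammer x (Suc k) = pochhammer x k * (x + real k)" by (rule pochhammer_Suc)
    ultimately show ?thesis by (simp add: field_simps)
  qed
  have "p * q / (p' * q') * (c k * (pochhammer (p+1) k * pochhammer (q+1) k / (pochhammer (p'+1) k * pochhammer (q'+1) k))
     * ((p' + real k) * (q' + real k) / ((p + real k) * (q + real k)))) =
     c k * (pochhammer p k * pochhammer q k / (pochhammer p' k * pochhammer q' k))" for k
  proof -
    have *: "p * q / (p' * q') * (x * (P * Q / (P' * Q')) * (s' * t' / (s * t))) =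
        x * (p * P / s * (q * Q / t) / (p' * P' / s' * (q' * Q' / t')))"
      if "s' > 0" "t' > 0" for x P Q P' Q' s t s' t' :: real
      using that by (simp add: mult_ac)
    show ?thesis
      unfolding sh[OF assms(2), of k] sh[OF assms(3), of k] sh[OF assms(4), of k] sh[OF assms(5), of k]
      by (rule *) (use assms in simp_all)
  qed
  with P show ?thesis by (simp only:)
qed

section \<open>A positive integral of Bessel functions\<close>

text \<open>\<open>psum (bessel_coeff \<mu>) (x\<^sup>2/4) = \<Gamma>(\<mu> + 1) (x/2)\<^bsup>-\<mu>\<^esup> J\<^sub>\<mu>(x)\<close>\<close>
definition bessel_coeff :: "real \<Rightarrow> nat \<Rightarrow> real" where
  "bessel_coeff \<mu> k = (- 1) ^ k / (fact k * pochhammer (\<mu> + 1) k)"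

lemma entire_bessel_coeff:
  assumes "\<mu> > -1" shows "entire_coeffs (bessel_coeff \<mu>)"
proof -
  have "entire_coeffs (\<lambda>k. 1 / fact k)"
    unfolding entire_coeffs_def using summable_exp[where 'a = real] by (simp add: field_simps)
  then have "entire_coeffs (\<lambda>k. 1 / fact k * ((- 1) ^ k / pochhammer (\<mu> + 1) k))"
  proof (rule entire_coeffs_bounded_mult)
    fix k
    have pos: "pochhammer (\<mu> + 1) k > 0" using assms by (intro pochhammer_pos) simp
    \<comment> \<open>Only the first factor \<mu> + 1 can lie below 1, all later ones exceed
      1.\<close>
    have "min 1 (\<mu> + 1) \<le> pochhammer (\<mu> + 1) k"
    proof (induction k)
      case (Suc k)
      show ?case
      proof (cases k)
        case (Suc j)
        then have "pochhammer (\<mu> + 1) k * 1 \<le> pochhammer (\<mu> + 1) k * (\<mu> + 1 + real k)"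
          using assms by (intro mult_left_mono) (auto intro!: pochhammer_nonneg)
        then show ?thesis using Suc.IH by (simp add: pochhammer_Suc)
      qed simp
    qed simp
    then show "\<bar>(- 1) ^ k / pochhammer (\<mu> + 1) k\<bar> \<le> 1 / min 1 (\<mu> + 1)"
      using pos assms by (simp add: abs_divide power_abs frac_le)
  qed
  then show ?thesis by (simp add: bessel_coeff_def[abs_def])
qed

text \<open>These are the Taylor coefficients of the square of the normalised Bessel function. After
  extracting the square of the Pochhammer symbol of \<sigma> + 1, each summand is a product of two
  generalised binomial coefficients of \<sigma> + k, and Vandermonde's identity sums them. The
  duplication formula then brings in \<sigma> + 1/2.\<close>

lemma bessel_coeff_convolution:
  fixes \<sigma> :: real
  assumes "\<sigma> > -1/2"
  shows "(\<Sum>i\<le>k. bessel_coeff \<sigma> i * bessel_coeff \<sigma> (k - i)) = (- 1) ^ k * 4 ^ k * pochhammer (\<sigma> + 1/2) k /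
    (fact k * pochhammer (\<sigma> + 1) k * pochhammer (2 * \<sigma> + 1) k)"
proof -
  have pos: "pochhammer x j > 0" if "x > 0" for x :: real and j by (rule pochhammer_pos) fact
  have s1: "\<sigma> + 1 > 0" and s2: "2 * \<sigma> + 1 > 0" using assms by simp_all
  have gb: "(\<sigma> + real k) gchoose i = pochhammer (\<sigma> + 1) k / (pochhammer (\<sigma> + 1) (k - i) * fact i)"
    if "i \<le> k" for i
  proof -
    have 1: "pochhammer (\<sigma> + 1) k = pochhammer (\<sigma> + 1) (k - i) * pochhammer (\<sigma> + 1 + real (k - i)) i"
      using pochhammer_product[of "k - i" k "\<sigma> + 1"] that by simp
    have 2: "\<sigma> + real k - real i + 1 = \<sigma> + 1 + real (k - i)" using that by (simp add: of_nat_diff)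
    have "Q / f = P * Q / (P * f)" if "P > 0" for P Q f :: real using that by simp
    then show ?thesis unfolding gbinomial_pochhammer' 1 2 by this (rule pos[OF s1])
  qed
  have "(\<Sum>i\<le>k. bessel_coeff \<sigma> i * bessel_coeff \<sigma> (k - i))
    = (\<Sum>i\<le>k. (- 1) ^ k / (pochhammer (\<sigma> + 1) k)\<^sup>2 *
        (((\<sigma> + real k) gchoose i) * ((\<sigma> + real k) gchoose (k - i))))"
  proof (rule sum.cong[OF refl])
    fix i assume "i \<in> {..k}"
    then have i: "i \<le> k" by simp
    have "(-1 :: real) ^ i * (- 1) ^ (k - i) = (- 1) ^ k" using i by (simp flip: power_add)
    then have "bessel_coeff \<sigma> i * bessel_coeff \<sigma> (k - i) = (- 1) ^ k /
       (fact i * pochhammer (\<sigma> + 1) i * (fact (k - i) * pochhammer (\<sigma> + 1) (k - i)))"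
      by (simp add: bessel_coeff_def)
    then show "bessel_coeff \<sigma> i * bessel_coeff \<sigma> (k - i) = (- 1) ^ k / (pochhammer (\<sigma> + 1) k)\<^sup>2 *
        (((\<sigma> + real k) gchoose i) * ((\<sigma> + real k) gchoose (k - i)))"
    proof -
      have "e / (f * a * (g * b)) = e / P\<^sup>2 * (P / (b * f) * (P / (a * g)))" if "P > 0" for e f a g b P :: real
        using that by (simp add: power2_eq_square)
      from this[OF pos[OF s1, of k]] show ?thesis
        unfolding \<open>bessel_coeff \<sigma> i * _ = _\<close> gb[OF i] gb[OF diff_le_self, of i] diff_diff_cancel[OF i] .
    qed
  qed
  also have "\<dots> = (- 1) ^ k / (pochhammer (\<sigma> + 1) k)\<^sup>2 * ((2 * \<sigma> + 2 * real k) gchoose k)"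
  proof -
    have "\<sigma> + real k + (\<sigma> + real k) = 2 * \<sigma> + 2 * real k" by simp
    then show ?thesis
      using gbinomial_Vandermonde[of "\<sigma> + real k" "\<sigma> + real k" k]
      by (simp only: sum_distrib_left[symmetric] atLeast0AtMost)
  qed
  also have "(2 * \<sigma> + 2 * real k) gchoose k = pochhammer (2 * \<sigma> + 1 + real k) k / fact k"
  proof -
    have "2 * \<sigma> + 2 * real k - real k + 1 = 2 * \<sigma> + 1 + real k" by simp
    then show ?thesis by (simp only: gbinomial_pochhammer')
  qed
  also have "pochhammer (2 * \<sigma> + 1 + real k) k
     = 4 ^ k * pochhammer (\<sigma> + 1/2) k * pochhammer (\<sigma> + 1) k / pochhammer (2 * \<sigma> + 1) k"
  proof -
    have "pochhammer (2 * \<sigma> + 1) k * pochhammer (2 * \<sigma> + 1 + real k) k = pochhammer (2 * (\<sigma> + 1/2)) (2 * k)"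
      using pochhammer_product'[of "2 * \<sigma> + 1" k k, symmetric] by (simp only: mult_2[symmetric]) simp
    also have "\<dots> = 4 ^ k * pochhammer (\<sigma> + 1/2) k * pochhammer (\<sigma> + 1) k"
      unfolding pochhammer_double by (simp add: power_mult add.assoc)
    finally show ?thesis using pos[of "2 * \<sigma> + 1" k] assms
      by (metis nonzero_mult_div_cancel_left less_irrefl s2)
  qed
  also have "(- 1) ^ k / (pochhammer (\<sigma> + 1) k)\<^sup>2 * (4 ^ k * pochhammer (\<sigma> + 1/2) k * pochhammer (\<sigma> + 1) k /
      pochhammer (2 * \<sigma> + 1) k / fact k) = (- 1) ^ k * 4 ^ k * pochhammer (\<sigma> + 1/2) k /
      (fact k * pochhammer (\<sigma> + 1) k * pochhammer (2 * \<sigma> + 1) k)"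
    using pos[OF s1, of k] by (simp add: power2_eq_square mult_ac)
  finally show ?thesis .
qed

text \<open>In the variable \<open>z = x\<^sup>2/4\<close> this is the series of a multiple of \<open>x\<^bsup>-2\<sigma>\<^esup> J\<^sub>\<sigma>(x/2)\<^sup>2\<close>.\<close>
lemma nonneg_entire_bessel_square:
  fixes \<sigma> :: real
  assumes "\<sigma> > -1/2"
  shows "nonneg_entire (\<lambda>k. (- 1) ^ k * pochhammer (\<sigma> + 1/2) k /
    (fact k * pochhammer (\<sigma> + 1) k * pochhammer (2 * \<sigma> + 1) k))" (is "nonneg_entire ?s")
proof -
  have e: "entire_coeffs (bessel_coeff \<sigma>)" using assms by (intro entire_bessel_coeff) simp
  \<comment> \<open>The argument z / 4 absorbs the 4^k of the convolution formula.\<close>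
  have sums: "(\<lambda>k. ?s k * z ^ k) sums (psum (bessel_coeff \<sigma>) (z / 4))\<^sup>2" for z
  proof -
    let ?a = "\<lambda>k. bessel_coeff \<sigma> k * (z / 4) ^ k"
    have "summable (\<lambda>k. norm (?a k))"
      using entire_coeffs_abs_summable[OF e, of "z / 4"] by (simp add: abs_mult power_abs)
    from Cauchy_product_sums[OF this this]
    have "(\<lambda>k. \<Sum>i\<le>k. ?a i * ?a (k - i)) sums (psum (bessel_coeff \<sigma>) (z / 4))\<^sup>2"
      by (simp add: psum_def power2_eq_square)
    moreover have "(\<Sum>i\<le>k. ?a i * ?a (k - i)) = ?s k * z ^ k" for k
    proof -
      have "(\<Sum>i\<le>k. ?a i * ?a (k - i)) = (\<Sum>i\<le>k. bessel_coeff \<sigma> i * bessel_coeff \<sigma> (k - i)) * (z / 4) ^ k"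
        unfolding sum_distrib_right
      proof (rule sum.cong[OF refl])
        fix i assume "i \<in> {..k}"
        then have "(z / 4) ^ k = (z / 4) ^ i * (z / 4) ^ (k - i)" by (simp flip: power_add)
        then show "?a i * ?a (k - i) = bessel_coeff \<sigma> i * bessel_coeff \<sigma> (k - i) * (z / 4) ^ k"
          by simp
      qed
      then show ?thesis
        unfolding bessel_coeff_convolution[OF assms] by (simp add: power_divide)
    qed
    ultimately show ?thesis by simp
  qed
  have "psum ?s z \<ge> 0" for z
    using sums_unique[OF sums[of z]] zero_le_power2[of "psum (bessel_coeff \<sigma>) (z / 4)"]
    by (simp only: psum_def)
  then show ?thesis
    using sums_summable[OF sums] by (auto simp: nonneg_entire_def entire_coeffs_def)
qed

lemma pos_entire_cmultD:
  assumes "pos_entire (\<lambda>k. C * c k)" and C: "C > 0" shows "pos_entire c"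
proof -
  have "(1 / C) * (C * x) = x" for x using C by simp
  then have "(\<lambda>k. (1 / C) * (C * c k)) = c" by (simp only:)
  moreover have "pos_entire (\<lambda>k. (1 / C) * (C * c k))"
    by (rule pos_entire_cmult[OF assms(1)]) (use C in simp)
  ultimately show ?thesis by (simp only:)
qed

text \<open>
  Here \<open>2 b = \<mu> + \<nu> + 1\<close>, and in the variable \<open>z = x\<^sup>2/4\<close> this is the series of a multiple of
  \<open>x\<^bsup>-\<mu>-\<nu>-2\<^esup> Q(x)\<close>.
\<close>
lemma pos_entire_bessel_kernel:
  fixes \<mu> :: real
  assumes "\<mu> > -1/2"
  defines "b \<equiv> (\<mu> + min (3/2) (\<mu> / 2 + 3/4) + 1) / 2"
  shows "pos_entire (\<lambda>k. bessel_coeff \<mu> k / ((b + real k) * (b + 1/2 + real k)))"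
proof -
  define \<sigma> where "\<sigma> = \<mu> / 2 + 3/4"
  have \<sigma>: "\<sigma> > 1/2" and \<mu>: "\<mu> + 1 = 2 * \<sigma> - 1/2" using assms(1) by (simp_all add: \<sigma>_def)
  let ?s = "\<lambda>k. (- 1) ^ k * pochhammer (\<sigma> + 1/2) k / (fact k * pochhammer (\<sigma> + 1) k * pochhammer (2 * \<sigma> + 1) k)"
  let ?t = "\<lambda>p q p' q' k. pochhammer p k * pochhammer q k / (pochhammer p' k * pochhammer q' k) :: real"
  have s: "nonneg_entire ?s" using \<sigma> by (intro nonneg_entire_bessel_square) simp
  have pos: "pochhammer x k > 0" if "x > 0" for x :: real and k by (rule pochhammer_pos) fact
  have b_min: "b = (\<mu> + min (3/2) \<sigma> + 1) / 2" by (simp add: b_def \<sigma>_def)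
  have b: "b > 0" using assms(1) \<sigma> unfolding b_min by (simp add: min_def)
  have rec: "pochhammer b k = b * pochhammer (b + 1) k / (b + real k)" if "b > 0" for b :: real and k
  proof -
    have "b + real k \<noteq> 0" using that by auto
    then show ?thesis using pochhammer_rec[of b k] pochhammer_Suc[of b k] by (simp add: field_simps)
  qed
  have b3: "b + 1/2 + 1 = b + 3/2" by simp
  have r1: "x * ?t b (b + 1/2) (b + 1) (b + 3/2) k = b * (b + 1/2) * (x / ((b + real k) * (b + 1/2 + real k)))" for x k
  proof -
    have *: "x * (b * P / u * (c * Q / v) / (P * Q)) = b * c * (x / (u * v))" if "P > 0" "Q > 0" for P Q c u v :: real
      using that by simp
    show ?thesis using rec[OF b, of k] rec[of "b + 1/2" k] b
      unfolding b3 by (simp only: *[OF pos pos])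
  qed
  have "pos_entire (\<lambda>k. b * (b + 1/2) * (bessel_coeff \<mu> k / ((b + real k) * (b + 1/2 + real k))))"
  proof (cases "\<sigma> \<le> 3/2")
    case True
    \<comment> \<open>In this range \<nu> = \<sigma>. The first multiplier trades
      \<open>\<sigma> + 1/2\<close> for the numerators \<open>b\<close> and \<open>b + 1/2\<close>
      and puts \<open>2 * \<sigma> - 1/2\<close>, which is \<mu> + 1, into the denominator. The
      second replaces the denominators of the square by \<open>b + 1\<close> and
      \<open>b + 3/2\<close>. As \<sigma> > 1/2, the condition \<sigma> \<le> 3/2 is exactly the
      product inequality of the first.\<close>
    then have b_eq: "b = 3 * \<sigma> / 2 - 1/4" using \<mu> by (simp add: b_min)
    have "(\<sigma> - 1/2) * (3/2 - \<sigma>) \<ge> 0" using \<sigma> True by simp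
    moreover have "(\<sigma> + 1/2) * (2 * \<sigma> - 1/2) - b * (b + 1/2) = (\<sigma> - 1/2) * (3/2 - \<sigma>) / 4"
      by (simp add: b_eq field_simps)
    ultimately have "(\<sigma> + 1/2) * (2 * \<sigma> - 1/2) - b * (b + 1/2) \<ge> 0" by simp
    then have *: "b * (b + 1/2) \<le> (\<sigma> + 1/2) * (2 * \<sigma> - 1/2)" by (simp only: diff_ge_0_iff_ge)
    have n1: "nonneg_entire (\<lambda>k. ?s k * ?t b (b + 1/2) (\<sigma> + 1/2) (2 * \<sigma> - 1/2) k)"
      by (rule nonneg_entire_transfer[OF s, of b "b + 1/2" "\<sigma> + 1/2" "2 * \<sigma> - 1/2"]) (use \<sigma> b b_eq * in linarith)+
    have "(\<sigma> - 1/2) * (\<sigma> + 1/2) > 0" using \<sigma> by simp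
    moreover have "(b + 1) * (b + 3/2) - (\<sigma> + 1) * (2 * \<sigma> + 1) = (\<sigma> - 1/2) * (\<sigma> + 1/2) / 4"
      by (simp add: b_eq field_simps)
    ultimately have "(b + 1) * (b + 3/2) - (\<sigma> + 1) * (2 * \<sigma> + 1) > 0" by simp
    then have *: "(\<sigma> + 1) * (2 * \<sigma> + 1) < (b + 1) * (b + 3/2)" by (simp only: diff_gt_0_iff_gt)
    have "pos_entire (\<lambda>k. ?s k * ?t b (b + 1/2) (\<sigma> + 1/2) (2 * \<sigma> - 1/2) k * ?t (\<sigma> + 1) (2 * \<sigma> + 1) (b + 1) (b + 3/2) k)"
      by (rule pos_entire_transfer[OF n1, of "\<sigma> + 1" "2 * \<sigma> + 1" "b + 1" "b + 3/2"]) (use \<sigma> b b_eq * in linarith)+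
    moreover have "?s k * ?t b (b + 1/2) (\<sigma> + 1/2) (2 * \<sigma> - 1/2) k * ?t (\<sigma> + 1) (2 * \<sigma> + 1) (b + 1) (b + 3/2) k =
       bessel_coeff \<mu> k * ?t b (b + 1/2) (b + 1) (b + 3/2) k" for k
    proof -
      have **: "e * A / (F * B * C) * (P * Q / (A * M)) * (B * C / (X * Y)) = e / (F * M) * (P * Q / (X * Y))"
        if "A > 0" "B > 0" "C > 0" for e A B C F P Q M X Y :: real
        using that by simp
      show ?thesis unfolding bessel_coeff_def \<mu> by (rule **) (use \<sigma> in \<open>auto intro!: pos\<close>)
    qed
    ultimately show ?thesis by (simp only: r1)
  next
    case False
    \<comment> \<open>Now \<nu> = 3/2, and the numerator parameter \<sigma> + 1/2 of the square
      already equals b. The auxiliary parameter \<open>\<sigma> + 5/2\<close> balances the sums in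
      the first multiplier and is cancelled by the second. The product inequality of the first is
      equivalent to \<sigma> \<ge> 3/2.\<close>
    then have b_eq: "b = \<sigma> + 1/2" using \<mu> by (simp add: b_min)
    have *: "(\<sigma> + 1) * (2 * \<sigma> + 1) \<le> (2 * \<sigma> - 1/2) * (\<sigma> + 5/2)" using False by (simp add: algebra_simps)
    have n1: "nonneg_entire (\<lambda>k. ?s k * ?t (\<sigma> + 1) (2 * \<sigma> + 1) (2 * \<sigma> - 1/2) (\<sigma> + 5/2) k)"
      by (rule nonneg_entire_transfer[OF s, of "\<sigma> + 1" "2 * \<sigma> + 1" "2 * \<sigma> - 1/2" "\<sigma> + 5/2"]) (use \<sigma> * in linarith)+
    have *: "(b + 1/2) * (\<sigma> + 5/2) < (b + 1) * (b + 3/2)" by (simp add: b_eq algebra_simps)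
    have "pos_entire (\<lambda>k. ?s k * ?t (\<sigma> + 1) (2 * \<sigma> + 1) (2 * \<sigma> - 1/2) (\<sigma> + 5/2) k * ?t (b + 1/2) (\<sigma> + 5/2) (b + 1) (b + 3/2) k)"
      by (rule pos_entire_transfer[OF n1, of "b + 1/2" "\<sigma> + 5/2" "b + 1" "b + 3/2"]) (use \<sigma> b b_eq * in linarith)+
    moreover have "?s k * ?t (\<sigma> + 1) (2 * \<sigma> + 1) (2 * \<sigma> - 1/2) (\<sigma> + 5/2) k * ?t (b + 1/2) (\<sigma> + 5/2) (b + 1) (b + 3/2) k =
       bessel_coeff \<mu> k * ?t b (b + 1/2) (b + 1) (b + 3/2) k" for k
    proof -
      have **: "e * A / (F * B * C) * (B * C / (M * D)) * (Q * D / (X * Y)) = e / (F * M) * (A * Q / (X * Y))"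
        if "D > 0" "B > 0" "C > 0" for e A B C F D Q M X Y :: real
        using that by simp
      show ?thesis unfolding bessel_coeff_def \<mu> b_eq by (rule **) (use \<sigma> in \<open>auto intro!: pos\<close>)
    qed
    ultimately show ?thesis by (simp only: r1)
  qed
  then show ?thesis by (rule pos_entire_cmultD) (use b in simp)
qed

section \<open>The convex decreasing weight on the unit interval\<close>

definition radial_weight :: "real \<Rightarrow> real \<Rightarrow> real \<Rightarrow> real \<Rightarrow> real" where
  "radial_weight d \<beta> \<rho> s = s powr - d * (1 - s powr \<beta>) powr \<rho>"

definition radial_weight' :: "real \<Rightarrow> real \<Rightarrow> real \<Rightarrow> real \<Rightarrow> real" where
  "radial_weight' d \<beta> \<rho> s = - d * s powr (- d - 1) * (1 - s powr \<beta>) powr \<rho>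
     - \<rho> * \<beta> * s powr - d * s powr (\<beta> - 1) * (1 - s powr \<beta>) powr (\<rho> - 1)"

lemma powr_between_0_1:
  fixes s \<beta> :: real assumes "0 < s" "s < 1" "0 < \<beta>" shows "0 < s powr \<beta>" "s powr \<beta> < 1"
  using assms powr_less_mono2[of \<beta> s 1] by auto

lemma radial_weight_has_derivative:
  assumes s: "0 < s" "s < 1" and \<beta>: "0 < \<beta>"
  shows "(radial_weight d \<beta> \<rho> has_real_derivative radial_weight' d \<beta> \<rho> s) (at s)"
proof -
  note b = powr_between_0_1[OF s \<beta>]
  show ?thesis
    unfolding radial_weight_def[abs_def] radial_weight'_def using s b
    by (auto intro!: derivative_eq_intros simp: mult_ac)
qed

text \<open>Write the weight as u v with u = s^(-d) and v = (1 - s^\<beta>)^\<rho>. In u'' v + 2 u'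
  v' + u v'' the middle term is nonnegative because both factors decrease. In v'' the conditions
  \<beta> \<le> 1 and \<rho> \<ge> 1 fix the signs of the coefficients \<rho> \<beta> (1 - \<beta>)
  and \<rho> (\<rho> - 1) \<beta>^2.\<close>

lemma radial_weight'_has_derivative:
  assumes s: "0 < s" "s < 1" and \<beta>: "0 < \<beta>" "\<beta> \<le> 1" and "0 \<le> d" "1 \<le> \<rho>"
  obtains y where "0 \<le> y" "(radial_weight' d \<beta> \<rho> has_real_derivative y) (at s)"
proof -
  note b = powr_between_0_1[OF s \<beta>(1)]
  let ?v1 = "- \<rho> * \<beta> * s powr (\<beta> - 1) * (1 - s powr \<beta>) powr (\<rho> - 1)"
  let ?v2 = "\<rho> * \<beta> * (1 - \<beta>) * s powr (\<beta> - 2) * (1 - s powr \<beta>) powr (\<rho> - 1)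
     + \<rho> * (\<rho> - 1) * \<beta>\<^sup>2 * s powr (\<beta> - 1) * s powr (\<beta> - 1) * (1 - s powr \<beta>) powr (\<rho> - 2)"
  let ?y = "d * (d + 1) * s powr (- d - 2) * (1 - s powr \<beta>) powr \<rho>
     + 2 * (- d * s powr (- d - 1)) * ?v1 + s powr - d * ?v2"
  have "(radial_weight' d \<beta> \<rho> has_real_derivative ?y) (at s)"
    unfolding radial_weight'_def[abs_def] using s b
    by (auto intro!: derivative_eq_intros simp: algebra_simps power2_eq_square)
  moreover have "0 \<le> ?y"
  proof -
    have "0 \<le> d * (d + 1) * s powr (- d - 2) * (1 - s powr \<beta>) powr \<rho>" using assms by simp
    moreover have "0 \<le> - d * s powr (- d - 1) * ?v1" using assms by simp
    moreover have "0 \<le> ?v2" using assms by (intro add_nonneg_nonneg) simp_all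
    then have "0 \<le> s powr - d * ?v2" by simp
    ultimately show ?thesis by (simp only: mult.assoc add_nonneg_nonneg mult_nonneg_nonneg zero_le_numeral)
  qed
  ultimately show ?thesis using that by blast
qed

lemma radial_weight'_nonpos:
  assumes "0 \<le> d" "0 < \<beta>" "1 \<le> \<rho>"
  shows "radial_weight' d \<beta> \<rho> s \<le> 0"
proof -
  have "0 \<le> d * s powr (- d - 1) * (1 - s powr \<beta>) powr \<rho>"
    "0 \<le> \<rho> * \<beta> * s powr - d * s powr (\<beta> - 1) * (1 - s powr \<beta>) powr (\<rho> - 1)"
    using assms by simp_all
  then show ?thesis by (simp add: radial_weight'_def)
qed

text \<open>Strictness comes from the derivative of (1 - s^\<beta>)^\<rho>, so it holds for d = 0 as
  well.\<close>

lemma radial_weight'_neg: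
  assumes "0 \<le> d" "0 < \<beta>" "1 \<le> \<rho>" "0 < s" "s < 1"
  shows "radial_weight' d \<beta> \<rho> s < 0"
proof -
  note b = powr_between_0_1[OF assms(4,5,2)]
  have "0 \<le> d * s powr (- d - 1) * (1 - s powr \<beta>) powr \<rho>"
    "0 < \<rho> * \<beta> * s powr - d * s powr (\<beta> - 1) * (1 - s powr \<beta>) powr (\<rho> - 1)"
    using assms b by simp_all
  then show ?thesis by (simp add: radial_weight'_def)
qed

text \<open>The primitive of a divided series in the variable s, with z = R s^2. It is proved from
  the Euler equation directly, which keeps R = 0, the zero frequency, inside the same
  formula.\<close>

lemma psum_square_has_derivative:
  assumes "entire_coeffs c" "p > 0" "s > 0"
  shows "((\<lambda>s. s powr (2 * p) * psum (\<lambda>k. c k / (p + real k)) (R * s\<^sup>2)) has_real_derivative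
    2 * s powr (2 * p - 1) * psum c (R * s\<^sup>2)) (at s)"
proof -
  let ?g = "psum (\<lambda>k. c k / (p + real k))"
  let ?z = "R * s\<^sup>2"
  have b: "entire_coeffs (\<lambda>k. c k / (p + real k))" by (rule entire_coeffs_divide) fact+
  let ?g' = "psum (diffs (\<lambda>k. c k / (p + real k)))"
  have "((\<lambda>s. s powr (2 * p) * ?g (R * s\<^sup>2)) has_real_derivative
     2 * p * s powr (2 * p - 1) * ?g ?z + s powr (2 * p) * (?g' ?z * (2 * R * s))) (at s)"
    using assms(3) by (auto intro!: derivative_eq_intros DERIV_chain2[OF psum_has_derivative[OF b]])
  moreover have "2 * p * s powr (2 * p - 1) * ?g ?z + s powr (2 * p) * (?g' ?z * (2 * R * s))
      = 2 * s powr (2 * p - 1) * psum c ?z"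
  proof -
    have "s powr (2 * p) = s powr (2 * p - 1) * s" using assms(3) by (simp add: powr_diff)
    then have "2 * p * s powr (2 * p - 1) * ?g ?z + s powr (2 * p) * (?g' ?z * (2 * R * s))
      = 2 * s powr (2 * p - 1) * (?z * ?g' ?z + p * ?g ?z)"
      by (simp add: algebra_simps power2_eq_square)
    then show ?thesis by (simp only: psum_divide_euler[OF assms(1,2)])
  qed
  ultimately show ?thesis by simp
qed

section \<open>Positivity of the radial integral\<close>

lemma set_integrable_powr_unit:
  fixes a :: real assumes "a > 0"
  shows "set_integrable lborel {0<..<1} (\<lambda>t. t powr (a - 1))"
proof -
  have "(\<lambda>t. t powr (a - 1)) absolutely_integrable_on {0<..<1::real}"
  proof (rule nonnegative_absolutely_integrable_1)
    show "(\<lambda>t. t powr (a - 1)) integrable_on {0<..<1::real}"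
      using integrable_on_powr_from_0[of "a - 1" 1] assms by (simp add: integrable_on_Icc_iff_Ioo)
  qed simp
  then show ?thesis
    unfolding set_integrable_def by (subst (asm) integrable_completion) auto
qed

lemma radial_integrand_integrable:
  fixes a :: real
  assumes "a > 0" "\<delta> > 0" "\<rho> \<ge> 0" "continuous_on {0..1} e"
    and [measurable]: "e \<in> borel_measurable borel"
  shows "set_integrable lborel {0<..<1} (\<lambda>t. t powr (a - 1) * (1 - t powr \<delta>) powr \<rho> * e t)"
proof -
  obtain K where K: "\<And>t. t \<in> {0..1} \<Longrightarrow> \<bar>e t\<bar> \<le> K"
    using compact_imp_bounded[OF compact_continuous_image[OF assms(4)]] unfolding bounded_iff
    by (metis compact_Icc image_eqI real_norm_def)
  have "set_integrable lborel {0<..<1} (\<lambda>t. K * t powr (a - 1))"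
    using set_integrable_powr_unit[OF assms(1)] by simp
  then show ?thesis
  proof (rule set_integrable_bound)
    show "set_borel_measurable lborel {0<..<1} (\<lambda>t. t powr (a - 1) * (1 - t powr \<delta>) powr \<rho> * e t)"
      unfolding set_borel_measurable_def by measurable
    show "AE t in lborel. t \<in> {0<..<1} \<longrightarrow>
       norm (t powr (a - 1) * (1 - t powr \<delta>) powr \<rho> * e t) \<le> norm (K * t powr (a - 1))"
    proof (intro AE_I2 impI)
      fix t :: real assume t: "t \<in> {0<..<1}"
      then have "0 \<le> 1 - t powr \<delta>" "1 - t powr \<delta> \<le> 1"
        using powr_between_0_1[of t \<delta>] assms(2) by auto
      then have "(1 - t powr \<delta>) powr \<rho> \<le> 1" using assms(3) powr_mono2[of \<rho> "1 - t powr \<delta>" 1] by simp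
      moreover have "\<bar>e t\<bar> \<le> \<bar>K\<bar>" using K[of t] t by auto
      ultimately have "(1 - t powr \<delta>) powr \<rho> * \<bar>e t\<bar> \<le> 1 * \<bar>K\<bar>" by (intro mult_mono) auto
      then have "t powr (a - 1) * ((1 - t powr \<delta>) powr \<rho> * \<bar>e t\<bar>) \<le> t powr (a - 1) * \<bar>K\<bar>"
        by (intro mult_left_mono) auto
      then show "norm (t powr (a - 1) * (1 - t powr \<delta>) powr \<rho> * e t) \<le> norm (K * t powr (a - 1))"
        by (simp add: abs_mult mult_ac)
    qed
  qed
qed

text \<open>
  In the variable \<open>s\<close> with \<open>t = s\<^sup>2\<close> the integrand is \<open>2 \<psi> Q''\<close> with \<open>Q > 0\<close> and \<open>\<psi>\<close> convex and
  decreasing, so two integrations by parts leave the positive contributions of \<open>\<psi>'' Q\<close> and of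
  \<open>- \<psi>' Q\<close> at 1.
\<close>
lemma radial_integral_pos:
  fixes \<mu> a \<delta> \<rho> R :: real
  assumes \<mu>: "\<mu> > -1/2" and \<delta>: "0 < \<delta>" "\<delta> \<le> 1/2" and \<rho>: "\<rho> \<ge> 1" and a: "a > 0"
    and a_le: "2 * a \<le> \<mu> + min (3/2) (\<mu> / 2 + 3/4) + 1" and R: "R \<ge> 0"
  defines "f \<equiv> \<lambda>t. t powr (a - 1) * (1 - t powr \<delta>) powr \<rho> * psum (bessel_coeff \<mu>) (R * t)"
  shows "set_integrable lborel {0<..<1} f" and "0 < (LINT t:{0<..<1}|lborel. f t)"
proof -
  define b where "b = (\<mu> + min (3/2) (\<mu> / 2 + 3/4) + 1) / 2"
  \<comment> \<open>The power 2a - 1 of s in the integrand is split into 2b - 1, for which the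
    kernel is known to be positive, and -d, which goes into the weight. The parameter condition is d
    \<ge> 0.\<close>
  define d where "d = 2 * b - 2 * a"
  define \<beta> where "\<beta> = 2 * \<delta>"
  have d: "d \<ge> 0" and bpos: "b > 0" and \<beta>: "0 < \<beta>" "\<beta> \<le> 1" and two_b: "2 * b = 2 * a + d"
    using a_le a \<delta> by (simp_all add: d_def b_def \<beta>_def)
  have e: "entire_coeffs (bessel_coeff \<mu>)" using \<mu> by (intro entire_bessel_coeff) simp
  have cont_e: "continuous_on A (\<lambda>t. psum (bessel_coeff \<mu>) (R * t))" for A
    by (intro continuous_on_compose2[OF continuous_on_psum[OF e, of UNIV]] continuous_intros) auto
  show int: "set_integrable lborel {0<..<1} f"
    unfolding f_def using a \<delta> \<rho> cont_e borel_measurable_continuous_onI[OF cont_e]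
    by (intro radial_integrand_integrable) auto
  \<comment> \<open>Starting from \<open>s powr (2 * b - 1)\<close> times the Bessel series, the
    primitives \<open>Q1\<close> and \<open>Q\<close> have leading powers 2b and 2b + 1. Hence the
    divisors use b and then b + 1/2, and each integration costs a factor 2 because z = R
    s^2.\<close>
  define c1 where "c1 = (\<lambda>k. bessel_coeff \<mu> k / (b + real k))"
  define c2 where "c2 = (\<lambda>k. c1 k / (b + 1/2 + real k))"
  have c1: "entire_coeffs c1" unfolding c1_def by (rule entire_coeffs_divide[OF e bpos])
  have c2: "entire_coeffs c2" unfolding c2_def by (rule entire_coeffs_divide[OF c1]) (use bpos in simp)
  have c2_pos: "psum c2 z > 0" if "z \<ge> 0" for z
    using pos_entire_bessel_kernel[OF \<mu>, folded b_def] that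
    by (simp add: pos_entire_def c2_def c1_def)
  define Q1 where "Q1 s = s powr (2 * b) * psum c1 (R * s\<^sup>2) / 2" for s
  define Q where "Q s = s powr (2 * b + 1) * psum c2 (R * s\<^sup>2) / 4" for s
  define \<psi> where "\<psi> = radial_weight d \<beta> \<rho>"
  define \<psi>' where "\<psi>' = radial_weight' d \<beta> \<rho>"
  have Q_pos: "Q s > 0" if "s > 0" for s using that R c2_pos by (simp add: Q_def)
  have Q_deriv: "(Q has_real_derivative Q1 s) (at s)" if "s > 0" for s
    using DERIV_cdivide[OF psum_square_has_derivative[OF c1 _ that, of "b + 1/2" R], of 4] bpos
    by (simp add: Q_def[abs_def] Q1_def c2_def distrib_left)
  have Q1_deriv: "(Q1 has_real_derivative s powr (2 * b - 1) * psum (bessel_coeff \<mu>) (R * s\<^sup>2)) (at s)"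
    if "s > 0" for s
    using DERIV_cdivide[OF psum_square_has_derivative[OF e bpos that, of R], of 2]
    by (simp add: Q1_def[abs_def] c1_def)
  have f_int: "f integrable_on {0..1}"
    using set_borel_integral_eq_integral(1)[OF int] by (simp add: integrable_on_Icc_iff_Ioo)
  define J where "J x = integral {0..x} f" for x
  have J_cont: "continuous_on {0..1} J" unfolding J_def by (rule indefinite_integral_continuous_1[OF f_int])
  have J0: "J 0 = 0" by (simp add: J_def)
  have J1: "J 1 = (LINT t:{0<..<1}|lborel. f t)"
    unfolding J_def set_borel_integral_eq_integral(2)[OF int] by (rule integral_open_interval_real)
  have J_deriv: "(J has_real_derivative f x) (at x)" if x: "0 < x" "x < 1" for x
  proof -
    have "isCont f x"
    proof -
      have "isCont (\<lambda>t. psum (bessel_coeff \<mu>) (R * t)) x"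
        using cont_e[of UNIV] by (simp add: continuous_on_eq_continuous_at)
      then show ?thesis unfolding f_def using x \<delta> powr_between_0_1[OF x \<delta>(1)]
        by (intro continuous_intros) auto
    qed
    then have "(J has_vector_derivative f x) (at x within ({0..1} - {}))"
      unfolding J_def using x f_int
      by (intro integral_has_vector_derivative_continuous_at) (auto intro: continuous_at_imp_continuous_at_within)
    then show ?thesis
      using x by (simp add: has_real_derivative_iff_has_vector_derivative at_within_Icc_at)
  qed
  \<comment> \<open>\<open>J (s\<^sup>2) / 2\<close> is the integral of \<psi> Q'' over (0, s), and
    the bracket is the boundary term of two integrations by parts, so D plays the role of the
    integral of \<psi>'' Q. Only the sign of its derivative is used, so \<psi>'', which may blow up
    at both ends, is never integrated.\<close>
  define D where "D s = J (s\<^sup>2) / 2 - (\<psi> s * Q1 s - \<psi>' s * Q s)" for s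
  have D_deriv: "\<exists>y\<ge>0. (\<psi>' has_real_derivative y) (at s) \<and> (D has_real_derivative y * Q s) (at s)"
    if s: "0 < s" "s < 1" for s
  proof -
    obtain y where y: "0 \<le> y" "(\<psi>' has_real_derivative y) (at s)"
      using radial_weight'_has_derivative[OF s \<beta> d \<rho>] unfolding \<psi>'_def by blast
    have s2: "0 < s\<^sup>2" "s\<^sup>2 < 1" using s by (auto simp: power_less_one_iff)
    have \<psi>_deriv: "(\<psi> has_real_derivative \<psi>' s) (at s)"
      unfolding \<psi>_def \<psi>'_def by (rule radial_weight_has_derivative[OF s \<beta>(1)])
    have "((\<lambda>s. J (s\<^sup>2)) has_real_derivative f (s\<^sup>2) * (2 * s)) (at s)"
      by (rule DERIV_chain2[where f = J and g = "\<lambda>s. s\<^sup>2", OF J_deriv[OF s2]]) (auto intro!: derivative_eq_intros)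
    then have "(D has_real_derivative f (s\<^sup>2) * (2 * s) / 2 -
       ((\<psi>' s * Q1 s + (s powr (2 * b - 1) * psum (bessel_coeff \<mu>) (R * s\<^sup>2)) * \<psi> s) - (y * Q s + Q1 s * \<psi>' s))) (at s)"
      unfolding D_def[abs_def]
      by (intro DERIV_diff DERIV_cdivide DERIV_mult \<psi>_deriv y Q_deriv[OF s(1)] Q1_deriv[OF s(1)])
    moreover have "f (s\<^sup>2) * s = s powr (2 * b - 1) * psum (bessel_coeff \<mu>) (R * s\<^sup>2) * \<psi> s"
    proof -
      have sq: "s\<^sup>2 powr x = s powr (2 * x)" for x using s by (simp add: powr_powr flip: powr_numeral)
      have "s powr (2 * (a - 1)) * s = s powr (2 * a - 1)"
        using powr_add[of s "2 * (a - 1)" 1] s by (simp add: algebra_simps)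
      moreover have "s powr (2 * a - 1) = s powr (2 * b - 1) * s powr - d"
        by (simp add: two_b flip: powr_add)
      ultimately have "s powr (2 * (a - 1)) * s = s powr (2 * b - 1) * s powr - d" by simp
      then show ?thesis unfolding f_def \<psi>_def radial_weight_def \<beta>_def sq by (simp add: mult_ac)
    qed
    ultimately show ?thesis using y by (auto simp: algebra_simps)
  qed
  have "(D \<longlongrightarrow> 0) (at_right 0)"
  proof -
    have ev: "\<forall>\<^sub>F s in at_right 0. 0 < s \<and> s < (1::real)"
      by (intro eventually_conj eventually_at_right_less eventually_at_right_real) (auto intro: eventually_at_rightI[of 0 1])
    have sq: "((\<lambda>s::real. s\<^sup>2) \<longlongrightarrow> 0) (at_right 0)" by (auto intro!: tendsto_eq_intros)
    have pw: "((\<lambda>s::real. s powr p) \<longlongrightarrow> 0) (at_right 0)" if "p > 0" for p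
    proof (rule tendsto_zero_powrI[OF _ tendsto_const _ that])
      show "((\<lambda>s::real. s) \<longlongrightarrow> 0) (at_right 0)" by (auto intro!: tendsto_eq_intros)
      show "\<forall>\<^sub>F s::real in at_right 0. 0 \<le> s" using ev by eventually_elim simp
    qed
    have ps: "((\<lambda>s. psum c (R * s\<^sup>2)) \<longlongrightarrow> psum c (R * 0)) (at_right 0)" if "entire_coeffs c" for c
      using continuous_on_psum[OF that, of UNIV]
      by (intro isCont_tendsto_compose[where g = "psum c"] tendsto_intros sq) (simp add: continuous_on_eq_continuous_at)
    have v: "((\<lambda>s. (1 - s powr \<beta>) powr p) \<longlongrightarrow> (1 - 0) powr p) (at_right 0)" for p
      by (intro tendsto_intros pw \<beta>) auto
    have "((\<lambda>s. J (s\<^sup>2)) \<longlongrightarrow> J 0) (at_right 0)"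
    proof (rule continuous_on_tendsto_compose[OF J_cont sq])
      show "\<forall>\<^sub>F s in at_right 0. s\<^sup>2 \<in> {0..1::real}"
        using ev by eventually_elim (auto simp: power_le_one_iff)
    qed auto
    moreover have "((\<lambda>s. \<psi> s * Q1 s - \<psi>' s * Q s) \<longlongrightarrow> 0) (at_right 0)"
    proof (rule Lim_transform_eventually)
      \<comment> \<open>Since 2b = 2a + d, the powers of s in \<open>Q\<close> and \<open>Q1\<close>
        offset the singularities of \<psi> and \<psi>', and what is left is s^(2a) with a > 0 times
        a convergent factor.\<close>
      let ?h = "\<lambda>s. s powr (2 * a) * ((1 - s powr \<beta>) powr \<rho> * psum c1 (R * s\<^sup>2) / 2
         + (d * (1 - s powr \<beta>) powr \<rho> + \<rho> * \<beta> * s powr \<beta> * (1 - s powr \<beta>) powr (\<rho> - 1)) * psum c2 (R * s\<^sup>2) / 4)"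
      have "(?h \<longlongrightarrow> 0 * ((1 - 0) powr \<rho> * psum c1 (R * 0) / 2
         + (d * (1 - 0) powr \<rho> + \<rho> * \<beta> * 0 * (1 - 0) powr (\<rho> - 1)) * psum c2 (R * 0) / 4)) (at_right 0)"
        by (intro tendsto_mult tendsto_add tendsto_divide tendsto_const pw v ps c1 c2) (use a \<beta> in auto)
      then show "(?h \<longlongrightarrow> 0) (at_right 0)" by simp
      show "\<forall>\<^sub>F s in at_right 0. ?h s = \<psi> s * Q1 s - \<psi>' s * Q s"
        using ev
      proof eventually_elim
        case (elim s)
        have 1: "s powr - d * s powr (2 * b) = s powr (2 * a)" by (simp add: two_b flip: powr_add)
        have 2: "s powr (- d - 1) * s powr (2 * b + 1) = s powr (2 * a)" by (simp add: two_b flip: powr_add)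
        have 3: "s powr - d * s powr (\<beta> - 1) * s powr (2 * b + 1) = s powr (2 * a) * s powr \<beta>"
        proof -
          have "- d + (\<beta> - 1) + (2 * b + 1) = 2 * a + \<beta>" using two_b by simp
          then show ?thesis by (simp only: powr_add[symmetric])
        qed
        have "\<psi> s * Q1 s - \<psi>' s * Q s =
          (s powr - d * s powr (2 * b)) * ((1 - s powr \<beta>) powr \<rho> * psum c1 (R * s\<^sup>2) / 2)
          + (s powr (- d - 1) * s powr (2 * b + 1)) * (d * (1 - s powr \<beta>) powr \<rho> * psum c2 (R * s\<^sup>2) / 4)
          + (s powr - d * s powr (\<beta> - 1) * s powr (2 * b + 1)) * (\<rho> * \<beta> * (1 - s powr \<beta>) powr (\<rho> - 1) * psum c2 (R * s\<^sup>2) / 4)"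
          unfolding \<psi>_def \<psi>'_def radial_weight_def radial_weight'_def Q_def Q1_def by (simp add: field_simps)
        then show ?case unfolding 1 2 3 by (simp add: field_simps)
      qed
    qed
    ultimately have "((\<lambda>s. J (s\<^sup>2) / 2 - (\<psi> s * Q1 s - \<psi>' s * Q s)) \<longlongrightarrow> J 0 / 2 - 0) (at_right 0)"
      by (intro tendsto_intros) auto
    then show ?thesis by (simp add: D_def[abs_def] J0)
  qed
  have D_half: "D (1/2) \<ge> 0"
  proof (rule tendsto_upperbound[OF \<open>(D \<longlongrightarrow> 0) (at_right 0)\<close>])
    have "D s \<le> D (1/2)" if "0 < s" "s < 1/2" for s
    proof (rule DERIV_nonneg_imp_nondecreasing[where f = D])
      show "s \<le> 1/2" using that by simp
      fix x assume "s \<le> x" "x \<le> 1/2"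
      then have x: "0 < x" "x < 1" using that by auto
      then show "\<exists>y. (D has_real_derivative y) (at x) \<and> 0 \<le> y"
        using D_deriv[OF x] Q_pos[OF x(1)] by (metis mult_nonneg_nonneg less_imp_le)
    qed
    then show "\<forall>\<^sub>F s in at_right 0. D s \<le> D (1/2)"
      by (intro eventually_at_rightI[of 0 "1/2"]) auto
  qed auto
  have "continuous_on {1/2..1} Q"
    using Q_deriv by (intro DERIV_continuous_on[where D = Q1]) (auto intro: has_field_derivative_at_within)
  then obtain s0 where s0: "s0 \<in> {1/2..1}" "\<And>s. s \<in> {1/2..1} \<Longrightarrow> Q s0 \<le> Q s"
    using continuous_attains_inf[of "{1/2..1::real}" Q] by auto
  \<comment> \<open>On [1/2, 1] the kernel is bounded below by m > 0. The gain from \<psi>'' on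
    [1/2, s] is then at least m (\<psi>'(s) - \<psi>'(1/2)), and the boundary term gives at least -m
    \<psi>'(s). The values at s cancel and leave -m \<psi>'(1/2). This covers at once \<rho> = 1,
    where \<psi>'' can vanish identically, and \<rho> > 1, where \<psi>' tends to 0 at 1.\<close>
  define m where "m = Q s0"
  have m: "m > 0" using Q_pos s0 by (auto simp: m_def)
  have lower: "J (s\<^sup>2) / 2 \<ge> \<psi> s * Q1 s - m * \<psi>' (1/2)" if s: "1/2 \<le> s" "s < 1" for s
  proof -
    have "D (1/2) - m * \<psi>' (1/2) \<le> D s - m * \<psi>' s"
    proof (rule DERIV_nonneg_imp_nondecreasing[where f = "\<lambda>s. D s - m * \<psi>' s", OF s(1)])
      fix x assume x': "1/2 \<le> x" "x \<le> s"
      then have x: "0 < x" "x < 1" using s by auto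
      obtain y where y: "y \<ge> 0" "(\<psi>' has_real_derivative y) (at x)" "(D has_real_derivative y * Q x) (at x)"
        using D_deriv[OF x] by blast
      have "((\<lambda>s. D s - m * \<psi>' s) has_real_derivative y * Q x - m * y) (at x)"
        by (intro DERIV_diff y DERIV_cmult)
      moreover have "y * Q x - m * y = y * (Q x - m)" by (simp add: algebra_simps)
      moreover have "Q x \<ge> m" using s0(2)[of x] x' s by (simp add: m_def)
      ultimately show "\<exists>z. ((\<lambda>s. D s - m * \<psi>' s) has_real_derivative z) (at x) \<and> 0 \<le> z"
        using y(1) by (metis diff_ge_0_iff_ge mult_nonneg_nonneg)
    qed
    then have "J (s\<^sup>2) / 2 \<ge> \<psi> s * Q1 s - \<psi>' s * (Q s - m) - m * \<psi>' (1/2)"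
      using D_half unfolding D_def[of s] by (simp add: algebra_simps)
    moreover have "\<psi>' s * (Q s - m) \<le> 0"
      using radial_weight'_nonpos[OF d \<beta>(1) \<rho>, of s] s0(2)[of s] s by (simp add: m_def \<psi>'_def mult_nonpos_nonneg)
    ultimately show ?thesis by linarith
  qed
  \<comment> \<open>At s = 1 the boundary term \<psi> Q' drops out because \<psi> tends to 0
    there.\<close>
  have "J 1 / 2 \<ge> 0 - m * \<psi>' (1/2)"
  proof (rule tendsto_le[of "at_left (1::real)"])
    have ev: "\<forall>\<^sub>F s in at_left 1. 1/2 \<le> s \<and> s < (1::real)"
      by (rule eventually_at_leftI[of "1/2"]) auto
    show "\<forall>\<^sub>F s in at_left 1. \<psi> s * Q1 s - m * \<psi>' (1/2) \<le> J (s\<^sup>2) / 2"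
      using ev by eventually_elim (use lower in auto)
    have sq: "((\<lambda>s::real. s\<^sup>2) \<longlongrightarrow> 1) (at_left 1)" by (auto intro!: tendsto_eq_intros)
    have "((\<lambda>s. J (s\<^sup>2)) \<longlongrightarrow> J 1) (at_left 1)"
    proof (rule continuous_on_tendsto_compose[OF J_cont sq])
      show "\<forall>\<^sub>F s in at_left 1. s\<^sup>2 \<in> {0..1::real}"
        using ev by eventually_elim (auto simp: power_le_one_iff)
    qed auto
    then show "((\<lambda>s. J (s\<^sup>2) / 2) \<longlongrightarrow> J 1 / 2) (at_left 1)" by (intro tendsto_intros) auto
    have id: "((\<lambda>s::real. s) \<longlongrightarrow> 1) (at_left 1)" by (auto intro!: tendsto_eq_intros)
    have "((\<lambda>s. (1 - s powr \<beta>) powr \<rho>) \<longlongrightarrow> 0) (at_left 1)"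
    proof (rule tendsto_zero_powrI[OF _ tendsto_const])
      show "((\<lambda>s::real. 1 - s powr \<beta>) \<longlongrightarrow> 0) (at_left 1)"
        by (auto intro!: tendsto_eq_intros id)
      show "\<forall>\<^sub>F s in at_left 1. 0 \<le> 1 - s powr \<beta>"
        using ev by eventually_elim (use powr_between_0_1 \<beta> in \<open>auto simp: less_imp_le\<close>)
    qed (use \<rho> in simp)
    then have "((\<lambda>s. s powr - d * (1 - s powr \<beta>) powr \<rho> * Q1 s) \<longlongrightarrow> 1 powr - d * 0 * Q1 1) (at_left 1)"
      by (intro tendsto_intros id isCont_tendsto_compose[OF DERIV_isCont[OF Q1_deriv]]) auto
    then show "((\<lambda>s. \<psi> s * Q1 s - m * \<psi>' (1/2)) \<longlongrightarrow> 0 - m * \<psi>' (1/2)) (at_left 1)"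
      by (intro tendsto_intros) (simp add: \<psi>_def radial_weight_def[abs_def])
  qed auto
  moreover have "m * \<psi>' (1/2) < 0"
    using m radial_weight'_neg[OF d \<beta>(1) \<rho>, of "1/2"] by (simp add: \<psi>'_def mult_pos_neg)
  ultimately show "0 < (LINT t:{0<..<1}|lborel. f t)" unfolding J1[symmetric] by linarith
qed

section \<open>Cosine transforms of Gaussians and of powers supported in balls\<close>

lemma pos_powr_nonneg [simp]: "0 \<le> pos_powr s p"
  by (simp add: pos_powr_def)

lemma pos_powr_measurable [measurable (raw)]:
  assumes [measurable]: "f \<in> borel_measurable M"
  shows "(\<lambda>x. pos_powr (f x) p) \<in> borel_measurable M"
  unfolding pos_powr_def by measurable

lemma pos_powr_mult:
  "c > 0 \<Longrightarrow> pos_powr (c * s) p = c powr p * pos_powr s p"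
  by (auto simp: pos_powr_def powr_mult zero_less_mult_iff)

lemma nn_integral_lborel_affine:
  fixes f :: "'a::euclidean_space \<Rightarrow> ennreal"
  assumes [measurable]: "f \<in> borel_measurable borel" and c: "c \<noteq> 0"
  shows "(\<integral>\<^sup>+x. f x \<partial>lborel) = ennreal (\<bar>c\<bar> ^ DIM('a)) * (\<integral>\<^sup>+x. f (t + c *\<^sub>R x) \<partial>lborel)"
  by (subst lborel_affine[OF c, of t])
     (simp add: nn_integral_density nn_integral_distr nn_integral_cmult)

lemma integral_lborel_affine:
  fixes f :: "'a::euclidean_space \<Rightarrow> real"
  assumes [measurable]: "f \<in> borel_measurable borel" and c: "c \<noteq> 0"
  shows "(LINT x|lborel. f x) = \<bar>c\<bar> ^ DIM('a) * (LINT x|lborel. f (t + c *\<^sub>R x))"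
  by (subst lborel_affine[OF c, of t])
     (simp add: integral_density integral_distr)

lemma nn_integral_pos_powr_exp:
  assumes "l > -1"
  shows "(\<integral>\<^sup>+t. ennreal (pos_powr (t - r) l * exp (- t)) \<partial>lborel) = ennreal (Gamma (l + 1) * exp (- r))"
proof -
  have "(\<integral>\<^sup>+t. ennreal (pos_powr (t - r) l * exp (- t)) \<partial>lborel)
      = (\<integral>\<^sup>+t. ennreal (pos_powr (r + 1 * t - r) l * exp (- (r + 1 * t))) \<partial>lborel)"
    by (subst nn_integral_real_affine[where c = 1 and t = r]) auto
  also have "\<dots> = (\<integral>\<^sup>+t. ennreal (exp (- r)) * ennreal (indicator {0..} t * t powr (l + 1 - 1) / exp t) \<partial>lborel)"
    by (intro nn_integral_cong) (auto simp: pos_powr_def indicator_def exp_diff mult_ac simp flip: ennreal_mult')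
  also have "\<dots> = ennreal (exp (- r)) * ennreal (Gamma (l + 1))"
    using assms by (subst nn_integral_cmult) (simp_all add: Gamma_conv_nn_integral_real)
  also have "\<dots> = ennreal (Gamma (l + 1) * exp (- r))" by (simp add: ennreal_mult' mult.commute)
  finally show ?thesis .
qed

lemma nn_integral_powr_exp:
  assumes "p > 0"
  shows "(\<integral>\<^sup>+t. ennreal (pos_powr t (p - 1) * exp (- t)) \<partial>lborel) = ennreal (Gamma p)"
  using nn_integral_pos_powr_exp[of "p - 1" 0] assms by simp

text \<open>
  Integrating \<open>(t - |x|\<^sup>2)\<^sub>+\<^sup>l e\<^sup>-\<^sup>t\<close> over \<open>t\<close> first gives a Gaussian, integrating over \<open>x\<close> first
  gives a power of \<open>t\<close>.
\<close>
lemma nn_integral_ball_gauss: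
  fixes h :: "'a::euclidean_space \<Rightarrow> real"
  assumes [measurable]: "h \<in> borel_measurable borel" and h: "\<And>x. 0 \<le> h x"
    and hom: "\<And>c x. c > 0 \<Longrightarrow> h (c *\<^sub>R x) = c ^ (2 * k) * h x" and l: "l > -1"
  shows "ennreal (Gamma (l + 1)) * (\<integral>\<^sup>+x. ennreal (exp (- (norm x)\<^sup>2) * h x) \<partial>lborel) =
    ennreal (Gamma (l + 1 + DIM('a) / 2 + k)) * (\<integral>\<^sup>+x. ennreal (pos_powr (1 - (norm x)\<^sup>2) l * h x) \<partial>lborel)"
proof -
  let ?A = "\<integral>\<^sup>+x. ennreal (pos_powr (1 - (norm x)\<^sup>2) l * h x) \<partial>lborel"
  \<comment> \<open>The exponent p - 1 collects l from the weight, half the dimension from the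
    volume under x = sqrt t y, and k from the homogeneity of h.\<close>
  define p where "p = l + 1 + DIM('a) / 2 + k"
  have p: "p > 0" using l by (simp add: p_def)
  have inner: "(\<integral>\<^sup>+x. ennreal (pos_powr (t - (norm x)\<^sup>2) l * h x) \<partial>lborel) = ennreal (pos_powr t (p - 1)) * ?A" for t
  proof (cases "t > 0")
    case True
    have s: "(sqrt t)\<^sup>2 = t" using True by simp
    have "(\<integral>\<^sup>+x. ennreal (pos_powr (t - (norm x)\<^sup>2) l * h x) \<partial>lborel) = ennreal (\<bar>sqrt t\<bar> ^ DIM('a)) *
       (\<integral>\<^sup>+x. ennreal (pos_powr (t - (norm (0 + sqrt t *\<^sub>R x))\<^sup>2) l * h (0 + sqrt t *\<^sub>R (x::'a))) \<partial>lborel)"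
      using True by (intro nn_integral_lborel_affine) auto
    also have "\<dots> = ennreal (\<bar>sqrt t\<bar> ^ DIM('a)) *
       (\<integral>\<^sup>+x. ennreal (t powr l * t ^ k) * ennreal (pos_powr (1 - (norm x)\<^sup>2) l * h (x::'a)) \<partial>lborel)"
    proof (intro arg_cong2[where f = "(*)"] refl nn_integral_cong)
      fix x :: 'a
      have "t - (norm (0 + sqrt t *\<^sub>R x))\<^sup>2 = t * (1 - (norm x)\<^sup>2)"
        using True by (simp add: power_mult_distrib algebra_simps)
      then have "pos_powr (t - (norm (0 + sqrt t *\<^sub>R x))\<^sup>2) l = t powr l * pos_powr (1 - (norm x)\<^sup>2) l"
        by (simp only: pos_powr_mult[OF True])
      moreover have "h (0 + sqrt t *\<^sub>R x) = t ^ k * h x"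
        using hom[of "sqrt t" x] True by (simp add: power_mult s)
      ultimately show "ennreal (pos_powr (t - (norm (0 + sqrt t *\<^sub>R x))\<^sup>2) l * h (0 + sqrt t *\<^sub>R x)) =
         ennreal (t powr l * t ^ k) * ennreal (pos_powr (1 - (norm x)\<^sup>2) l * h x)"
        using True h by (simp add: mult_ac flip: ennreal_mult)
    qed
    also have "\<dots> = ennreal (\<bar>sqrt t\<bar> ^ DIM('a)) * ennreal (t powr l * t ^ k) * ?A"
      by (subst nn_integral_cmult) (auto simp: mult.assoc)
    also have "ennreal (\<bar>sqrt t\<bar> ^ DIM('a)) * ennreal (t powr l * t ^ k) = ennreal (pos_powr t (p - 1))"
    proof -
      have "\<bar>sqrt t\<bar> ^ DIM('a) = t powr (DIM('a) / 2)"
        using True by (simp add: powr_powr flip: powr_realpow powr_half_sqrt)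
      moreover have "t ^ k = t powr k" using True by (simp add: powr_realpow)
      ultimately have "\<bar>sqrt t\<bar> ^ DIM('a) * (t powr l * t ^ k) = t powr (p - 1)"
        by (simp add: p_def algebra_simps flip: powr_add)
      then show ?thesis using True by (simp add: pos_powr_def flip: ennreal_mult)
    qed
    finally show ?thesis .
  next
    case False
    then have "pos_powr (t - (norm x)\<^sup>2) l = 0" for x :: 'a
      by (simp add: pos_powr_def not_less) (smt (verit) zero_le_power2)
    then show ?thesis using False by (simp add: pos_powr_def)
  qed
  have "ennreal (Gamma (l + 1)) * (\<integral>\<^sup>+x. ennreal (exp (- (norm x)\<^sup>2) * h x) \<partial>lborel)
     = (\<integral>\<^sup>+x. ennreal (h x) * ennreal (Gamma (l + 1) * exp (- (norm x)\<^sup>2)) \<partial>lborel)"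
    using l by (subst nn_integral_cmult[symmetric], measurable) (intro nn_integral_cong, simp add: h ennreal_mult mult_ac Gamma_real_pos less_imp_le)
  also have "\<dots> = (\<integral>\<^sup>+x. (\<integral>\<^sup>+t. ennreal (h x) * ennreal (pos_powr (t - (norm x)\<^sup>2) l * exp (- t)) \<partial>lborel) \<partial>lborel)"
    by (simp add: nn_integral_cmult flip: nn_integral_pos_powr_exp[OF l])
  also have "\<dots> = (\<integral>\<^sup>+t. (\<integral>\<^sup>+x. ennreal (h x) * ennreal (pos_powr (t - (norm x)\<^sup>2) l * exp (- t)) \<partial>lborel) \<partial>lborel)"
    by (rule lborel_pair.Fubini'[symmetric]) measurable
  also have "\<dots> = (\<integral>\<^sup>+t. ennreal (exp (- t)) * (\<integral>\<^sup>+x. ennreal (pos_powr (t - (norm x)\<^sup>2) l * h x) \<partial>lborel) \<partial>lborel)"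
    by (subst nn_integral_cmult[symmetric], measurable) (intro nn_integral_cong, simp add: h ennreal_mult mult_ac)
  also have "\<dots> = (\<integral>\<^sup>+t. ennreal (pos_powr t (p - 1) * exp (- t)) * ?A \<partial>lborel)"
    by (intro nn_integral_cong, subst inner) (simp add: mult_ac ennreal_mult)
  also have "\<dots> = ennreal (Gamma p) * ?A"
    using p by (simp add: nn_integral_multc nn_integral_powr_exp)
  finally show ?thesis by (simp add: p_def)
qed

text \<open>One-sided identity theorem: the constant term is a limit from the right, and
  differentiating lowers the index. The half-line suffices because the generating function it is
  applied to is computed at z = s^2.\<close>

lemma psum_eq_0_imp_coeff_0:
  assumes "entire_coeffs c" "\<And>z. z > 0 \<Longrightarrow> psum c z = 0"
  shows "c k = 0"
  using assms
proof (induction k arbitrary: c)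
  case 0
  have "(psum c \<longlongrightarrow> psum c 0) (at_right 0)"
    using DERIV_isCont[OF psum_has_derivative[OF 0(1), of 0]] unfolding isCont_def
    by (rule tendsto_mono[rotated]) (simp add: at_le)
  moreover have "(psum c \<longlongrightarrow> 0) (at_right 0)"
    using 0(2) by (intro tendsto_eventually eventually_at_rightI[of 0 1]) auto
  ultimately show ?case using tendsto_unique[of "at_right (0::real)"] by fastforce
next
  case (Suc k)
  have "psum (diffs c) z = 0" if "z > 0" for z
  proof -
    have "(psum c has_real_derivative 0) (at z)"
    proof (rule has_field_derivative_transform_within_open[of "\<lambda>_. 0" _ _ "{0<..}"])
      show "((\<lambda>_. 0) has_real_derivative 0) (at z)" by simp
    qed (use that Suc.prems in auto)
    then show ?thesis using psum_has_derivative[OF Suc.prems(1)] DERIV_unique by blast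
  qed
  moreover have "entire_coeffs (diffs c)"
    using termdiff_converges_all[of c] Suc.prems(1) by (simp add: entire_coeffs_def)
  ultimately have "diffs c k = 0" using Suc.IH by blast
  then show ?case by (simp add: diffs_def)
qed

text \<open>The number pi^(n/2), kept symbolic: it enters all later formulas as a positive
  factor.\<close>

definition gauss_mass :: "'a::euclidean_space itself \<Rightarrow> real" where
  "gauss_mass _ = (LINT x|(lborel :: 'a measure). exp (- (norm x)\<^sup>2))"

lemma cosh_paired: "(\<lambda>n. x ^ (2 * n) / fact (2 * n)) sums cosh x" for x :: real
proof -
  have "(\<lambda>n. if even (2 * n) then x ^ (2 * n) /\<^sub>R fact (2 * n) else 0) sums cosh x"
    by (subst sums_mono_reindex[of "(*) 2" "\<lambda>n. if even n then x ^ n /\<^sub>R fact n else 0", unfolded o_def])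
      (use cosh_converges[of x] in \<open>auto simp: strict_mono_def elim!: evenE\<close>)
  then show ?thesis by (simp add: divide_real_def mult.commute)
qed

text \<open>Finiteness is carried over from the unit ball, where the integrand is bounded, by the
  identity between ball and Gaussian moments at l = 0.\<close>

lemma nn_integral_gauss_moment_finite:
  fixes \<xi> :: "'a::euclidean_space"
  shows "(\<integral>\<^sup>+x. ennreal (exp (- (norm x)\<^sup>2) * (\<xi> \<bullet> x) ^ (2 * k)) \<partial>lborel) < \<infinity>"
proof -
  let ?g = "\<integral>\<^sup>+x. ennreal (exp (- (norm x)\<^sup>2) * (\<xi> \<bullet> x) ^ (2 * k)) \<partial>lborel"
  \<comment> \<open>With exponent 0, \<open>pos_powr\<close> is the indicator of positive arguments,
    so the weight is that of the open unit ball.\<close>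
  let ?A = "\<integral>\<^sup>+x. ennreal (pos_powr (1 - (norm x)\<^sup>2) 0 * (\<xi> \<bullet> x) ^ (2 * k)) \<partial>lborel"
  have "?A \<le> (\<integral>\<^sup>+x. ennreal (norm \<xi> ^ (2 * k)) * indicator (ball (0 :: 'a) 1) x \<partial>lborel)"
  proof (rule nn_integral_mono)
    fix x :: 'a
    show "ennreal (pos_powr (1 - (norm x)\<^sup>2) 0 * (\<xi> \<bullet> x) ^ (2 * k)) \<le> ennreal (norm \<xi> ^ (2 * k)) * indicator (ball 0 1) x"
    proof (cases "norm x < 1")
      case True
      have "\<bar>\<xi> \<bullet> x\<bar> \<le> norm \<xi> * 1"
        using True Cauchy_Schwarz_ineq2[of \<xi> x] by (meson less_imp_le mult_left_mono norm_ge_zero order_trans)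
      then have "\<bar>\<xi> \<bullet> x\<bar> ^ (2 * k) \<le> norm \<xi> ^ (2 * k)" by (intro power_mono) auto
      then show ?thesis using True by (auto simp: pos_powr_def power_even_abs intro!: ennreal_leI)
    next
      case False
      then have "1 \<le> (norm x)\<^sup>2" by (simp add: one_le_power)
      then show ?thesis by (simp add: pos_powr_def)
    qed
  qed
  also have "\<dots> < \<infinity>"
    using emeasure_lborel_ball_finite[of "0 :: 'a" 1] by (simp add: nn_integral_cmult_indicator ennreal_mult_less_top)
  finally have "ennreal (Gamma (0 + 1 + DIM('a) / 2 + k)) * ?A < \<infinity>" by (simp add: ennreal_mult_less_top)
  also have "ennreal (Gamma (0 + 1 + DIM('a) / 2 + k)) * ?A = ennreal (Gamma (0 + 1)) * ?g"
    by (rule nn_integral_ball_gauss[symmetric]) (auto simp: power_mult_distrib)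
  finally show ?thesis by simp
qed

lemma gauss_has_integral:
  "has_bochner_integral (lborel :: 'a::euclidean_space measure) (\<lambda>x. exp (- (norm x)\<^sup>2)) (gauss_mass TYPE('a))"
proof -
  have "integrable (lborel :: 'a measure) (\<lambda>x. exp (- (norm x)\<^sup>2))"
    using nn_integral_gauss_moment_finite[of "0::'a" 0] by (intro integrableI_nonneg) auto
  then show ?thesis by (simp add: has_bochner_integral_iff gauss_mass_def)
qed

lemma gauss_mass_pos: "0 < gauss_mass TYPE('a::euclidean_space)"
proof -
  have "\<not> (AE x in (lborel :: 'a measure). exp (- (norm x)\<^sup>2) = 0)"
  proof
    assume "AE x in (lborel :: 'a measure). exp (- (norm x)\<^sup>2) = 0"
    then have "ae_filter (lborel :: 'a measure) = bot" by (simp add: trivial_limit_def)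
    then show False by (simp add: ae_filter_eq_bot_iff)
  qed
  moreover have "0 \<le> gauss_mass TYPE('a)" unfolding gauss_mass_def by (intro integral_nonneg_AE) auto
  moreover have "gauss_mass TYPE('a) = 0 \<longleftrightarrow> (AE x in (lborel :: 'a measure). exp (- (norm x)\<^sup>2) = 0)"
    unfolding gauss_mass_def using gauss_has_integral[where 'a = 'a]
    by (intro integral_nonneg_eq_0_iff_AE) (auto simp: has_bochner_integral_iff)
  ultimately show ?thesis by fastforce
qed

text \<open>The moments are read off from a generating function. The integral of exp(-|x|^2) cosh(s
  \<xi> \<bullet> x) is known in closed form, cosh has only nonnegative terms in even powers, so it
  may be integrated termwise, and coefficients of s^2 are compared.\<close>

lemma gauss_moment:
  fixes \<xi> :: "'a::euclidean_space"
  shows "has_bochner_integral lborel (\<lambda>x. exp (- (norm x)\<^sup>2) * (\<xi> \<bullet> x) ^ (2 * k))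
    (gauss_mass TYPE('a) * fact (2 * k) / fact k * ((norm \<xi>)\<^sup>2 / 4) ^ k)"
proof -
  let ?G = "gauss_mass TYPE('a)" and ?r = "(norm \<xi>)\<^sup>2 / 4"
  define g where "g k = enn2real (\<integral>\<^sup>+x. ennreal (exp (- (norm x)\<^sup>2) * (\<xi> \<bullet> x) ^ (2 * k)) \<partial>lborel)" for k
  have g: "(\<integral>\<^sup>+x. ennreal (exp (- (norm x)\<^sup>2) * (\<xi> \<bullet> x) ^ (2 * k)) \<partial>lborel) = ennreal (g k)" for k
    unfolding g_def by (rule ennreal_enn2real[symmetric]) (use nn_integral_gauss_moment_finite[of \<xi> k] in simp)
  have g0: "g k \<ge> 0" for k by (simp add: g_def)
  have G: "(\<integral>\<^sup>+x. ennreal (exp (- (norm (x::'a))\<^sup>2)) \<partial>lborel) = ennreal ?G"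
    using gauss_has_integral[where 'a = 'a] by (subst nn_integral_eq_integral) (auto simp: has_bochner_integral_iff)
  \<comment> \<open>Translation by (s/2) \<xi> completes the square.\<close>
  have shift: "(\<integral>\<^sup>+x. ennreal (exp (- (norm x)\<^sup>2 + s * (\<xi> \<bullet> x))) \<partial>lborel) = ennreal (?G * exp (s\<^sup>2 * ?r))" for s
  proof -
    have "(\<integral>\<^sup>+x. ennreal (exp (- (norm x)\<^sup>2 + s * (\<xi> \<bullet> x))) \<partial>lborel) = ennreal (\<bar>1\<bar> ^ DIM('a)) *
      (\<integral>\<^sup>+x. ennreal (exp (- (norm ((s/2) *\<^sub>R \<xi> + 1 *\<^sub>R x))\<^sup>2 + s * (\<xi> \<bullet> ((s/2) *\<^sub>R \<xi> + 1 *\<^sub>R (x::'a))))) \<partial>lborel)"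
      by (intro nn_integral_lborel_affine) auto
    also have "\<dots> = (\<integral>\<^sup>+x. ennreal (exp (s\<^sup>2 * ?r)) * ennreal (exp (- (norm (x::'a))\<^sup>2)) \<partial>lborel)"
    proof -
      have "- (norm ((s/2) *\<^sub>R \<xi> + 1 *\<^sub>R x))\<^sup>2 + s * (\<xi> \<bullet> ((s/2) *\<^sub>R \<xi> + 1 *\<^sub>R x)) = s\<^sup>2 * ?r + - (norm x)\<^sup>2" for x :: 'a
        unfolding power2_norm_eq_inner by (simp add: inner_add_left inner_add_right inner_commute[of x \<xi>] power2_eq_square field_simps)
      then show ?thesis by (simp only: exp_add abs_one power_one ennreal_1 mult_1 ennreal_mult exp_ge_zero)
    qed
    also have "\<dots> = ennreal (?G * exp (s\<^sup>2 * ?r))"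
      by (subst nn_integral_cmult) (auto simp: G mult.commute simp flip: ennreal_mult'')
    finally show ?thesis .
  qed
  have sums: "(\<lambda>k. g k / fact (2 * k) * z ^ k) sums (?G * exp (z * ?r))" if "z \<ge> 0" for z
  proof -
    define s where "s = sqrt z"
    have s: "s\<^sup>2 = z" using that by (simp add: s_def)
    have "(\<Sum>k. ennreal (g k / fact (2 * k) * z ^ k)) =
       (\<Sum>k. \<integral>\<^sup>+x. ennreal (z ^ k / fact (2 * k)) * ennreal (exp (- (norm x)\<^sup>2) * (\<xi> \<bullet> x) ^ (2 * k)) \<partial>lborel)"
      using that g0 by (subst nn_integral_cmult) (auto simp: g mult.commute[of _ "g _"] simp flip: ennreal_mult)
    also have "\<dots> = (\<integral>\<^sup>+x. (\<Sum>k. ennreal (z ^ k / fact (2 * k)) * ennreal (exp (- (norm x)\<^sup>2) * (\<xi> \<bullet> x) ^ (2 * k))) \<partial>lborel)"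
      by (intro nn_integral_suminf[symmetric]) measurable
    also have "\<dots> = (\<integral>\<^sup>+x. ennreal (exp (- (norm x)\<^sup>2) * cosh (s * (\<xi> \<bullet> x))) \<partial>lborel)"
    proof (intro nn_integral_cong)
      fix x :: 'a
      have "(\<lambda>k. exp (- (norm x)\<^sup>2) * ((s * (\<xi> \<bullet> x)) ^ (2 * k) / fact (2 * k))) sums (exp (- (norm x)\<^sup>2) * cosh (s * (\<xi> \<bullet> x)))"
        by (intro sums_mult cosh_paired)
      moreover have "exp (- (norm x)\<^sup>2) * ((s * (\<xi> \<bullet> x)) ^ (2 * k) / fact (2 * k)) =
          z ^ k / fact (2 * k) * (exp (- (norm x)\<^sup>2) * (\<xi> \<bullet> x) ^ (2 * k))" for k
        by (simp add: power_mult_distrib power_mult s)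
      ultimately have *: "(\<lambda>k. z ^ k / fact (2 * k) * (exp (- (norm x)\<^sup>2) * (\<xi> \<bullet> x) ^ (2 * k))) sums (exp (- (norm x)\<^sup>2) * cosh (s * (\<xi> \<bullet> x)))"
        by (simp only:)
      have A: "(\<Sum>k. ennreal (z ^ k / fact (2 * k) * (exp (- (norm x)\<^sup>2) * (\<xi> \<bullet> x) ^ (2 * k)))) = ennreal (exp (- (norm x)\<^sup>2) * cosh (s * (\<xi> \<bullet> x)))"
        using that * by (intro suminf_ennreal_eq) auto
      then show "(\<Sum>k. ennreal (z ^ k / fact (2 * k)) * ennreal (exp (- (norm x)\<^sup>2) * (\<xi> \<bullet> x) ^ (2 * k))) = ennreal (exp (- (norm x)\<^sup>2) * cosh (s * (\<xi> \<bullet> x)))"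
      proof -
        have "ennreal (z ^ k / fact (2 * k)) * ennreal (exp (- (norm x)\<^sup>2) * (\<xi> \<bullet> x) ^ (2 * k))
          = ennreal (z ^ k / fact (2 * k) * (exp (- (norm x)\<^sup>2) * (\<xi> \<bullet> x) ^ (2 * k)))" for k
          by (rule ennreal_mult[symmetric]) (use that in auto)
        with A show ?thesis by (simp only:)
      qed
    qed
    also have "\<dots> = (\<integral>\<^sup>+x. ennreal (1/2) * (ennreal (exp (- (norm x)\<^sup>2 + s * (\<xi> \<bullet> x))) + ennreal (exp (- (norm x)\<^sup>2 + (- s) * (\<xi> \<bullet> x)))) \<partial>lborel)"
    proof (intro nn_integral_cong)
      fix x :: 'a
      have "exp (- (norm x)\<^sup>2) * cosh (s * (\<xi> \<bullet> x)) = (1/2) * (exp (- (norm x)\<^sup>2 + s * (\<xi> \<bullet> x)) + exp (- (norm x)\<^sup>2 + (- s) * (\<xi> \<bullet> x)))"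
        unfolding cosh_field_def exp_add by (simp add: algebra_simps)
      then show "ennreal (exp (- (norm x)\<^sup>2) * cosh (s * (\<xi> \<bullet> x))) = ennreal (1/2) * (ennreal (exp (- (norm x)\<^sup>2 + s * (\<xi> \<bullet> x))) + ennreal (exp (- (norm x)\<^sup>2 + (- s) * (\<xi> \<bullet> x))))"
        by (simp only: ennreal_mult' ennreal_plus exp_ge_zero zero_le_divide_1_iff zero_le_numeral)
    qed
    also have "\<dots> = ennreal (1/2) * (ennreal (?G * exp (s\<^sup>2 * ?r)) + ennreal (?G * exp ((- s)\<^sup>2 * ?r)))"
    proof -
      have "(\<integral>\<^sup>+x. ennreal (1/2) * (ennreal (exp (- (norm x)\<^sup>2 + s * (\<xi> \<bullet> x))) + ennreal (exp (- (norm x)\<^sup>2 + (- s) * (\<xi> \<bullet> x)))) \<partial>lborel)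
        = ennreal (1/2) * ((\<integral>\<^sup>+x. ennreal (exp (- (norm x)\<^sup>2 + s * (\<xi> \<bullet> x))) \<partial>lborel) + (\<integral>\<^sup>+x. ennreal (exp (- (norm x)\<^sup>2 + (- s) * (\<xi> \<bullet> x))) \<partial>lborel))"
        by (subst nn_integral_cmult, measurable) (subst nn_integral_add, measurable)
      then show ?thesis unfolding shift .
    qed
    also have "\<dots> = ennreal (?G * exp (z * ?r))"
    proof -
      have "(1/2) * (?G * exp (z * ?r) + ?G * exp (z * ?r)) = ?G * exp (z * ?r)" by simp
      moreover have "0 \<le> ?G * exp (z * ?r)" using gauss_mass_pos[where 'a = 'a] by simp
      ultimately show ?thesis
        unfolding power2_minus s by (metis ennreal_mult' ennreal_plus zero_le_divide_1_iff zero_le_numeral)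
    qed
    finally have "(\<Sum>k. ennreal (g k / fact (2 * k) * z ^ k)) = ennreal (?G * exp (z * ?r))" .
    then show ?thesis
      using that g0 gauss_mass_pos[where 'a = 'a] by (intro sums_ennreal[THEN iffD1]) (auto simp: sums_iff)
  qed
  \<comment> \<open>Difference of the two coefficient sequences; its series vanishes on the
    half-line.\<close>
  define c where "c k = g k / fact (2 * k) - ?G * ?r ^ k / fact k" for k
  have sums_c: "(\<lambda>k. c k * z ^ k) sums 0" if "z \<ge> 0" for z
  proof -
    have "(\<lambda>k. ?G * ((z * ?r) ^ k /\<^sub>R fact k)) sums (?G * exp (z * ?r))"
      by (intro sums_mult exp_converges)
    from sums_diff[OF sums[OF that] this]
    have "(\<lambda>k. g k / fact (2 * k) * z ^ k - ?G * ((z * ?r) ^ k /\<^sub>R fact k)) sums 0" by simp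
    moreover have "g k / fact (2 * k) * z ^ k - ?G * ((z * ?r) ^ k /\<^sub>R fact k) = c k * z ^ k" for k
      unfolding c_def power_mult_distrib by (simp add: field_simps)
    ultimately show ?thesis by simp
  qed
  have "c k = 0"
  proof (rule psum_eq_0_imp_coeff_0)
    show "entire_coeffs c" unfolding entire_coeffs_def
    proof
      fix z :: real
      show "summable (\<lambda>k. c k * z ^ k)"
        by (rule summable_norm_cancel, rule powser_insidea[of c "\<bar>z\<bar> + 1"])
          (use sums_c[of "\<bar>z\<bar> + 1"] in \<open>auto simp: sums_iff\<close>)
    qed
    show "psum c z = 0" if "z > 0" for z using sums_c[of z] that by (simp add: psum_def sums_iff)
  qed
  then have "g k = fact (2 * k) * (?G * ?r ^ k / fact k)" by (simp add: c_def nonzero_divide_eq_eq mult.commute)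
  then have "g k = ?G * fact (2 * k) / fact k * ?r ^ k" by (simp only: times_divide_eq_left times_divide_eq_right mult_ac)
  then show ?thesis
    using g[of k] g0[of k] by (intro has_bochner_integral_nn_integral) auto
qed

text \<open>The cosine series is integrated termwise. The norms of its terms integrate to m k /
  (2k)!, so summability of these numbers is the required absolute convergence.\<close>

lemma cosine_transform_sums:
  fixes w :: "'a::euclidean_space \<Rightarrow> real" and \<xi> :: 'a
  assumes [measurable]: "w \<in> borel_measurable borel" and w: "\<And>x. 0 \<le> w x"
    and m: "\<And>k. has_bochner_integral lborel (\<lambda>x. w x * (\<xi> \<bullet> x) ^ (2 * k)) (m k)"
    and sm: "summable (\<lambda>k. m k / fact (2 * k))"
  shows "integrable lborel (\<lambda>x. w x * cos (\<xi> \<bullet> x))"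
    and "(\<lambda>k. (- 1) ^ k * (m k / fact (2 * k))) sums (LINT x|lborel. w x * cos (\<xi> \<bullet> x))"
proof -
  have int: "integrable lborel (\<lambda>x. w x * (\<xi> \<bullet> x) ^ (2 * k))"
    and m_eq: "(LINT x|lborel. w x * (\<xi> \<bullet> x) ^ (2 * k)) = m k" for k
    using m[of k] by (auto simp: has_bochner_integral_iff)
  show "integrable lborel (\<lambda>x. w x * cos (\<xi> \<bullet> x))"
  proof (rule Bochner_Integration.integrable_bound)
    show "integrable lborel w" using int[of 0] by simp
    show "AE x in lborel. norm (w x * cos (\<xi> \<bullet> x)) \<le> norm (w x)"
      by (auto simp: abs_mult mult_left_le)
  qed measurable
  define f where "f k x = (- 1) ^ k / fact (2 * k) * (w x * (\<xi> \<bullet> x) ^ (2 * k))" for k x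
  have norm_f: "norm (f k x) = 1 / fact (2 * k) * (w x * (\<xi> \<bullet> x) ^ (2 * k))" for k x
    using w[of x] by (simp add: f_def abs_mult power_abs power_even_abs)
  have f_sums: "(\<lambda>k. f k x) sums (w x * cos (\<xi> \<bullet> x))" for x
    using sums_mult[OF cos_paired[of "\<xi> \<bullet> x"], of "w x"] by (simp add: f_def mult_ac)
  have "(\<lambda>k. integral\<^sup>L lborel (f k)) sums (LINT x|lborel. (\<Sum>k. f k x))"
  proof (rule sums_integral)
    show "integrable lborel (f k)" for k
      unfolding f_def[abs_def] by (intro integrable_mult_right int)
    show "AE x in lborel. summable (\<lambda>k. norm (f k x))"
      unfolding norm_f
    proof (intro AE_I2)
      fix x
      show "summable (\<lambda>k. 1 / fact (2 * k) * (w x * (\<xi> \<bullet> x) ^ (2 * k)))"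
        using sums_summable[OF sums_mult[OF cosh_paired[of "\<xi> \<bullet> x"], of "w x"]] by (simp add: mult_ac)
    qed
    show "summable (\<lambda>k. LINT x|lborel. norm (f k x))"
      unfolding norm_f using sm by (simp add: m_eq)
  qed
  moreover have "integral\<^sup>L lborel (f k) = (- 1) ^ k * (m k / fact (2 * k))" for k
    unfolding f_def[abs_def] by (simp add: m_eq)
  moreover have "(\<Sum>k. f k x) = w x * cos (\<xi> \<bullet> x)" for x
    using f_sums by (rule sums_unique[symmetric])
  ultimately show "(\<lambda>k. (- 1) ^ k * (m k / fact (2 * k))) sums (LINT x|lborel. w x * cos (\<xi> \<bullet> x))"
    by simp
qed

lemma gauss_cosine_transform:
  fixes \<xi> :: "'a::euclidean_space"
  shows "integrable lborel (\<lambda>x. exp (- (norm x)\<^sup>2) * cos (\<xi> \<bullet> x))"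
    and "(LINT x|lborel. exp (- (norm x)\<^sup>2) * cos (\<xi> \<bullet> x)) = gauss_mass TYPE('a) * exp (- (norm \<xi>)\<^sup>2 / 4)"
proof -
  let ?G = "gauss_mass TYPE('a)" and ?r = "(norm \<xi>)\<^sup>2 / 4"
  have m: "?G * fact (2 * k) / fact k * ?r ^ k / fact (2 * k) = ?G * (?r ^ k /\<^sub>R fact k)" for k
    by (simp add: field_simps)
  have "summable (\<lambda>k. ?G * fact (2 * k) / fact k * ?r ^ k / fact (2 * k))"
    unfolding m by (intro summable_mult sums_summable[OF exp_converges])
  note * = cosine_transform_sums[OF _ _ gauss_moment this]
  show "integrable lborel (\<lambda>x. exp (- (norm x)\<^sup>2) * cos (\<xi> \<bullet> x))"
    by (rule *(1)) auto
  have 1: "(\<lambda>k. (- 1) ^ k * (?G * (?r ^ k /\<^sub>R fact k))) sums (LINT x|lborel. exp (- (norm x)\<^sup>2) * cos (\<xi> \<bullet> x))"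
    using *(2) unfolding m by auto
  have "(\<lambda>k. ?G * ((- ?r) ^ k /\<^sub>R fact k)) sums (?G * exp (- ?r))"
    by (intro sums_mult exp_converges)
  moreover have "?G * ((- ?r) ^ k /\<^sub>R fact k) = (- 1) ^ k * (?G * (?r ^ k /\<^sub>R fact k))" for k
    unfolding power_minus[of ?r] by (simp add: mult_ac)
  ultimately have "(\<lambda>k. (- 1) ^ k * (?G * (?r ^ k /\<^sub>R fact k))) sums (?G * exp (- ?r))" by (simp only:)
  from sums_unique2[OF 1 this] show "(LINT x|lborel. exp (- (norm x)\<^sup>2) * cos (\<xi> \<bullet> x)) = ?G * exp (- (norm \<xi>)\<^sup>2 / 4)"
    by simp
qed

text \<open>The total mass of \<open>pos_powr (1 - (norm x)\<^sup>2) l\<close>, that is, the moment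
  of order 0 in \<open>ball_moment\<close>.\<close>

definition ball_const :: "real \<Rightarrow> 'a::euclidean_space itself \<Rightarrow> real" where
  "ball_const l T = Gamma (l + 1) * gauss_mass T / Gamma (l + DIM('a) / 2 + 1)"

lemma ball_const_pos: "l > -1 \<Longrightarrow> 0 < ball_const l TYPE('a::euclidean_space)"
  unfolding ball_const_def
  by (intro divide_pos_pos mult_pos_pos Gamma_real_pos gauss_mass_pos) (auto intro: add_pos_nonneg)

lemma ball_moment:
  fixes \<xi> :: "'a::euclidean_space"
  assumes l: "l > -1"
  shows "has_bochner_integral lborel (\<lambda>x. pos_powr (1 - (norm x)\<^sup>2) l * (\<xi> \<bullet> x) ^ (2 * k))
    (ball_const l TYPE('a) * fact (2 * k) / (fact k * pochhammer (l + DIM('a) / 2 + 1) k) * ((norm \<xi>)\<^sup>2 / 4) ^ k)"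
proof -
  let ?g = "gauss_mass TYPE('a) * fact (2 * k) / fact k * ((norm \<xi>)\<^sup>2 / 4) ^ k"
  let ?A = "\<integral>\<^sup>+x. ennreal (pos_powr (1 - (norm x)\<^sup>2) l * (\<xi> \<bullet> x) ^ (2 * k)) \<partial>lborel"
  \<comment> \<open>Larger by 1 than the order l + n/2 of the Bessel function.\<close>
  define \<mu> where "\<mu> = l + DIM('a) / 2 + 1"
  have \<mu>: "\<mu> > 0" using l by (auto simp: \<mu>_def intro: add_pos_nonneg)
  have g: "(\<integral>\<^sup>+x. ennreal (exp (- (norm x)\<^sup>2) * (\<xi> \<bullet> x) ^ (2 * k)) \<partial>lborel) = ennreal ?g"
    using gauss_moment[of \<xi> k] by (subst nn_integral_eq_integral) (auto simp: has_bochner_integral_iff)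
  have Gp: "Gamma (\<mu> + k) > 0" using \<mu> by (intro Gamma_real_pos) auto
  have "Gamma (l + 1) > 0" using l by (intro Gamma_real_pos) auto
  have "ennreal (Gamma (l + 1)) * ennreal ?g = ennreal (Gamma (\<mu> + k)) * ?A"
    using nn_integral_ball_gauss[of "\<lambda>x. (\<xi> \<bullet> x) ^ (2 * k)" k l] l unfolding g
    by (simp add: \<mu>_def power_mult_distrib add_ac)
  then have "ennreal (1 / Gamma (\<mu> + k)) * (ennreal (Gamma (\<mu> + k)) * ?A) = ennreal (1 / Gamma (\<mu> + k)) * (ennreal (Gamma (l + 1)) * ennreal ?g)"
    by simp
  moreover have "ennreal (1 / Gamma (\<mu> + k)) * (ennreal (Gamma (\<mu> + k)) * ?A) = ?A"
    using Gp by (simp flip: mult.assoc ennreal_mult)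
  moreover have "ennreal (1 / Gamma (\<mu> + k)) * (ennreal (Gamma (l + 1)) * ennreal ?g) = ennreal (1 / Gamma (\<mu> + k) * (Gamma (l + 1) * ?g))"
    using Gp \<open>Gamma (l + 1) > 0\<close> gauss_mass_pos[where 'a = 'a]
    by (subst ennreal_mult, simp, simp, subst ennreal_mult) auto
  moreover have "1 / Gamma (\<mu> + k) * (Gamma (l + 1) * ?g) =
     ball_const l TYPE('a) * fact (2 * k) / (fact k * pochhammer \<mu> k) * ((norm \<xi>)\<^sup>2 / 4) ^ k"
  proof -
    have "pochhammer \<mu> k = Gamma (\<mu> + k) / Gamma \<mu>"
      using \<mu> by (intro pochhammer_Gamma) (auto dest: nonpos_Ints_nonpos)
    moreover have "Gamma \<mu> > 0" using \<mu> by (rule Gamma_real_pos)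
    ultimately show ?thesis by (simp add: ball_const_def mult_ac flip: \<mu>_def)
  qed
  ultimately have "?A = ennreal (ball_const l TYPE('a) * fact (2 * k) / (fact k * pochhammer \<mu> k) * ((norm \<xi>)\<^sup>2 / 4) ^ k)"
    by (simp only:)
  then show ?thesis
    using ball_const_pos[OF l, where 'a = 'a] \<mu> unfolding \<mu>_def[symmetric]
    by (intro has_bochner_integral_nn_integral) (auto intro!: divide_nonneg_nonneg mult_nonneg_nonneg pochhammer_nonneg)
qed

text \<open>Divided by (2k)!, the even moments of the ball weight are the absolute values of the
  Bessel coefficients times powers of |\<xi>|^2/4, and the alternating signs of the cosine series
  restore the Bessel series.\<close>

lemma ball_cosine_transform:
  fixes \<xi> :: "'a::euclidean_space"
  assumes l: "l > -1"
  shows "integrable lborel (\<lambda>x. pos_powr (1 - (norm x)\<^sup>2) l * cos (\<xi> \<bullet> x))"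
    and "(LINT x|lborel. pos_powr (1 - (norm x)\<^sup>2) l * cos (\<xi> \<bullet> x)) =
      ball_const l TYPE('a) * psum (bessel_coeff (l + DIM('a) / 2)) ((norm \<xi>)\<^sup>2 / 4)"
proof -
  let ?C = "ball_const l TYPE('a)" and ?r = "(norm \<xi>)\<^sup>2 / 4" and ?e = "bessel_coeff (l + DIM('a) / 2)"
  have \<mu>: "l + DIM('a) / 2 > -1" using l by (smt (verit) divide_nonneg_nonneg of_nat_0_le_iff)
  have e: "entire_coeffs ?e" by (rule entire_bessel_coeff[OF \<mu>])
  have abs_e: "\<bar>?e k\<bar> = 1 / (fact k * pochhammer (l + DIM('a) / 2 + 1) k)" for k
    using pochhammer_pos[of "l + DIM('a) / 2 + 1" k] \<mu> by (simp add: bessel_coeff_def abs_mult)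
  have m: "?C * fact (2 * k) / (fact k * pochhammer (l + DIM('a) / 2 + 1) k) * ?r ^ k / fact (2 * k)
     = ?C * (\<bar>?e k\<bar> * \<bar>?r\<bar> ^ k)" for k
    unfolding abs_e by simp
  have "summable (\<lambda>k. ?C * fact (2 * k) / (fact k * pochhammer (l + DIM('a) / 2 + 1) k) * ?r ^ k / fact (2 * k))"
    unfolding m by (intro summable_mult entire_coeffs_abs_summable e)
  note * = cosine_transform_sums[OF _ _ ball_moment[OF l] this]
  show "integrable lborel (\<lambda>x. pos_powr (1 - (norm x)\<^sup>2) l * cos (\<xi> \<bullet> x))"
    by (rule *(1)) auto
  have 1: "(\<lambda>k. (- 1) ^ k * (?C * (\<bar>?e k\<bar> * \<bar>?r\<bar> ^ k))) sums (LINT x|lborel. pos_powr (1 - (norm x)\<^sup>2) l * cos (\<xi> \<bullet> x))"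
    using *(2) unfolding m by auto
  have "(\<lambda>k. ?C * (?e k * ?r ^ k)) sums (?C * psum ?e ?r)"
    unfolding psum_def by (intro sums_mult summable_sums entire_coeffs_summable e)
  moreover have "?C * (?e k * ?r ^ k) = (- 1) ^ k * (?C * (\<bar>?e k\<bar> * \<bar>?r\<bar> ^ k))" for k
    unfolding abs_e by (simp add: bessel_coeff_def)
  ultimately have "(\<lambda>k. (- 1) ^ k * (?C * (\<bar>?e k\<bar> * \<bar>?r\<bar> ^ k))) sums (?C * psum ?e ?r)" by (simp only:)
  from sums_unique2[OF 1 this]
  show "(LINT x|lborel. pos_powr (1 - (norm x)\<^sup>2) l * cos (\<xi> \<bullet> x)) = ?C * psum ?e ?r" .
qed

lemma scaled_ball_cosine_transform:
  fixes \<xi> :: "'a::euclidean_space"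
  assumes l: "l > -1" and t: "t > 0"
  shows "(LINT x|lborel. pos_powr (1 - (norm x)\<^sup>2 / t) l * cos (\<xi> \<bullet> x)) =
      t powr (DIM('a) / 2) * (ball_const l TYPE('a) * psum (bessel_coeff (l + DIM('a) / 2)) ((norm \<xi>)\<^sup>2 / 4 * t))"
proof -
  have "(LINT x|lborel. pos_powr (1 - (norm x)\<^sup>2 / t) l * cos (\<xi> \<bullet> x)) = \<bar>sqrt t\<bar> ^ DIM('a) *
     (LINT x|lborel. pos_powr (1 - (norm (0 + sqrt t *\<^sub>R x))\<^sup>2 / t) l * cos (\<xi> \<bullet> (0 + sqrt t *\<^sub>R x)))"
    using t by (intro integral_lborel_affine) auto
  also have "\<dots> = \<bar>sqrt t\<bar> ^ DIM('a) * (LINT x|lborel. pos_powr (1 - (norm x)\<^sup>2) l * cos ((sqrt t *\<^sub>R \<xi>) \<bullet> x))"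
    using t by (simp add: power_mult_distrib)
  also have "\<dots> = \<bar>sqrt t\<bar> ^ DIM('a) * (ball_const l TYPE('a) * psum (bessel_coeff (l + DIM('a) / 2)) ((norm (sqrt t *\<^sub>R \<xi>))\<^sup>2 / 4))"
    by (simp only: ball_cosine_transform(2)[OF l])
  also have "(norm (sqrt t *\<^sub>R \<xi>))\<^sup>2 / 4 = (norm \<xi>)\<^sup>2 / 4 * t"
    using t by (simp add: power_mult_distrib)
  also have "\<bar>sqrt t\<bar> ^ DIM('a) = t powr (DIM('a) / 2)"
    using t by (simp add: powr_powr flip: powr_realpow powr_half_sqrt)
  finally show ?thesis .
qed

lemma nn_integral_scaled_ball:
  assumes l: "l > -1" and t: "t > 0"
  shows "(\<integral>\<^sup>+x. ennreal (pos_powr (1 - (norm (x::'a::euclidean_space))\<^sup>2 / t) l) \<partial>lborel) =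
      ennreal (t powr (DIM('a) / 2) * ball_const l TYPE('a))"
proof -
  have "(\<integral>\<^sup>+x. ennreal (pos_powr (1 - (norm (x::'a))\<^sup>2 / t) l) \<partial>lborel) = ennreal (\<bar>sqrt t\<bar> ^ DIM('a)) *
     (\<integral>\<^sup>+x. ennreal (pos_powr (1 - (norm (0 + sqrt t *\<^sub>R (x::'a)))\<^sup>2 / t) l) \<partial>lborel)"
    using t by (intro nn_integral_lborel_affine) auto
  also have "(\<integral>\<^sup>+x. ennreal (pos_powr (1 - (norm (0 + sqrt t *\<^sub>R (x::'a)))\<^sup>2 / t) l) \<partial>lborel)
     = (\<integral>\<^sup>+x. ennreal (pos_powr (1 - (norm (x::'a))\<^sup>2) l) \<partial>lborel)"
    using t by (simp add: power_mult_distrib)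
  also have "\<dots> = ennreal (ball_const l TYPE('a))"
    using ball_moment[OF l, of "0::'a" 0] by (subst nn_integral_eq_integral) (auto simp: has_bochner_integral_iff)
  also have "\<bar>sqrt t\<bar> ^ DIM('a) = t powr (DIM('a) / 2)"
    using t by (simp add: powr_powr flip: powr_realpow powr_half_sqrt)
  finally show ?thesis by (simp add: ennreal_mult')
qed

section \<open>The Fourier transform of the mixture\<close>

text \<open>A real integrand on the whole line, so that the same function can be used in nonnegative
  integrals, for finiteness, and in Bochner integrals, for the transform.\<close>

definition mix_integrand :: "real \<Rightarrow> real \<Rightarrow> real \<Rightarrow> real \<Rightarrow> 'a::euclidean_space \<Rightarrow> real \<Rightarrow> real" where
  "mix_integrand l \<alpha> \<delta> \<rho> x t = indicator {0<..} t *
     (pos_powr (1 - (norm x)\<^sup>2 / t) l * t powr \<alpha> * pos_powr (1 - t powr \<delta>) \<rho>)"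

lemma mix_integrand_nonneg: "0 \<le> mix_integrand l \<alpha> \<delta> \<rho> x t"
  by (simp add: mix_integrand_def)

lemma mix_integrand_measurable [measurable]:
  "(\<lambda>(x, t). mix_integrand l \<alpha> \<delta> \<rho> x t) \<in> borel_measurable (borel \<Otimes>\<^sub>M borel)"
  "mix_integrand l \<alpha> \<delta> \<rho> x \<in> borel_measurable borel"
  unfolding mix_integrand_def[abs_def] by measurable

lemma W_mix_eq: "W_mix l \<alpha> \<delta> \<rho> x = (\<integral>\<^sup>+t. ennreal (mix_integrand l \<alpha> \<delta> \<rho> x t) \<partial>lborel)"
  unfolding W_mix_def mix_integrand_def by (intro nn_integral_cong) (simp split: split_indicator)

text \<open>This includes a point where the integral diverges: there both sides are 0, by the
  conventions for \<open>enn2real\<close> and for the Bochner integral.\<close>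

lemma enn2real_W_mix: "enn2real (W_mix l \<alpha> \<delta> \<rho> x) = (LINT t|lborel. mix_integrand l \<alpha> \<delta> \<rho> x t)"
  unfolding W_mix_eq by (subst integral_eq_nn_integral) (simp_all add: mix_integrand_nonneg)

lemma mix_weight_eq:
  assumes "\<delta> > 0"
  shows "indicator {0<..} t * (t powr \<alpha> * pos_powr (1 - t powr \<delta>) \<rho>) =
    indicator {0<..<1} t * (t powr \<alpha> * (1 - t powr \<delta>) powr \<rho>)"
proof (cases "0 < t \<and> t < 1")
  case True
  then show ?thesis using powr_between_0_1[of t \<delta>] assms by (simp add: pos_powr_def)
next
  case False
  then have "t \<le> 0 \<or> 1 \<le> t powr \<delta>" using assms ge_one_powr_ge_zero[of t \<delta>] by auto
  then show ?thesis using False by (auto simp: pos_powr_def split: split_indicator)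
qed

text \<open>Integrating over x first yields a multiple of t^(n/2), so the mass is an integral of
  t^(\<alpha> + n/2) near 0. Its convergence is the lower bound on \<alpha>, which may well lie
  below -1.\<close>

lemma mix_integrand_integrable:
  fixes l \<alpha> \<delta> \<rho> :: real
  assumes l: "l > -1" and \<delta>: "0 < \<delta>" and \<rho>: "\<rho> \<ge> 0" and a: "\<alpha> + DIM('a) / 2 + 1 > 0"
  shows "integrable (lborel \<Otimes>\<^sub>M lborel) (\<lambda>(x :: 'a::euclidean_space, t). mix_integrand l \<alpha> \<delta> \<rho> x t)"
proof (rule integrableI_bounded)
  show "(\<lambda>(x :: 'a, t). mix_integrand l \<alpha> \<delta> \<rho> x t) \<in> borel_measurable (lborel \<Otimes>\<^sub>M lborel)"
    using mix_integrand_measurable(1) by (simp cong: measurable_cong_sets)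
  let ?C = "ball_const l TYPE('a)"
  have C: "?C \<ge> 0" using ball_const_pos[OF l, where 'a = 'a] by simp
  have inner: "(\<integral>\<^sup>+x. ennreal (mix_integrand l \<alpha> \<delta> \<rho> (x::'a) t) \<partial>lborel) =
     ennreal (indicator {0<..<1} t *\<^sub>R (t powr (\<alpha> + DIM('a) / 2 + 1 - 1) * (1 - t powr \<delta>) powr \<rho> * ?C))" for t
  proof (cases "t > 0")
    case True
    have "(\<integral>\<^sup>+x. ennreal (mix_integrand l \<alpha> \<delta> \<rho> (x::'a) t) \<partial>lborel) =
      (\<integral>\<^sup>+x. ennreal (t powr \<alpha> * pos_powr (1 - t powr \<delta>) \<rho>) * ennreal (pos_powr (1 - (norm (x::'a))\<^sup>2 / t) l) \<partial>lborel)"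
      using True by (intro nn_integral_cong) (simp add: mix_integrand_def mult_ac flip: ennreal_mult)
    also have "\<dots> = ennreal (t powr \<alpha> * pos_powr (1 - t powr \<delta>) \<rho>) * ennreal (t powr (DIM('a) / 2) * ?C)"
      using nn_integral_scaled_ball[OF l True, where 'a = 'a] by (simp add: nn_integral_cmult)
    also have "\<dots> = ennreal ((t powr \<alpha> * pos_powr (1 - t powr \<delta>) \<rho>) * (t powr (DIM('a) / 2) * ?C))"
      using C by (intro ennreal_mult[symmetric]) auto
    also have "t powr \<alpha> * pos_powr (1 - t powr \<delta>) \<rho> = indicator {0<..<1} t * (t powr \<alpha> * (1 - t powr \<delta>) powr \<rho>)"
      using mix_weight_eq[OF \<delta>, of t \<alpha> \<rho>] True by simp
    finally show ?thesis by (simp add: powr_add mult_ac)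
  qed (simp add: mix_integrand_def)
  have "(\<integral>\<^sup>+z. ennreal (norm (case z of (x :: 'a, t) \<Rightarrow> mix_integrand l \<alpha> \<delta> \<rho> x t)) \<partial>(lborel \<Otimes>\<^sub>M lborel))
     = (\<integral>\<^sup>+t. (\<integral>\<^sup>+x. ennreal (mix_integrand l \<alpha> \<delta> \<rho> (x::'a) t) \<partial>lborel) \<partial>lborel)"
    by (subst lborel_pair.nn_integral_snd[symmetric])
      (use mix_integrand_measurable(1)[of l \<alpha> \<delta> \<rho>, where 'a = 'a] in \<open>simp_all add: mix_integrand_nonneg case_prod_unfold cong: measurable_cong_sets\<close>)
  also have "\<dots> < \<infinity>"
  proof -
    have "set_integrable lborel {0<..<1} (\<lambda>t. t powr (\<alpha> + DIM('a) / 2 + 1 - 1) * (1 - t powr \<delta>) powr \<rho> * ?C)"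
      by (rule radial_integrand_integrable) (use a \<delta> \<rho> in auto)
    then show ?thesis
      unfolding inner set_integrable_def integrable_iff_bounded using C by (simp add: abs_mult)
  qed
  finally show "(\<integral>\<^sup>+z. ennreal (norm (case z of (x :: 'a, t) \<Rightarrow> mix_integrand l \<alpha> \<delta> \<rho> x t)) \<partial>(lborel \<Otimes>\<^sub>M lborel)) < \<infinity>" .
qed

lemma mix_cosine_transform_pos:
  fixes \<xi> :: "'a::euclidean_space" and l \<alpha> \<delta> \<rho> :: real
  assumes l: "l > -1" and \<delta>: "0 < \<delta>" "\<delta> \<le> 1/2" and \<rho>: "\<rho> \<ge> 1"
    and a: "- ((real DIM('a) + 2) / 2) < \<alpha>"
    and a1: "\<alpha> \<le> 1/4 * (3 * l - (real DIM('a) + 1) / 2)" and a2: "\<alpha> \<le> 1/2 * (l - (real DIM('a) - 1) / 2)"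
  shows "integrable lborel (\<lambda>x::'a. LINT t|lborel. mix_integrand l \<alpha> \<delta> \<rho> x t)"
    and "0 < (LINT x|lborel. (LINT t|lborel. mix_integrand l \<alpha> \<delta> \<rho> x t) * cos (\<xi> \<bullet> x))"
proof -
  let ?F = "mix_integrand l \<alpha> \<delta> \<rho>"
  define n where "n = real DIM('a)"
  have n: "n \<ge> 1" using DIM_positive[where 'a = 'a] unfolding n_def by linarith
  define \<mu> where "\<mu> = l + n / 2"
  \<comment> \<open>The exponent of t after the x-integration is a0 - 1: \<alpha> from the mixing
    weight and n/2 from the scaled ball.\<close>
  define a0 where "a0 = \<alpha> + n / 2 + 1"
  have \<mu>: "\<mu> > -1/2" using l n unfolding \<mu>_def by linarith
  have a0: "a0 > 0" using a by (simp add: a0_def n_def field_simps)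
  \<comment> \<open>These are the second and the first entry of the minimum in
    \<open>param_region\<close>, in this order.\<close>
  have "2 * a0 \<le> \<mu> + 3/2 + 1" "2 * a0 \<le> \<mu> + (\<mu> / 2 + 3/4) + 1"
    using a1 a2 by (auto simp: \<mu>_def a0_def n_def[symmetric] field_simps)
  then have a0_le: "2 * a0 \<le> \<mu> + min (3/2) (\<mu> / 2 + 3/4) + 1" by (simp add: min_def)
  have int: "integrable (lborel \<Otimes>\<^sub>M lborel) (\<lambda>(x :: 'a, t). ?F x t)"
    using l \<delta> \<rho> a0 by (intro mix_integrand_integrable) (auto simp: a0_def n_def)
  show "integrable lborel (\<lambda>x::'a. LINT t|lborel. ?F x t)"
    using lborel_pair.integrable_fst[OF int] .
  have int_cos: "integrable (lborel \<Otimes>\<^sub>M lborel) (\<lambda>(x :: 'a, t). ?F x t * cos (\<xi> \<bullet> x))"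
  proof (rule Bochner_Integration.integrable_bound[OF int])
    show "(\<lambda>(x, t). ?F x t * cos (\<xi> \<bullet> x)) \<in> borel_measurable (lborel \<Otimes>\<^sub>M lborel)"
      using mix_integrand_measurable(1)[of l \<alpha> \<delta> \<rho>, where 'a = 'a] by (simp add: case_prod_unfold cong: measurable_cong_sets)
    show "AE z in lborel \<Otimes>\<^sub>M lborel. norm (case z of (x, t) \<Rightarrow> ?F x t * cos (\<xi> \<bullet> x)) \<le> norm (case z of (x, t) \<Rightarrow> ?F x t)"
      by (auto simp: abs_mult mult_left_le)
  qed
  let ?C = "ball_const l TYPE('a)" and ?R = "(norm \<xi>)\<^sup>2 / 4"
  have inner: "(LINT x|lborel. ?F x t * cos (\<xi> \<bullet> x)) =
     ?C * (indicator {0<..<1} t *\<^sub>R (t powr (a0 - 1) * (1 - t powr \<delta>) powr \<rho> * psum (bessel_coeff \<mu>) (?R * t)))" for t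
  proof (cases "t > 0")
    case True
    have "(LINT x|lborel. ?F x t * cos (\<xi> \<bullet> x)) =
      (LINT x|lborel. t powr \<alpha> * pos_powr (1 - t powr \<delta>) \<rho> * (pos_powr (1 - (norm x)\<^sup>2 / t) l * cos (\<xi> \<bullet> x)))"
      using True by (intro Bochner_Integration.integral_cong) (simp_all add: mix_integrand_def)
    also have "\<dots> = t powr \<alpha> * pos_powr (1 - t powr \<delta>) \<rho> * (t powr (n / 2) * (?C * psum (bessel_coeff \<mu>) (?R * t)))"
      using scaled_ball_cosine_transform[OF l True, of \<xi>] by (simp add: n_def \<mu>_def)
    also have "t powr \<alpha> * pos_powr (1 - t powr \<delta>) \<rho> = indicator {0<..<1} t * (t powr \<alpha> * (1 - t powr \<delta>) powr \<rho>)"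
      using mix_weight_eq[OF \<delta>(1), of t \<alpha> \<rho>] True by simp
    finally show ?thesis by (simp add: a0_def powr_add)
  qed (simp add: mix_integrand_def)
  have "(LINT x|lborel. (LINT t|lborel. ?F x t) * cos (\<xi> \<bullet> x)) = (LINT x|lborel. (LINT t|lborel. ?F x t * cos (\<xi> \<bullet> x)))"
    by simp
  also have "\<dots> = (LINT t|lborel. (LINT x|lborel. ?F x t * cos (\<xi> \<bullet> x)))"
    by (rule lborel_pair.Fubini_integral[OF int_cos, symmetric])
  also have "\<dots> = ?C * (LINT t:{0<..<1}|lborel. t powr (a0 - 1) * (1 - t powr \<delta>) powr \<rho> * psum (bessel_coeff \<mu>) (?R * t))"
    unfolding inner set_lebesgue_integral_def by (rule integral_mult_right_zero)
  also have "\<dots> > 0"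
    using radial_integral_pos(2)[OF \<mu> \<delta> \<rho> a0 a0_le, of ?R] ball_const_pos[OF l, where 'a = 'a] by simp
  finally show "0 < (LINT x|lborel. (LINT t|lborel. ?F x t) * cos (\<xi> \<bullet> x))" .
qed

text \<open>The real part of the transform is the cosine integral; the imaginary part is minus the
  sine integral, which equals its own negative under x \<mapsto> -x.\<close>

lemma strictly_positive_fourier_transformI:
  fixes f :: "real ^ 'n \<Rightarrow> real"
  assumes f: "integrable lborel f" and even: "\<And>x. f (- x) = f x"
    and pos: "\<And>\<xi>. 0 < (LINT x|lborel. f x * cos (\<xi> \<bullet> x))"
  shows "has_strictly_positive_fourier_transform f"
proof -
  have "Im (fourier_transform f \<xi>) = 0 \<and> Re (fourier_transform f \<xi>) > 0" for \<xi>
  proof -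
    let ?g = "\<lambda>x. complex_of_real (f x) * exp (- (\<i> * complex_of_real (\<xi> \<bullet> x)))"
    have [measurable]: "f \<in> borel_measurable borel" using f by auto
    have int: "integrable lborel ?g"
      by (rule Bochner_Integration.integrable_bound[OF f]) (auto simp: norm_mult)
    have "Re (fourier_transform f \<xi>) = (LINT x|lborel. Re (?g x))"
      unfolding fourier_transform_def by (rule integral_Re[OF int, symmetric])
    also have "\<dots> = (LINT x|lborel. f x * cos (\<xi> \<bullet> x))" by (simp add: Re_exp)
    finally have 1: "Re (fourier_transform f \<xi>) > 0" using pos by simp
    have "Im (fourier_transform f \<xi>) = (LINT x|lborel. Im (?g x))"
      unfolding fourier_transform_def by (rule integral_Im[OF int, symmetric])
    also have "\<dots> = (LINT x|lborel. - (f x * sin (\<xi> \<bullet> x)))" by (simp add: Im_exp)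
    finally have 2: "Im (fourier_transform f \<xi>) = - (LINT x|lborel. f x * sin (\<xi> \<bullet> x))" by simp
    have "(LINT x|lborel. f x * sin (\<xi> \<bullet> x)) = \<bar>-1\<bar> ^ DIM(real ^ 'n) *
        (LINT x|lborel. f (0 + (-1) *\<^sub>R x) * sin (\<xi> \<bullet> (0 + (-1) *\<^sub>R x)))"
      by (rule integral_lborel_affine) auto
    then have "(LINT x|lborel. f x * sin (\<xi> \<bullet> x)) = - (LINT x|lborel. f x * sin (\<xi> \<bullet> x))"
      by (simp add: even)
    with 1 2 show ?thesis by simp
  qed
  then show ?thesis using f by (simp add: has_strictly_positive_fourier_transform_def)
qed

section \<open>Positive definiteness from a positive cosine transform\<close>

lemma gauss_scaled_cosine_transform:
  fixes v :: "'a::euclidean_space"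
  assumes \<epsilon>: "\<epsilon> > 0"
  shows "integrable (lborel :: 'a measure) (\<lambda>x. exp (- (\<epsilon> * norm x)\<^sup>2))"
    and "(LINT x|lborel. exp (- (\<epsilon> * norm x)\<^sup>2) * cos (v \<bullet> x)) =
      gauss_mass TYPE('a) / \<epsilon> ^ DIM('a) * exp (- (norm v / (2 * \<epsilon>))\<^sup>2)"
proof -
  have "integrable (lborel :: 'a measure) (\<lambda>x. exp (- (norm (0 + \<epsilon> *\<^sub>R x))\<^sup>2))"
  proof -
    have "integrable (lborel :: 'a measure) (\<lambda>x. exp (- (norm x)\<^sup>2))"
      using gauss_has_integral[where 'a = 'a] by (simp add: has_bochner_integral_iff)
    then show ?thesis
      using \<epsilon> by (subst (asm) lborel_affine[of \<epsilon> 0]) (auto simp: integrable_density integrable_distr_eq)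
  qed
  then show "integrable (lborel :: 'a measure) (\<lambda>x. exp (- (\<epsilon> * norm x)\<^sup>2))" using \<epsilon> by simp
  have "(LINT x|lborel. exp (- (norm x)\<^sup>2) * cos ((v /\<^sub>R \<epsilon>) \<bullet> x)) = \<bar>\<epsilon>\<bar> ^ DIM('a) *
     (LINT x|lborel. exp (- (norm (0 + \<epsilon> *\<^sub>R x))\<^sup>2) * cos ((v /\<^sub>R \<epsilon>) \<bullet> (0 + \<epsilon> *\<^sub>R x)))"
    using \<epsilon> by (intro integral_lborel_affine) auto
  also have "\<dots> = \<epsilon> ^ DIM('a) * (LINT x|lborel. exp (- (\<epsilon> * norm x)\<^sup>2) * cos (v \<bullet> x))"
    using \<epsilon> by (simp add: mult.assoc[symmetric])
  finally have "gauss_mass TYPE('a) * exp (- (norm (v /\<^sub>R \<epsilon>))\<^sup>2 / 4) =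
      \<epsilon> ^ DIM('a) * (LINT x|lborel. exp (- (\<epsilon> * norm x)\<^sup>2) * cos (v \<bullet> x))"
    by (simp only: gauss_cosine_transform(2))
  moreover have "- (norm (v /\<^sub>R \<epsilon>))\<^sup>2 / 4 = - (norm v / (2 * \<epsilon>))\<^sup>2"
    using \<epsilon> by (simp add: field_simps power2_eq_square)
  ultimately show "(LINT x|lborel. exp (- (\<epsilon> * norm x)\<^sup>2) * cos (v \<bullet> x)) =
      gauss_mass TYPE('a) / \<epsilon> ^ DIM('a) * exp (- (norm v / (2 * \<epsilon>))\<^sup>2)"
    using \<epsilon> by (simp add: field_simps)
qed

text \<open>Gaussian averages of a bounded continuous function concentrate at d. The width 2/(k+1)
  is the 2\<epsilon> of \<open>smoothed_fourier_inversion\<close> for \<epsilon> = 1/(k+1).\<close>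

lemma tendsto_gauss_convolution:
  fixes w :: "'a::euclidean_space \<Rightarrow> real"
  assumes w: "continuous_on UNIV w" and B: "\<And>x. \<bar>w x\<bar> \<le> B"
  shows "(\<lambda>k. (LINT v|lborel. w (d + (2 / real (Suc k)) *\<^sub>R v) * exp (- (norm v)\<^sup>2))) \<longlonglongrightarrow> w d * gauss_mass TYPE('a)"
proof -
  have int: "integrable (lborel :: 'a measure) (\<lambda>x. exp (- (norm x)\<^sup>2))"
    using gauss_has_integral[where 'a = 'a] by (simp add: has_bochner_integral_iff)
  have [measurable]: "w \<in> borel_measurable borel" by (rule borel_measurable_continuous_onI[OF w])
  have "(\<lambda>k. (LINT v|lborel. w (d + (2 / real (Suc k)) *\<^sub>R v) * exp (- (norm v)\<^sup>2))) \<longlonglongrightarrow> (LINT v|lborel. w d * exp (- (norm (v::'a))\<^sup>2))"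
  proof (rule integral_dominated_convergence[where w = "\<lambda>v::'a. B * exp (- (norm v)\<^sup>2)"])
    show "integrable lborel (\<lambda>v::'a. B * exp (- (norm v)\<^sup>2))" using int by simp
    show "AE v in lborel. (\<lambda>k. w (d + (2 / real (Suc k)) *\<^sub>R v) * exp (- (norm v)\<^sup>2)) \<longlonglongrightarrow> w d * exp (- (norm v)\<^sup>2)"
    proof (intro AE_I2 tendsto_mult tendsto_const)
      fix v :: 'a
      have "(\<lambda>k. 2 / real (Suc k)) \<longlonglongrightarrow> 0"
        using tendsto_mult[OF tendsto_const[of 2] LIMSEQ_inverse_real_of_nat] by (simp add: divide_inverse)
      then have "(\<lambda>k. d + (2 / real (Suc k)) *\<^sub>R v) \<longlonglongrightarrow> d + 0 *\<^sub>R v" by (intro tendsto_intros)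
      then show "(\<lambda>k. w (d + (2 / real (Suc k)) *\<^sub>R v)) \<longlonglongrightarrow> w d"
        using w by (intro isCont_tendsto_compose[of d w]) (auto simp: continuous_on_eq_continuous_at)
    qed
    show "AE v in lborel. norm (w (d + (2 / real (Suc k)) *\<^sub>R v) * exp (- (norm v)\<^sup>2)) \<le> B * exp (- (norm v)\<^sup>2)" for k
      by (intro AE_I2) (simp add: abs_mult B)
  qed measurable
  then show ?thesis by (simp add: gauss_mass_def)
qed

text \<open>Integrability of the transform of w is not among the assumptions, so a Gaussian factor
  is inserted to make the double integral absolutely convergent. Exchanging the order leaves the
  transform of the Gaussian, which is again a Gaussian, centred at d and at -d.\<close>

lemma smoothed_fourier_inversion:
  fixes w :: "'a::euclidean_space \<Rightarrow> real"
  assumes int: "integrable lborel w" and \<epsilon>: "\<epsilon> > 0"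
  shows "integrable lborel (\<lambda>\<xi>. (LINT u|lborel. w u * cos (\<xi> \<bullet> u)) * cos (\<xi> \<bullet> d) * exp (- (\<epsilon> * norm \<xi>)\<^sup>2))"
    and "(LINT \<xi>|lborel. (LINT u|lborel. w u * cos (\<xi> \<bullet> u)) * cos (\<xi> \<bullet> d) * exp (- (\<epsilon> * norm \<xi>)\<^sup>2)) =
     2 ^ DIM('a) * gauss_mass TYPE('a) * ((LINT v|lborel. w (d + (2 * \<epsilon>) *\<^sub>R v) * exp (- (norm v)\<^sup>2))
       + (LINT v|lborel. w (- d + (2 * \<epsilon>) *\<^sub>R v) * exp (- (norm v)\<^sup>2))) / 2"
proof -
  let ?G = "gauss_mass TYPE('a)" and ?n = "DIM('a)"
  let ?e = "\<lambda>\<xi>::'a. exp (- (\<epsilon> * norm \<xi>)\<^sup>2)"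
  have [measurable]: "w \<in> borel_measurable borel" using int by auto
  have e_int: "integrable lborel ?e" by (rule gauss_scaled_cosine_transform(1)[OF \<epsilon>])
  have prod: "integrable (lborel \<Otimes>\<^sub>M lborel) (\<lambda>(u, \<xi>). w u * ?e \<xi>)"
  proof (rule lborel_pair.Fubini_integrable)
    show "integrable lborel (\<lambda>x. LINT y|lborel. norm (case (x, y) of (u, \<xi>) \<Rightarrow> w u * ?e \<xi>))"
      using int by (simp add: abs_mult)
    show "AE x in lborel. integrable lborel (\<lambda>y. case (x, y) of (u, \<xi>) \<Rightarrow> w u * ?e \<xi>)"
      using e_int by auto
  qed measurable
  let ?f = "\<lambda>u \<xi>. w u * cos (\<xi> \<bullet> u) * cos (\<xi> \<bullet> d) * ?e \<xi>"
  have f_int: "integrable (lborel \<Otimes>\<^sub>M lborel) (\<lambda>(u, \<xi>). ?f u \<xi>)"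
  proof (rule Bochner_Integration.integrable_bound[OF prod])
    have "\<bar>w u\<bar> * \<bar>cos (\<xi> \<bullet> u)\<bar> * \<bar>cos (\<xi> \<bullet> d)\<bar> * ?e \<xi> \<le> \<bar>w u\<bar> * 1 * 1 * ?e \<xi>" for u \<xi>
      by (intro mult_right_mono mult_mono) auto
    then show "AE z in lborel \<Otimes>\<^sub>M lborel. norm (case z of (u, \<xi>) \<Rightarrow> ?f u \<xi>) \<le> norm (case z of (u, \<xi>) \<Rightarrow> w u * ?e \<xi>)"
      by (auto simp: abs_mult)
  qed measurable
  have 1: "(LINT u|lborel. ?f u \<xi>) = (LINT u|lborel. w u * cos (\<xi> \<bullet> u)) * cos (\<xi> \<bullet> d) * ?e \<xi>" for \<xi>
    by simp
  show "integrable lborel (\<lambda>\<xi>. (LINT u|lborel. w u * cos (\<xi> \<bullet> u)) * cos (\<xi> \<bullet> d) * ?e \<xi>)"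
    using lborel_pair.integrable_snd[OF f_int] unfolding 1 .
  let ?g = "\<lambda>v. ?G / \<epsilon> ^ ?n * exp (- (norm v / (2 * \<epsilon>))\<^sup>2)"
  have ec_int: "integrable lborel (\<lambda>\<xi>. ?e \<xi> * cos (v \<bullet> \<xi>))" for v
    by (rule Bochner_Integration.integrable_bound[OF e_int]) (auto simp: abs_mult mult_left_le)
  \<comment> \<open>Product-to-sum formula for the two cosines; it produces the two centres d and
    -d.\<close>
  have 2: "(LINT \<xi>|lborel. ?f u \<xi>) = w u * (?g (u - d) + ?g (u + d)) / 2" for u
  proof -
    have "?f u \<xi> = w u / 2 * (?e \<xi> * cos ((u - d) \<bullet> \<xi>) + ?e \<xi> * cos ((u + d) \<bullet> \<xi>))" for \<xi>
      by (simp add: inner_diff_left inner_add_left cos_diff cos_add inner_commute[of _ \<xi>] algebra_simps)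
    then have "(LINT \<xi>|lborel. ?f u \<xi>) = (LINT \<xi>|lborel. w u / 2 * (?e \<xi> * cos ((u - d) \<bullet> \<xi>) + ?e \<xi> * cos ((u + d) \<bullet> \<xi>)))"
      by (simp only:)
    also have "\<dots> = w u / 2 * ((LINT \<xi>|lborel. ?e \<xi> * cos ((u - d) \<bullet> \<xi>)) + (LINT \<xi>|lborel. ?e \<xi> * cos ((u + d) \<bullet> \<xi>)))"
      by (subst integral_mult_right_zero, subst Bochner_Integration.integral_add[OF ec_int ec_int]) simp
    finally show ?thesis unfolding gauss_scaled_cosine_transform(2)[OF \<epsilon>] by simp
  qed
  have g_le: "\<bar>?g v\<bar> \<le> ?G / \<epsilon> ^ ?n" for v
    using gauss_mass_pos[where 'a = 'a] \<epsilon> by (simp add: abs_mult divide_right_mono mult_left_le)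
  have wg_int: "integrable lborel (\<lambda>u. w u * ?g (u + d'))" for d'
  proof (rule Bochner_Integration.integrable_bound)
    show "integrable lborel (\<lambda>u. w u * (?G / \<epsilon> ^ ?n))" using int by simp
    show "AE u in lborel. norm (w u * ?g (u + d')) \<le> norm (w u * (?G / \<epsilon> ^ ?n))"
    proof (intro AE_I2)
      fix u
      have "\<bar>w u\<bar> * \<bar>?g (u + d')\<bar> \<le> \<bar>w u\<bar> * \<bar>?G / \<epsilon> ^ ?n\<bar>"
        by (intro mult_left_mono order_trans[OF g_le abs_ge_self]) auto
      then show "norm (w u * ?g (u + d')) \<le> norm (w u * (?G / \<epsilon> ^ ?n))"
        by (simp only: real_norm_def abs_mult)
    qed
  qed measurable
  \<comment> \<open>Substituting u = -d' + 2\<epsilon>v normalises the Gaussian; the Jacobian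
    (2\<epsilon>)^n against \<epsilon>^(-n) leaves 2^n.\<close>
  have 3: "(LINT u|lborel. w u * ?g (u + d')) = 2 ^ ?n * ?G * (LINT v|lborel. w (- d' + (2 * \<epsilon>) *\<^sub>R v) * exp (- (norm v)\<^sup>2))" for d'
  proof -
    have "(LINT u|lborel. w u * ?g (u + d')) = \<bar>2 * \<epsilon>\<bar> ^ ?n *
       (LINT v|lborel. w (- d' + (2 * \<epsilon>) *\<^sub>R v) * ?g (- d' + (2 * \<epsilon>) *\<^sub>R v + d'))"
      using \<epsilon> by (intro integral_lborel_affine) auto
    also have "\<dots> = (2 * \<epsilon>) ^ ?n * (LINT v|lborel. ?G / \<epsilon> ^ ?n * (w (- d' + (2 * \<epsilon>) *\<^sub>R v) * exp (- (norm v)\<^sup>2)))"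
      using \<epsilon> by (simp add: mult_ac)
    also have "\<dots> = (2 * \<epsilon>) ^ ?n * (?G / \<epsilon> ^ ?n * (LINT v|lborel. w (- d' + (2 * \<epsilon>) *\<^sub>R v) * exp (- (norm v)\<^sup>2)))"
      by (simp only: integral_mult_right_zero)
    finally show ?thesis using \<epsilon> by (simp add: power_mult_distrib)
  qed
  have "(LINT \<xi>|lborel. (LINT u|lborel. ?f u \<xi>)) = (LINT u|lborel. (LINT \<xi>|lborel. ?f u \<xi>))"
    by (rule lborel_pair.Fubini_integral[OF f_int])
  also have "\<dots> = (LINT u|lborel. (w u * ?g (u + - d) + w u * ?g (u + d)) / 2)"
    unfolding 2 by (simp add: distrib_left)
  also have "\<dots> = ((LINT u|lborel. w u * ?g (u + - d)) + (LINT u|lborel. w u * ?g (u + d))) / 2"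
    by (subst integral_divide_zero, subst Bochner_Integration.integral_add[OF wg_int wg_int]) simp
  also have "\<dots> = 2 ^ ?n * ?G * ((LINT v|lborel. w (d + (2 * \<epsilon>) *\<^sub>R v) * exp (- (norm v)\<^sup>2))
       + (LINT v|lborel. w (- d + (2 * \<epsilon>) *\<^sub>R v) * exp (- (norm v)\<^sup>2))) / 2"
    unfolding 3 by (simp add: distrib_left)
  finally show "(LINT \<xi>|lborel. (LINT u|lborel. w u * cos (\<xi> \<bullet> u)) * cos (\<xi> \<bullet> d) * ?e \<xi>) =
     2 ^ ?n * ?G * ((LINT v|lborel. w (d + (2 * \<epsilon>) *\<^sub>R v) * exp (- (norm v)\<^sup>2))
       + (LINT v|lborel. w (- d + (2 * \<epsilon>) *\<^sub>R v) * exp (- (norm v)\<^sup>2))) / 2"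
    unfolding 1 .
qed

text \<open>Both sides are \<open>|\<Sum>\<^sub>j c\<^sub>j exp (i \<xi> \<bullet> x\<^sub>j)|\<^sup>2\<close>.\<close>
lemma trig_quadratic_form:
  fixes x :: "nat \<Rightarrow> 'a::euclidean_space"
  shows "(\<Sum>i<N. \<Sum>j<N. c i * c j * cos (\<xi> \<bullet> (x i - x j))) =
    (\<Sum>j<N. c j * cos (\<xi> \<bullet> x j))\<^sup>2 + (\<Sum>j<N. c j * sin (\<xi> \<bullet> x j))\<^sup>2"
  unfolding power2_eq_square sum_product
  by (simp add: inner_diff_right cos_diff algebra_simps flip: sum.distrib)

text \<open>The averages against wide Gaussians, suitably normalised, tend to \<open>\<Sum>\<^sub>i c\<^sub>i\<^sup>2\<close>.\<close>
lemma trig_quadratic_form_not_AE_0: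
  fixes x :: "nat \<Rightarrow> 'a::euclidean_space"
  assumes x: "inj_on x {..<N}" and c: "\<exists>i<N. c i \<noteq> 0"
  shows "\<not> (AE \<xi> in lborel. (\<Sum>i<N. \<Sum>j<N. c i * c j * cos (\<xi> \<bullet> (x i - x j))) = 0)"
proof
  let ?T = "\<lambda>\<xi>. \<Sum>i<N. \<Sum>j<N. c i * c j * cos (\<xi> \<bullet> (x i - x j))"
  let ?G = "gauss_mass TYPE('a)"
  assume T: "AE \<xi> in lborel. ?T \<xi> = 0"
  define \<epsilon> where "\<epsilon> k = 1 / real (Suc k)" for k
  have \<epsilon>: "\<epsilon> k > 0" for k by (simp add: \<epsilon>_def)
  have z: "(\<Sum>i<N. \<Sum>j<N. c i * c j * exp (- (norm (x i - x j) / (2 * \<epsilon> k))\<^sup>2)) = 0" for k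
  proof -
    let ?e = "\<lambda>\<xi>::'a. exp (- (\<epsilon> k * norm \<xi>)\<^sup>2)"
    have ec_int: "integrable lborel (\<lambda>\<xi>. ?e \<xi> * cos (v \<bullet> \<xi>))" for v
      by (rule Bochner_Integration.integrable_bound[OF gauss_scaled_cosine_transform(1)[OF \<epsilon>[of k]]]) (auto simp: abs_mult mult_left_le)
    have "0 = (LINT \<xi>|lborel. ?e \<xi> * ?T \<xi>)"
      by (subst integral_eq_zero_AE) (use T in auto)
    also have "\<dots> = (LINT \<xi>|lborel. (\<Sum>i<N. \<Sum>j<N. c i * c j * (?e \<xi> * cos ((x i - x j) \<bullet> \<xi>))))"
      by (simp add: sum_distrib_left mult_ac inner_commute)
    also have "\<dots> = (\<Sum>i<N. \<Sum>j<N. c i * c j * (?G / \<epsilon> k ^ DIM('a) * exp (- (norm (x i - x j) / (2 * \<epsilon> k))\<^sup>2)))"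
      using ec_int by (simp add: gauss_scaled_cosine_transform(2)[OF \<epsilon>])
    also have "\<dots> = ?G / \<epsilon> k ^ DIM('a) * (\<Sum>i<N. \<Sum>j<N. c i * c j * exp (- (norm (x i - x j) / (2 * \<epsilon> k))\<^sup>2))"
      by (simp add: sum_distrib_left mult_ac)
    finally show ?thesis using gauss_mass_pos[where 'a = 'a] \<epsilon>[of k] by simp
  qed
  have lim: "(\<lambda>k. exp (- (norm (x i - x j) / (2 * \<epsilon> k))\<^sup>2)) \<longlonglongrightarrow> (if i = j then 1 else 0)"
    if "i < N" "j < N" for i j
  proof (cases "i = j")
    case False
    define r where "r = norm (x i - x j) / 2"
    have r: "r > 0" using False that x by (auto simp: r_def inj_on_def)
    have "filterlim (\<lambda>k. r * real (Suc k)) at_top sequentially"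
      by (intro filterlim_tendsto_pos_mult_at_top[OF tendsto_const r] filterlim_compose[OF filterlim_real_sequentially filterlim_Suc])
    then have "filterlim (\<lambda>k. (r * real (Suc k))\<^sup>2) at_top sequentially"
      by (rule filterlim_pow_at_top[rotated]) simp
    then have "(\<lambda>k. exp (- (r * real (Suc k))\<^sup>2)) \<longlonglongrightarrow> 0"
      by (intro filterlim_compose[OF exp_at_bot] filterlim_compose[OF filterlim_uminus_at_bot_at_top])
    moreover have "norm (x i - x j) / (2 * \<epsilon> k) = r * real (Suc k)" for k by (simp add: r_def \<epsilon>_def)
    ultimately show ?thesis using False by simp
  qed simp
  have "(\<lambda>k. \<Sum>i<N. \<Sum>j<N. c i * c j * exp (- (norm (x i - x j) / (2 * \<epsilon> k))\<^sup>2)) \<longlonglongrightarrow>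
      (\<Sum>i<N. \<Sum>j<N. c i * c j * (if i = j then 1 else 0))"
    by (intro tendsto_sum tendsto_mult tendsto_const lim) auto
  then have "0 = (\<Sum>i<N. \<Sum>j<N. c i * c j * (if i = j then 1 else 0))"
    unfolding z using LIMSEQ_unique tendsto_const by blast
  also have "\<dots> = (\<Sum>i<N. (c i)\<^sup>2)" by (simp add: power2_eq_square if_distrib[of "(*) _"] cong: if_cong)
  finally have "(\<Sum>i<N. (c i)\<^sup>2) = 0" ..
  then show False using c by (auto simp: sum_nonneg_eq_0_iff)
qed

text \<open>
  The Gaussian regularisations of the quadratic form increase as \<open>\<epsilon>\<close> decreases to 0, so the first
  one bounds the limit from below.
\<close>
lemma quadratic_form_pos:
  fixes w :: "'a::euclidean_space \<Rightarrow> real" and x :: "nat \<Rightarrow> 'a"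
  assumes int: "integrable lborel w" and w: "continuous_on UNIV w" and B: "\<And>u. \<bar>w u\<bar> \<le> B"
    and even: "\<And>u. w (- u) = w u"
    and pos: "\<And>\<xi>. 0 < (LINT u|lborel. w u * cos (\<xi> \<bullet> u))"
    and x: "inj_on x {..<N}" and c: "\<exists>i<N. c i \<noteq> 0"
  shows "0 < (\<Sum>i<N. \<Sum>j<N. c i * c j * w (x i - x j))"
proof -
  let ?G = "gauss_mass TYPE('a)"
  let ?h = "\<lambda>\<xi>. LINT u|lborel. w u * cos (\<xi> \<bullet> u)"
  let ?T = "\<lambda>\<xi>. \<Sum>i<N. \<Sum>j<N. c i * c j * cos (\<xi> \<bullet> (x i - x j))"
  define \<epsilon> where "\<epsilon> k = 1 / real (Suc k)" for k
  have \<epsilon>: "\<epsilon> k > 0" "\<epsilon> k \<le> 1" for k by (auto simp: \<epsilon>_def)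
  define S where "S k \<xi> = ?h \<xi> * ?T \<xi> * exp (- (\<epsilon> k * norm \<xi>)\<^sup>2)" for k \<xi>
  define F where "F d k \<xi> = ?h \<xi> * cos (\<xi> \<bullet> d) * exp (- (\<epsilon> k * norm \<xi>)\<^sup>2)" for d k \<xi>
  have S_eq: "S k = (\<lambda>\<xi>. \<Sum>i<N. \<Sum>j<N. c i * c j * F (x i - x j) k \<xi>)" for k
    by (simp add: S_def F_def sum_distrib_left sum_distrib_right mult_ac fun_eq_iff)
  have F_int: "integrable lborel (F d k)" for d k
    unfolding F_def by (rule smoothed_fourier_inversion(1)[OF int \<epsilon>(1)])
  have S_int: "integrable lborel (S k)" for k
    unfolding S_eq by (intro Bochner_Integration.integrable_sum integrable_mult_right F_int)
  have S_nonneg: "0 \<le> S k \<xi>" for k \<xi>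
    using pos[of \<xi>] unfolding S_def trig_quadratic_form by (simp add: less_imp_le)
  define L where "L d k = (LINT v|lborel. w (d + (2 * \<epsilon> k) *\<^sub>R v) * exp (- (norm v)\<^sup>2))" for d k
  have L: "L d \<longlonglongrightarrow> w d * ?G" for d
  proof -
    have "2 * \<epsilon> k = 2 / real (Suc k)" for k by (simp add: \<epsilon>_def)
    then show ?thesis using tendsto_gauss_convolution[OF w B, of d] by (simp only: L_def[abs_def])
  qed
  have F_val: "integral\<^sup>L lborel (F d k) = 2 ^ DIM('a) * ?G * (L d k + L (- d) k) / 2" for d k
    unfolding F_def[abs_def] L_def by (rule smoothed_fourier_inversion(2)[OF int \<epsilon>(1)])
  have "integral\<^sup>L lborel (S k) = (\<Sum>i<N. \<Sum>j<N. c i * c j * integral\<^sup>L lborel (F (x i - x j) k))" for k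
    by (simp add: S_eq F_int)
  then have "integral\<^sup>L lborel (S k) = (\<Sum>i<N. \<Sum>j<N. c i * c j * (2 ^ DIM('a) * ?G * (L (x i - x j) k + L (- (x i - x j)) k) / 2))" for k
    unfolding F_val .
  moreover have "(\<lambda>k. \<Sum>i<N. \<Sum>j<N. c i * c j * (2 ^ DIM('a) * ?G * (L (x i - x j) k + L (- (x i - x j)) k) / 2)) \<longlonglongrightarrow>
     (\<Sum>i<N. \<Sum>j<N. c i * c j * (2 ^ DIM('a) * ?G * (w (x i - x j) * ?G + w (- (x i - x j)) * ?G) / 2))"
    by (intro tendsto_intros L) auto
  \<comment> \<open>Evenness of w merges the averages around d and -d.\<close>
  moreover have "c i * c j * (2 ^ DIM('a) * ?G * (w (x i - x j) * ?G + w (- (x i - x j)) * ?G) / 2) =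
      2 ^ DIM('a) * ?G * ?G * (c i * c j * w (x i - x j))" for i j
    unfolding even by simp
  ultimately have "(\<lambda>k. integral\<^sup>L lborel (S k)) \<longlonglongrightarrow> (\<Sum>i<N. \<Sum>j<N. 2 ^ DIM('a) * ?G * ?G * (c i * c j * w (x i - x j)))"
    by (simp only:)
  then have lim: "(\<lambda>k. integral\<^sup>L lborel (S k)) \<longlonglongrightarrow> 2 ^ DIM('a) * ?G * ?G * (\<Sum>i<N. \<Sum>j<N. c i * c j * w (x i - x j))"
    by (simp only: sum_distrib_left)
  have mono: "integral\<^sup>L lborel (S 0) \<le> integral\<^sup>L lborel (S k)" for k
  proof (rule integral_mono[OF S_int S_int])
    fix \<xi> :: 'a
    have "(\<epsilon> k * norm \<xi>)\<^sup>2 \<le> (\<epsilon> 0 * norm \<xi>)\<^sup>2"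
      using \<epsilon>[of k] by (intro power_mono mult_right_mono) (auto simp: \<epsilon>_def)
    moreover have "0 \<le> ?h \<xi> * ?T \<xi>"
      using pos[of \<xi>] unfolding trig_quadratic_form by (simp add: less_imp_le)
    ultimately show "S 0 \<xi> \<le> S k \<xi>" unfolding S_def by (intro mult_left_mono) auto
  qed
  \<comment> \<open>The transform and the Gaussian are strictly positive, so a zero integral would
    force the trigonometric form to vanish almost everywhere.\<close>
  have "0 < integral\<^sup>L lborel (S 0)"
  proof -
    have "\<not> (AE \<xi> in lborel. S 0 \<xi> = 0)"
      using trig_quadratic_form_not_AE_0[OF x c] pos unfolding S_def by (simp add: less_imp_neq[symmetric])
    then have "integral\<^sup>L lborel (S 0) \<noteq> 0"
      using integral_nonneg_eq_0_iff_AE[OF S_int[of 0]] S_nonneg by simp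
    moreover have "0 \<le> integral\<^sup>L lborel (S 0)" by (intro integral_nonneg_AE) (simp add: S_nonneg)
    ultimately show ?thesis by linarith
  qed
  also have "integral\<^sup>L lborel (S 0) \<le> 2 ^ DIM('a) * ?G * ?G * (\<Sum>i<N. \<Sum>j<N. c i * c j * w (x i - x j))"
    by (rule LIMSEQ_le_const[OF lim]) (use mono in blast)
  finally have "0 < 2 ^ DIM('a) * ?G * ?G * (\<Sum>i<N. \<Sum>j<N. c i * c j * w (x i - x j))" .
  moreover have "0 < 2 ^ DIM('a) * ?G * ?G" using gauss_mass_pos[where 'a = 'a] by simp
  ultimately show ?thesis by (rule zero_less_mult_pos)
qed

section \<open>Finiteness and continuity of the mixture\<close>

lemma mix_integrand_0:
  assumes "\<delta> > 0"
  shows "mix_integrand l \<alpha> \<delta> \<rho> 0 t = indicator {0<..<1} t * (t powr \<alpha> * (1 - t powr \<delta>) powr \<rho>)"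
  using mix_weight_eq[OF assms, of t \<alpha> \<rho>] by (simp add: mix_integrand_def pos_powr_def)

lemma mix_integrand_0_integrable:
  assumes "\<delta> > 0" "\<rho> \<ge> 0" "\<alpha> > -1"
  shows "integrable lborel (mix_integrand l \<alpha> \<delta> \<rho> 0)"
proof -
  have "set_integrable lborel {0<..<1} (\<lambda>t. t powr (\<alpha> + 1 - 1) * (1 - t powr \<delta>) powr \<rho> * 1)"
    by (rule radial_integrand_integrable) (use assms in auto)
  then show ?thesis by (simp add: set_integrable_def mix_integrand_0[OF assms(1), abs_def] cong: if_cong)
qed

text \<open>The density in u = t / |x|^2, up to a power of |x|. Its singularity of order l sits at
  the fixed point u = 1; at infinity it need not be integrable, which is why bounds on it carry a
  cutoff in u.\<close>

definition shell_weight :: "real \<Rightarrow> real \<Rightarrow> real \<Rightarrow> real" where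
  "shell_weight l \<alpha> u = indicator {1<..} u * (pos_powr (1 - 1 / u) l * u powr \<alpha>)"

lemma shell_weight_measurable [measurable]: "shell_weight l \<alpha> \<in> borel_measurable borel"
  unfolding shell_weight_def[abs_def] by measurable

lemma shell_weight_nonneg: "0 \<le> shell_weight l \<alpha> u"
  by (simp add: shell_weight_def)

text \<open>For 1 < u \<le> M the weight is (u - 1)^l u^(\<alpha> - l). The second power is at most
  M^|\<alpha> - l|, and exp (M - u) \<ge> 1 allows comparison with the shifted Gamma integrand,
  where l > -1 gives integrability at u = 1.\<close>

lemma shell_weight_integrable:
  assumes "l > -1"
  shows "integrable lborel (\<lambda>u. indicator {..M} u * shell_weight l \<alpha> u)"
proof (rule Bochner_Integration.integrable_bound)
  have "integrable lborel (\<lambda>u. pos_powr (u - 1) l * exp (- u))"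
    using nn_integral_pos_powr_exp[OF assms, of 1] by (intro integrableI_nonneg) auto
  then show "integrable lborel (\<lambda>u. M powr \<bar>\<alpha> - l\<bar> * exp M * (pos_powr (u - 1) l * exp (- u)))"
    by (rule integrable_mult_right)
  show "AE u in lborel. norm (indicator {..M} u * shell_weight l \<alpha> u) \<le> norm (M powr \<bar>\<alpha> - l\<bar> * exp M * (pos_powr (u - 1) l * exp (- u)))"
  proof (intro AE_I2)
    fix u :: real
    show "norm (indicator {..M} u * shell_weight l \<alpha> u) \<le> norm (M powr \<bar>\<alpha> - l\<bar> * exp M * (pos_powr (u - 1) l * exp (- u)))"
    proof (cases "1 < u \<and> u \<le> M")
      case True
      have "1 - 1 / u = (u - 1) / u" using True by (simp add: field_simps)
      then have "shell_weight l \<alpha> u = pos_powr (u - 1) l * u powr (\<alpha> - l)"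
        using True by (simp add: shell_weight_def pos_powr_def powr_divide powr_diff)
      also have "u powr (\<alpha> - l) \<le> M powr \<bar>\<alpha> - l\<bar>"
        using True by (intro order_trans[OF powr_mono[of "\<alpha> - l" "\<bar>\<alpha> - l\<bar>" u] powr_mono2]) auto
      also have "M powr \<bar>\<alpha> - l\<bar> \<le> M powr \<bar>\<alpha> - l\<bar> * (exp M * exp (- u))"
        using True by (simp add: mult_le_cancel_left1 flip: exp_add)
      finally have "shell_weight l \<alpha> u \<le> pos_powr (u - 1) l * (M powr \<bar>\<alpha> - l\<bar> * (exp M * exp (- u)))"
        by (simp add: mult_left_mono)
      then show ?thesis using True shell_weight_nonneg[of l \<alpha> u] by (simp add: abs_mult mult_ac)
    qed (auto simp: shell_weight_def)
  qed
qed measurable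

text \<open>The substitution \<open>t = |x|\<^sup>2 u\<close> removes the moving singularity of the integrand.\<close>
lemma mix_integrand_rescaled:
  fixes x :: "'a::euclidean_space"
  assumes "x \<noteq> 0"
  shows "mix_integrand l \<alpha> \<delta> \<rho> x ((norm x)\<^sup>2 * u) =
    ((norm x)\<^sup>2) powr \<alpha> * (shell_weight l \<alpha> u * pos_powr (1 - ((norm x)\<^sup>2 * u) powr \<delta>) \<rho>)"
proof -
  have q: "(norm x)\<^sup>2 > 0" using assms by simp
  show ?thesis
  proof (cases "u > 0")
    case True
    have "(norm x)\<^sup>2 / ((norm x)\<^sup>2 * u) = 1 / u" using q by simp
    moreover have "pos_powr (1 - 1 / u) l = indicator {1<..} u * pos_powr (1 - 1 / u) l"
      using True by (auto simp: pos_powr_def split: split_indicator)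
    ultimately show ?thesis
      using True q by (simp add: mix_integrand_def shell_weight_def powr_mult mult_ac) blast
  next
    case False
    then have "\<not> (norm x)\<^sup>2 * u > 0" using q by (simp add: zero_less_mult_iff)
    then show ?thesis using False by (simp add: mix_integrand_def shell_weight_def)
  qed
qed

lemma shell_factor_le:
  assumes "q > 0" "u > 0" "\<delta> > 0" "\<rho> > 0"
  shows "pos_powr (1 - (q * u) powr \<delta>) \<rho> \<le> indicator {..1 / q} u"
proof (cases "u \<le> 1 / q")
  case True
  show ?thesis using True assms powr_mono2[of \<rho> "1 - (q * u) powr \<delta>" 1] by (auto simp: pos_powr_def)
next
  case False
  then have "1 \<le> q * u" using assms by (simp add: field_simps)
  then have "1 \<le> (q * u) powr \<delta>" using assms by (intro ge_one_powr_ge_zero) auto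
  then show ?thesis by (simp add: pos_powr_def)
qed

text \<open>A majorant common to all q \<ge> q0, as required for dominated convergence when |x|^2
  varies.\<close>

lemma shell_integrand_le:
  assumes "q0 > 0" "q0 \<le> q" "\<delta> > 0" "\<rho> > 0"
  shows "norm (shell_weight l \<alpha> u * pos_powr (1 - (q * u) powr \<delta>) \<rho>) \<le> indicator {..1 / q0} u * shell_weight l \<alpha> u"
proof (cases "u > 1")
  case True
  have "pos_powr (1 - (q * u) powr \<delta>) \<rho> \<le> indicator {..1 / q} u"
    using assms True by (intro shell_factor_le) auto
  also have "\<dots> \<le> (indicator {..1 / q0} u :: real)"
    using assms by (auto split: split_indicator simp: field_simps) (smt (verit) mult_right_mono True)
  finally have "shell_weight l \<alpha> u * pos_powr (1 - (q * u) powr \<delta>) \<rho> \<le> shell_weight l \<alpha> u * indicator {..1 / q0} u"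
    by (rule mult_left_mono) (rule shell_weight_nonneg)
  then show ?thesis using shell_weight_nonneg[of l \<alpha> u] by (simp add: abs_mult mult.commute)
qed (simp add: shell_weight_def)

text \<open>The integrand lives on |x|^2 < t < 1, away from t = 0, so \<alpha> is unrestricted and
  only the singularity of order l > -1 at t = |x|^2 matters.\<close>

lemma mix_integrand_integrable_nonzero:
  fixes x :: "'a::euclidean_space"
  assumes l: "l > -1" and \<delta>: "\<delta> > 0" and \<rho>: "\<rho> > 0" and x: "x \<noteq> 0"
  shows "integrable lborel (mix_integrand l \<alpha> \<delta> \<rho> x)"
proof -
  have q: "(norm x)\<^sup>2 > 0" using x by simp
  have "integrable lborel (\<lambda>u. shell_weight l \<alpha> u * pos_powr (1 - ((norm x)\<^sup>2 * u) powr \<delta>) \<rho>)"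
    by (rule Bochner_Integration.integrable_bound[OF shell_weight_integrable[OF l, of "1 / (norm x)\<^sup>2" \<alpha>]])
      (use shell_integrand_le[OF q order_refl \<delta> \<rho>] shell_weight_nonneg in auto)
  then have "integrable lborel (\<lambda>u. mix_integrand l \<alpha> \<delta> \<rho> x (0 + (norm x)\<^sup>2 * u))"
    by (simp add: mix_integrand_rescaled[OF x])
  then show ?thesis
    using q by (subst (asm) lborel_integrable_real_affine_iff) auto
qed

lemma mix_integral_rescaled:
  fixes x :: "'a::euclidean_space"
  assumes x: "x \<noteq> 0"
  shows "(LINT t|lborel. mix_integrand l \<alpha> \<delta> \<rho> x t) = ((norm x)\<^sup>2) powr (\<alpha> + 1) *
    (LINT u|lborel. shell_weight l \<alpha> u * pos_powr (1 - ((norm x)\<^sup>2 * u) powr \<delta>) \<rho>)"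
proof -
  have q: "(norm x)\<^sup>2 > 0" using x by simp
  have "(LINT t|lborel. mix_integrand l \<alpha> \<delta> \<rho> x t) = (norm x)\<^sup>2 * (LINT u|lborel. mix_integrand l \<alpha> \<delta> \<rho> x (0 + (norm x)\<^sup>2 * u))"
    using q lborel_integral_real_affine[of "(norm x)\<^sup>2" "mix_integrand l \<alpha> \<delta> \<rho> x" 0] by simp
  also have "\<dots> = (norm x)\<^sup>2 * ((norm x)\<^sup>2) powr \<alpha> *
    (LINT u|lborel. shell_weight l \<alpha> u * pos_powr (1 - ((norm x)\<^sup>2 * u) powr \<delta>) \<rho>)"
    by (simp add: mix_integrand_rescaled[OF x])
  also have "(norm x)\<^sup>2 * ((norm x)\<^sup>2) powr \<alpha> = ((norm x)\<^sup>2) powr (\<alpha> + 1)"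
    using q by (simp add: powr_add mult.commute)
  finally show ?thesis .
qed

text \<open>For \<rho> > 0 the truncated power is the continuous function
  \<open>max s 0 powr \<rho>\<close>, because \<open>0 powr \<rho> = 0\<close>.\<close>

lemma tendsto_pos_powr:
  assumes "(f \<longlongrightarrow> a) F" "\<rho> > 0"
  shows "((\<lambda>x. pos_powr (f x) \<rho>) \<longlongrightarrow> pos_powr a \<rho>) F"
proof -
  have *: "pos_powr s \<rho> = max s 0 powr \<rho>" for s by (simp add: pos_powr_def max_def)
  show ?thesis unfolding * using assms by (intro tendsto_powr2 tendsto_max tendsto_const) auto
qed

lemma shell_integral_tendsto:
  assumes l: "l > -1" and \<delta>: "\<delta> > 0" and \<rho>: "\<rho> > 0" and q: "q \<longlonglongrightarrow> q0" and q0: "q0 > 0"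
  shows "(\<lambda>k. LINT u|lborel. shell_weight l \<alpha> u * pos_powr (1 - (q k * u) powr \<delta>) \<rho>) \<longlonglongrightarrow>
    (LINT u|lborel. shell_weight l \<alpha> u * pos_powr (1 - (q0 * u) powr \<delta>) \<rho>)"
proof -
  \<comment> \<open>From N on, the single majorant belonging to q0 / 2 serves all k.\<close>
  obtain N where N: "\<And>k. k \<ge> N \<Longrightarrow> q k > q0 / 2"
    using order_tendstoD(1)[OF q, of "q0 / 2"] q0 unfolding eventually_sequentially by auto
  show ?thesis
  proof (rule LIMSEQ_offset[where k = N], rule integral_dominated_convergence)
    show "integrable lborel (\<lambda>u. indicator {..1 / (q0 / 2)} u * shell_weight l \<alpha> u)"
      by (rule shell_weight_integrable[OF l])
    show "AE u in lborel. norm (shell_weight l \<alpha> u * pos_powr (1 - (q (k + N) * u) powr \<delta>) \<rho>) \<le> indicator {..1 / (q0 / 2)} u * shell_weight l \<alpha> u" for k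
      using N[of "k + N"] q0 by (intro AE_I2 shell_integrand_le \<delta> \<rho>) auto
    show "AE u in lborel. (\<lambda>k. shell_weight l \<alpha> u * pos_powr (1 - (q (k + N) * u) powr \<delta>) \<rho>) \<longlonglongrightarrow> shell_weight l \<alpha> u * pos_powr (1 - (q0 * u) powr \<delta>) \<rho>"
    proof (intro AE_I2)
      fix u :: real
      show "(\<lambda>k. shell_weight l \<alpha> u * pos_powr (1 - (q (k + N) * u) powr \<delta>) \<rho>) \<longlonglongrightarrow> shell_weight l \<alpha> u * pos_powr (1 - (q0 * u) powr \<delta>) \<rho>"
      proof (cases "u > 1")
        case True
        show ?thesis
          using True q0 by (intro tendsto_mult tendsto_const tendsto_pos_powr \<rho> tendsto_diff tendsto_powr LIMSEQ_ignore_initial_segment q) auto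
      qed (simp add: shell_weight_def)
    qed
  qed measurable
qed

text \<open>At the origin the rescaling degenerates, so the integral is split at t = 2 |y|^2. Above,
  the singular factor is bounded and the integrand at 0 dominates; below, the contribution is at
  most a constant times (|y|^2)^(\<alpha> + 1), which tends to 0 because \<alpha> > -1.\<close>

lemma mix_integral_tendsto_0:
  fixes y :: "nat \<Rightarrow> 'a::euclidean_space"
  assumes l: "l > -1" and \<delta>: "\<delta> > 0" and \<rho>: "\<rho> > 0" and \<alpha>: "\<alpha> > -1" and y: "y \<longlonglongrightarrow> 0"
  shows "(\<lambda>k. LINT t|lborel. mix_integrand l \<alpha> \<delta> \<rho> (y k) t) \<longlonglongrightarrow> (LINT t|lborel. mix_integrand l \<alpha> \<delta> \<rho> (0::'a) t)"
proof -
  define q where "q k = (norm (y k))\<^sup>2" for k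
  have q: "q \<longlonglongrightarrow> 0" unfolding q_def using tendsto_power[OF tendsto_norm[OF y], of 2] by simp
  have q0: "q k \<ge> 0" for k by (simp add: q_def)
  let ?m = "mix_integrand l \<alpha> \<delta> \<rho>"
  have int: "integrable lborel (?m x)" for x :: 'a
    using mix_integrand_integrable_nonzero[OF l \<delta> \<rho>, of x \<alpha>] mix_integrand_0_integrable[OF \<delta> less_imp_le[OF \<rho>] \<alpha>]
    by (cases "x = 0") auto
  have ind_int: "integrable lborel (\<lambda>t. indicator A t * ?m x t)" if [measurable]: "A \<in> sets borel" for A and x :: 'a
    by (rule Bochner_Integration.integrable_bound[OF int[of x]]) (auto split: split_indicator)
  define A where "A k = (LINT t|lborel. indicator {2 * q k<..} t * ?m (y k) t)" for k
  define B where "B k = (LINT t|lborel. indicator {..2 * q k} t * ?m (y k) t)" for k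
  have AB: "(LINT t|lborel. ?m (y k) t) = A k + B k" for k
  proof -
    have "A k + B k = (LINT t|lborel. indicator {2 * q k<..} t * ?m (y k) t + indicator {..2 * q k} t * ?m (y k) t)"
      unfolding A_def B_def by (intro Bochner_Integration.integral_add[symmetric] ind_int) auto
    also have "\<dots> = (LINT t|lborel. ?m (y k) t)"
      by (intro Bochner_Integration.integral_cong) (auto split: split_indicator)
    finally show ?thesis ..
  qed
  have "A \<longlonglongrightarrow> (LINT t|lborel. ?m (0::'a) t)"
    unfolding A_def
  proof (rule integral_dominated_convergence)
    \<comment> \<open>For t > 2q the base 1 - q/t lies in [1/2, 1], so its l-th power is at most 1
      if l \<ge> 0 and at most 2^(-l) if l < 0.\<close>
    let ?K = "max 1 (2 powr - l)"
    show "integrable lborel (\<lambda>t. ?K * ?m (0::'a) t)" using int by simp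
    have "indicator {2 * q k<..} t * ?m (y k) t \<le> ?K * ?m (0::'a) t" for k t
    proof (cases "2 * q k < t")
      case True
      then have t: "t > 0" using q0[of k] by linarith
      have s: "1/2 \<le> 1 - q k / t" "1 - q k / t \<le> 1" using True t q0[of k] by (auto simp: field_simps)
      have "0 < 1 - q k / t" using s by linarith
      then have pp: "pos_powr (1 - q k / t) l = (1 - q k / t) powr l" by (simp only: pos_powr_def if_True)
      have "pos_powr (1 - q k / t) l \<le> ?K"
      proof (cases "l \<ge> 0")
        case True
        have "(1 - q k / t) powr l \<le> 1 powr l" by (rule powr_mono2) (use s True in linarith)+
        then show ?thesis by (simp add: pp le_max_iff_disj)
      next
        case False
        have "(1 - q k / t) powr l \<le> (1/2) powr l" by (rule powr_mono2') (use s False in linarith)+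
        also have "(1/2) powr l = 2 powr - l" by (simp add: powr_divide powr_minus_divide)
        finally show ?thesis by (simp add: pp le_max_iff_disj)
      qed
      then have "pos_powr (1 - q k / t) l * (t powr \<alpha> * pos_powr (1 - t powr \<delta>) \<rho>) \<le> ?K * (t powr \<alpha> * pos_powr (1 - t powr \<delta>) \<rho>)"
        by (intro mult_right_mono) auto
      then show ?thesis using True t by (simp add: mix_integrand_def q_def pos_powr_def[of 1] mult_ac)
    qed (simp add: mix_integrand_nonneg)
    then show "AE t in lborel. norm (indicator {2 * q k<..} t * ?m (y k) t) \<le> ?K * ?m (0::'a) t" for k
      by (intro AE_I2) (simp add: abs_mult mix_integrand_nonneg)
    show "AE t in lborel. (\<lambda>k. indicator {2 * q k<..} t * ?m (y k) t) \<longlonglongrightarrow> ?m (0::'a) t"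
    proof (intro AE_I2)
      fix t :: real
      show "(\<lambda>k. indicator {2 * q k<..} t * ?m (y k) t) \<longlonglongrightarrow> ?m (0::'a) t"
      proof (cases "t > 0")
        case True
        have qt: "(\<lambda>k. 1 - q k / t) \<longlonglongrightarrow> 1 - 0 / t" using True by (intro tendsto_intros q) auto
        have "(\<lambda>k. (1 - q k / t) powr l * t powr \<alpha> * pos_powr (1 - t powr \<delta>) \<rho>) \<longlonglongrightarrow> (1 - 0 / t) powr l * t powr \<alpha> * pos_powr (1 - t powr \<delta>) \<rho>"
          by (intro tendsto_mult tendsto_powr qt tendsto_const) auto
        moreover have ev: "\<forall>\<^sub>F k in sequentially. q k < t / 2"
          using True by (intro order_tendstoD(2)[OF q]) simp
        have "\<forall>\<^sub>F k in sequentially. (1 - q k / t) powr l * t powr \<alpha> * pos_powr (1 - t powr \<delta>) \<rho> = indicator {2 * q k<..} t * ?m (y k) t"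
          using ev
        proof (elim eventually_mono)
          fix k assume "q k < t / 2"
          then show "(1 - q k / t) powr l * t powr \<alpha> * pos_powr (1 - t powr \<delta>) \<rho> = indicator {2 * q k<..} t * ?m (y k) t"
            using True by (simp add: mix_integrand_def q_def[symmetric] pos_powr_def[of "1 - q k / t"])
        qed
        ultimately have "(\<lambda>k. indicator {2 * q k<..} t * ?m (y k) t) \<longlonglongrightarrow> (1 - 0 / t) powr l * t powr \<alpha> * pos_powr (1 - t powr \<delta>) \<rho>"
          by (rule Lim_transform_eventually)
        then show ?thesis using True by (simp add: mix_integrand_def pos_powr_def[of 1])
      qed (simp add: mix_integrand_def)
    qed
  qed measurable
  moreover have "B \<longlonglongrightarrow> 0"
  proof -
    \<comment> \<open>In the variable u = t/q the range t \<le> 2q becomes u \<le> 2, which gives an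
      integral independent of k.\<close>
    let ?V = "LINT u|lborel. indicator {..2} u * shell_weight l \<alpha> u"
    have lower: "0 \<le> B k" for k
      unfolding B_def by (intro integral_nonneg_AE AE_I2 mult_nonneg_nonneg mix_integrand_nonneg) simp
    have upper: "B k \<le> q k powr (\<alpha> + 1) * ?V" for k
      proof (cases "y k = 0")
        case True
        then have z: "indicator {..2 * q k} t * ?m (y k) t = 0" for t
          by (auto simp: q_def mix_integrand_def split: split_indicator)
        have "B k = 0" unfolding B_def z by simp
        then show ?thesis using True by (simp add: q_def)
      next
        case False
        then have qk: "q k > 0" by (simp add: q_def)
        define X where "X = (LINT u|lborel. indicator {..2 * q k} (0 + q k * u) * ?m (y k) (0 + q k * u))"
        have "B k = \<bar>q k\<bar> *\<^sub>R X"
          unfolding B_def X_def by (rule lborel_integral_real_affine) (use qk in simp)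
        then have B: "B k = q k * X" using qk by simp
        have le: "indicator {..2 * q k} (0 + q k * u) * ?m (y k) (0 + q k * u) \<le> q k powr \<alpha> * (indicator {..2} u * shell_weight l \<alpha> u)" for u
        proof -
          have "pos_powr (1 - (q k * u) powr \<delta>) \<rho> \<le> 1" if "u > 1"
            using shell_factor_le[of "q k" u \<delta> \<rho>] qk that \<delta> \<rho> by (auto split: split_indicator_asm)
          then have "shell_weight l \<alpha> u * pos_powr (1 - (q k * u) powr \<delta>) \<rho> \<le> shell_weight l \<alpha> u"
            using shell_weight_nonneg[of l \<alpha> u] by (cases "u > 1") (auto simp: mult_left_le shell_weight_def)
          then have "q k powr \<alpha> * (shell_weight l \<alpha> u * pos_powr (1 - (q k * u) powr \<delta>) \<rho>) \<le> q k powr \<alpha> * shell_weight l \<alpha> u"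
            by (intro mult_left_mono) auto
          moreover have "indicator {..2 * q k} (0 + q k * u) = (indicator {..2} u :: real)"
            using qk by (auto split: split_indicator)
          ultimately show ?thesis
            using mix_integrand_rescaled[OF False, of l \<alpha> \<delta> \<rho> u] by (simp add: q_def[symmetric] split: split_indicator)
        qed
        have "X \<le> (LINT u|lborel. q k powr \<alpha> * (indicator {..2} u * shell_weight l \<alpha> u))"
          unfolding X_def
          by (rule integral_mono'[OF integrable_mult_right[OF shell_weight_integrable[OF l]] le]) (simp add: shell_weight_nonneg)
        then have "X \<le> q k powr \<alpha> * ?V" by (simp only: integral_mult_right_zero)
        then have "B k \<le> q k * (q k powr \<alpha> * ?V)" unfolding B using qk by (intro mult_left_mono) auto
        also have "\<dots> = q k powr (\<alpha> + 1) * ?V" using qk by (simp add: powr_add)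
        finally show ?thesis .
      qed
    have "(\<lambda>k. q k powr (\<alpha> + 1)) \<longlonglongrightarrow> 0"
      using q0 \<alpha> by (intro tendsto_zero_powrI[OF q tendsto_const]) auto
    then have "(\<lambda>k. q k powr (\<alpha> + 1) * ?V) \<longlonglongrightarrow> 0" by (rule tendsto_mult_left_zero)
    then show ?thesis
      by (rule tendsto_sandwich[of "\<lambda>_. 0" B, rotated 3]) (simp_all add: lower upper)
  qed
  ultimately have "(\<lambda>k. A k + B k) \<longlonglongrightarrow> (LINT t|lborel. ?m (0::'a) t) + 0" by (rule tendsto_add)
  then show ?thesis unfolding AB by simp
qed

text \<open>Away from the origin x enters the rescaled integral only through a power and the cutoff
  factor, where dominated convergence applies; the origin is the separate limit above.\<close>

lemma continuous_on_mix_integral: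
  assumes l: "l > -1" and \<delta>: "\<delta> > 0" and \<rho>: "\<rho> > 0" and \<alpha>: "\<alpha> > -1"
  shows "continuous_on UNIV (\<lambda>x::'a::euclidean_space. LINT t|lborel. mix_integrand l \<alpha> \<delta> \<rho> x t)"
proof -
  let ?w = "\<lambda>x::'a. LINT t|lborel. mix_integrand l \<alpha> \<delta> \<rho> x t"
  have "(\<lambda>k. ?w (y k)) \<longlonglongrightarrow> ?w x" if y: "y \<longlonglongrightarrow> x" for x y
  proof (cases "x = 0")
    case True
    then show ?thesis using mix_integral_tendsto_0[OF l \<delta> \<rho> \<alpha>, of y] y by simp
  next
    case False
    have q: "(\<lambda>k. (norm (y k))\<^sup>2) \<longlonglongrightarrow> (norm x)\<^sup>2" by (intro tendsto_intros y)
    have x2: "(norm x)\<^sup>2 > 0" using False by simp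
    let ?H = "\<lambda>q. LINT u|lborel. shell_weight l \<alpha> u * pos_powr (1 - (q * u) powr \<delta>) \<rho>"
    have "(\<lambda>k. ?H ((norm (y k))\<^sup>2)) \<longlonglongrightarrow> ?H ((norm x)\<^sup>2)"
      by (rule shell_integral_tendsto[OF l \<delta> \<rho> q x2])
    moreover have "(\<lambda>k. ((norm (y k))\<^sup>2) powr (\<alpha> + 1)) \<longlonglongrightarrow> ((norm x)\<^sup>2) powr (\<alpha> + 1)"
      by (rule tendsto_powr[OF q tendsto_const]) (use x2 in simp)
    ultimately have "(\<lambda>k. ((norm (y k))\<^sup>2) powr (\<alpha> + 1) * ?H ((norm (y k))\<^sup>2)) \<longlonglongrightarrow> ((norm x)\<^sup>2) powr (\<alpha> + 1) * ?H ((norm x)\<^sup>2)"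
      by (rule tendsto_mult[rotated])
    then have "(\<lambda>k. ((norm (y k))\<^sup>2) powr (\<alpha> + 1) * ?H ((norm (y k))\<^sup>2)) \<longlonglongrightarrow> ?w x"
      by (subst mix_integral_rescaled[OF False])
    moreover have "\<forall>\<^sub>F k in sequentially. ((norm (y k))\<^sup>2) powr (\<alpha> + 1) * ?H ((norm (y k))\<^sup>2) = ?w (y k)"
      using tendsto_imp_eventually_ne[OF y False]
      by (rule eventually_mono) (rule mix_integral_rescaled[symmetric])
    ultimately show ?thesis by (rule Lim_transform_eventually)
  qed
  then show ?thesis by (simp add: continuous_on_sequentially o_def)
qed

text \<open>The integrand requires |x|^2 < t < 1, so the integral vanishes outside the closed unit
  ball and compactness bounds it inside.\<close>

lemma mix_integral_bounded:
  assumes l: "l > -1" and \<delta>: "\<delta> > 0" and \<rho>: "\<rho> > 0" and \<alpha>: "\<alpha> > -1"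
  obtains B where "\<And>x::'a::euclidean_space. \<bar>LINT t|lborel. mix_integrand l \<alpha> \<delta> \<rho> x t\<bar> \<le> B"
proof -
  let ?w = "\<lambda>x::'a. LINT t|lborel. mix_integrand l \<alpha> \<delta> \<rho> x t"
  have "compact (?w ` cball 0 1)"
    by (intro compact_continuous_image continuous_on_subset[OF continuous_on_mix_integral[OF assms]]) auto
  then have "bounded (?w ` cball 0 1)" by (rule compact_imp_bounded)
  then obtain B where "\<forall>v\<in>?w ` cball 0 1. norm v \<le> B" unfolding bounded_iff ..
  then have B: "\<bar>?w x\<bar> \<le> B" if "x \<in> cball 0 1" for x
    using imageI[OF that, of ?w] by (simp only: real_norm_def)
  have w0: "?w x = 0" if "x \<notin> cball 0 1" for x
  proof -
    have x: "1 \<le> (norm x)\<^sup>2" using that by (simp add: one_le_power)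
    have "mix_integrand l \<alpha> \<delta> \<rho> x t = 0" for t
    proof (cases "0 < t \<and> t < 1")
      case True
      then have "1 \<le> (norm x)\<^sup>2 / t" using x by (simp add: field_simps)
      then show ?thesis by (simp add: mix_integrand_def pos_powr_def)
    next
      case False
      then have "t \<le> 0 \<or> 1 \<le> t powr \<delta>" using \<delta> ge_one_powr_ge_zero[of t \<delta>] by auto
      then show ?thesis by (auto simp: mix_integrand_def pos_powr_def)
    qed
    then show ?thesis by simp
  qed
  have "\<bar>?w x\<bar> \<le> max B 0" for x
  proof (cases "x \<in> cball 0 1")
    case True
    then show ?thesis by (rule max.coboundedI1[OF B])
  next
    case False
    show ?thesis unfolding w0[OF False] by simp
  qed
  then show ?thesis by (rule that)
qed

text \<open>The measure dt/t is invariant under t \<mapsto> t/2, so the integral J over (0, h)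
  equals J plus the integral over [h/2, h), which is at least 1/2. No finite J satisfies
  this.\<close>

lemma nn_integral_inverse_infinite:
  fixes h :: real
  assumes h: "h > 0"
  shows "(\<integral>\<^sup>+t. ennreal (indicator {0<..<h} t / t) \<partial>lborel) = \<infinity>"
proof -
  let ?J = "\<integral>\<^sup>+t. ennreal (indicator {0<..<h} t / t) \<partial>lborel"
  let ?b = "\<integral>\<^sup>+t. ennreal (indicator {h/2..<h} t / t) \<partial>lborel"
  have "?J = (\<integral>\<^sup>+t. ennreal (indicator {0<..<h/2} t / t) + ennreal (indicator {h/2..<h} t / t) \<partial>lborel)"
    using h by (intro nn_integral_cong) (auto split: split_indicator)
  also have "\<dots> = (\<integral>\<^sup>+t. ennreal (indicator {0<..<h/2} t / t) \<partial>lborel) + ?b"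
    by (rule nn_integral_add) measurable
  also have "(\<integral>\<^sup>+t. ennreal (indicator {0<..<h/2} t / t) \<partial>lborel) =
     ennreal \<bar>1/2\<bar> * (\<integral>\<^sup>+t. ennreal (indicator {0<..<h/2} (0 + 1/2 * t) / (0 + 1/2 * t)) \<partial>lborel)"
    by (rule nn_integral_real_affine) auto
  also have "\<dots> = (\<integral>\<^sup>+t. ennreal (1/2) * ennreal (indicator {0<..<h} t * 2 / t) \<partial>lborel)"
    by (subst nn_integral_cmult) (auto intro!: arg_cong2[where f = "(*)"] nn_integral_cong split: split_indicator)
  also have "\<dots> = ?J"
    by (intro nn_integral_cong) (subst ennreal_mult'[symmetric], auto split: split_indicator)
  finally have J: "?J = ?J + ?b" .
  have "ennreal (1/2) = (\<integral>\<^sup>+t. ennreal (1 / h) * indicator {h/2..<h} t \<partial>lborel)"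
    using h by (subst nn_integral_cmult_indicator) (auto simp flip: ennreal_mult)
  also have "\<dots> \<le> ?b"
    using h by (intro nn_integral_mono) (auto split: split_indicator intro!: ennreal_leI simp: field_simps)
  finally have "ennreal (1/2) \<le> ?b" .
  moreover have "0 < ennreal (1/2)" by (subst ennreal_less_zero_iff) simp
  ultimately have b: "?b > 0" by (rule less_le_trans[rotated])
  show ?thesis
  proof (rule ccontr)
    assume "?J \<noteq> \<infinity>"
    then have "?J + 0 < ?J + ?b" using b by (auto simp only: ennreal_add_left_cancel_less infinity_ennreal_def)
    then have "?J < ?J + ?b" by (simp only: add_0_right)
    then have "?J < ?J" by (subst (asm) J[symmetric])
    then show False by (rule less_irrefl[THEN notE])
  qed
qed

text \<open>On (0, 1/2) the factor t^\<alpha> is at least 1/t and the cutoff factor is at least its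
  positive value at 1/2.\<close>

lemma W_mix_0_infinite:
  assumes \<delta>: "\<delta> > 0" and \<rho>: "\<rho> \<ge> 0" and \<alpha>: "\<alpha> \<le> -1"
  shows "W_mix l \<alpha> \<delta> \<rho> 0 = \<infinity>"
proof -
  let ?c = "(1 - (1/2) powr \<delta>) powr \<rho>"
  have half: "(1/2::real) powr \<delta> < 1" using powr_between_0_1[of "1/2" \<delta>] \<delta> by simp
  have "ennreal ?c * \<infinity> = \<infinity>" using half \<delta> by (simp add: ennreal_mult_eq_top_iff)
  then have "\<infinity> = ennreal ?c * \<infinity>" ..
  also have "\<dots> = ennreal ?c * (\<integral>\<^sup>+t. ennreal (indicator {0<..<1/2} t / t) \<partial>lborel)"
    by (subst nn_integral_inverse_infinite) auto
  also have "\<dots> = (\<integral>\<^sup>+t. ennreal ?c * ennreal (indicator {0<..<1/2} t / t) \<partial>lborel)"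
    by (rule nn_integral_cmult[symmetric]) measurable
  also have "\<dots> \<le> W_mix l \<alpha> \<delta> \<rho> 0"
    unfolding W_mix_eq mix_integrand_0[OF \<delta>]
  proof (intro nn_integral_mono)
    fix t :: real
    show "ennreal ?c * ennreal (indicator {0<..<1/2} t / t) \<le> ennreal (indicator {0<..<1} t * (t powr \<alpha> * (1 - t powr \<delta>) powr \<rho>))"
    proof (cases "0 < t \<and> t < 1/2")
      case True
      have "t powr -1 \<le> t powr \<alpha>" using True \<alpha> by (intro powr_mono') auto
      then have 1: "1 / t \<le> t powr \<alpha>" using True by (simp add: powr_minus_divide)
      have "t powr \<delta> \<le> (1/2) powr \<delta>" using True \<delta> by (intro powr_mono2) auto
      then have "?c \<le> (1 - t powr \<delta>) powr \<rho>" using half \<rho> by (intro powr_mono2) auto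
      then have "1 / t * ?c \<le> t powr \<alpha> * (1 - t powr \<delta>) powr \<rho>"
        using 1 True by (intro mult_mono) auto
      then have "ennreal (?c * (1 / t)) \<le> ennreal (t powr \<alpha> * (1 - t powr \<delta>) powr \<rho>)"
        by (intro ennreal_leI) (simp only: mult.commute)
      moreover have "ennreal (?c * (1 / t)) = ennreal ?c * ennreal (1 / t)" by (rule ennreal_mult') simp
      moreover have "indicator {0<..<1/2} t = (1::real)" "indicator {0<..<1} t = (1::real)" using True by auto
      ultimately show ?thesis by (simp only: mult_1)
    qed simp
  qed
  finally show ?thesis by (simp add: top_unique)
qed

text \<open>The first conjunct locates the only possible infinite value, at the origin for \<alpha>
  \<le> -1. In the transform \<open>enn2real\<close> replaces this value by 0, a change on a null
  set, whereas the matrices keep it on their diagonal.\<close>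

theorem theorem5p1:
  fixes W :: "real ^ 'n \<Rightarrow> ennreal" and l \<alpha> \<delta> \<rho> :: real
  assumes "0 < \<delta>" and "\<delta> \<le> 1/2" and "\<rho> \<ge> 1"
    and "(l, \<alpha>) \<in> param_region CARD('n)"
  defines "W \<equiv> W_mix l \<alpha> \<delta> \<rho>"
  shows "(\<forall>x. x \<noteq> 0 \<or> \<alpha> > -1 \<longrightarrow> W x < \<infinity>)
    \<and> has_strictly_positive_fourier_transform (\<lambda>x. enn2real (W x))
    \<and> induces_pos_def_matrices (\<lambda>x. enn2ereal (W x))"
proof -
  let ?w = "\<lambda>x::real ^ 'n. LINT t|lborel. mix_integrand l \<alpha> \<delta> \<rho> x t"
  have l: "l > -1" and a: "- ((real DIM(real ^ 'n) + 2) / 2) < \<alpha>"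
    and a1: "\<alpha> \<le> 1/4 * (3 * l - (real DIM(real ^ 'n) + 1) / 2)" and a2: "\<alpha> \<le> 1/2 * (l - (real DIM(real ^ 'n) - 1) / 2)"
    using assms(4) by (simp_all add: param_region_def)
  have \<rho>: "\<rho> > 0" using assms(3) by simp
  have fin: "W x < \<infinity>" if "x \<noteq> 0 \<or> \<alpha> > -1" for x
  proof -
    have "integrable lborel (mix_integrand l \<alpha> \<delta> \<rho> x)"
    proof (cases "x = 0")
      case True
      then have "\<alpha> > -1" using that by simp
      then show ?thesis unfolding True by (rule mix_integrand_0_integrable[OF assms(1) less_imp_le[OF \<rho>]])
    next
      case False
      then show ?thesis by (rule mix_integrand_integrable_nonzero[OF l assms(1) \<rho>])
    qed
    then have "(\<integral>\<^sup>+t. ennreal (norm (mix_integrand l \<alpha> \<delta> \<rho> x t)) \<partial>lborel) < \<infinity>"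
      unfolding integrable_iff_bounded by (rule conjunct2)
    then show ?thesis
      by (simp only: W_def W_mix_eq real_norm_def abs_of_nonneg[OF mix_integrand_nonneg])
  qed
  note ft = mix_cosine_transform_pos[OF l assms(1-3) a a1 a2]
  have even: "W (- x) = W x" for x unfolding W_def W_mix_def norm_minus_cancel ..
  have W_real: "enn2real (W x) = ?w x" for x unfolding W_def by (rule enn2real_W_mix)
  have "has_strictly_positive_fourier_transform (\<lambda>x. enn2real (W x))"
    unfolding W_real by (rule strictly_positive_fourier_transformI[OF ft(1) _ ft(2)]) (fold W_real, simp only: even)
  moreover have "induces_pos_def_matrices (\<lambda>x. enn2ereal (W x))"
    unfolding induces_pos_def_matrices_def
  proof (intro allI impI)
    fix N and x :: "nat \<Rightarrow> real ^ 'n"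
    assume x: "inj_on x {..<N}"
    have sym: "W (x i - x j) = W (x j - x i)" for i j using even[of "x i - x j"] by simp
    show "pos_def_matrix N (\<lambda>i j. enn2ereal (W (x i - x j)))"
    proof (cases "\<alpha> > -1")
      case True
      have *: "enn2ereal (W u) = ereal (?w u)" for u
      proof -
        have "W u < \<infinity>" by (rule fin) (use True in simp)
        then have "W u = ennreal (enn2real (W u))" by simp
        then have "enn2ereal (W u) = enn2ereal (ennreal (enn2real (W u)))" by (rule arg_cong)
        also have "\<dots> = ereal (enn2real (W u))" by (rule enn2ereal_ennreal[OF enn2real_nonneg])
        finally show ?thesis unfolding W_real .
      qed
      obtain B where B: "\<And>u. \<bar>?w u\<bar> \<le> B" using mix_integral_bounded[OF l assms(1) \<rho> True] by blast
      have w_even: "?w (- u) = ?w u" for u unfolding W_real[symmetric] even ..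
      show ?thesis unfolding * pos_def_matrix_ereal
      proof (intro conjI allI impI)
        fix i j
        show "?w (x i - x j) = ?w (x j - x i)" unfolding W_real[symmetric] sym[of i j] ..
      next
        fix c :: "nat \<Rightarrow> real"
        assume "\<exists>i<N. c i \<noteq> 0"
        then show "0 < (\<Sum>i<N. \<Sum>j<N. c i * c j * ?w (x i - x j))"
          by (rule quadratic_form_pos[OF ft(1) continuous_on_mix_integral[OF l assms(1) \<rho> True] B w_even ft(2) x])
      qed
    next
      case False
      then have inf: "enn2ereal (W 0) = \<infinity>"
        using W_mix_0_infinite[OF assms(1) less_imp_le[OF \<rho>], of \<alpha> l] by (simp add: W_def)
      \<comment> \<open>A single nonzero c i already makes its diagonal term infinite, while all
        off-diagonal terms are finite, so the form itself is infinite.\<close>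
      have "0 < (\<Sum>i<N. \<Sum>j<N. ereal (c i * c j) * enn2ereal (W (x i - x j)))" if "i < N" "c i \<noteq> 0" for c :: "nat \<Rightarrow> real" and i
      proof -
        have "0 < c i * c i" using that(2) not_real_square_gt_zero by blast
        then have "ereal (c i * c i) * enn2ereal (W (x i - x i)) = \<infinity>"
          unfolding diff_self inf using that(2) by simp
        then have "(\<Sum>j<N. ereal (c i * c j) * enn2ereal (W (x i - x j))) = \<infinity>"
          using that by (subst sum_Pinfty) auto
        then have "(\<Sum>i<N. \<Sum>j<N. ereal (c i * c j) * enn2ereal (W (x i - x j))) = \<infinity>"
          using that by (subst sum_Pinfty) auto
        then show ?thesis by simp
      qed
      moreover have "enn2ereal (W (x i - x j)) \<noteq> \<infinity>" if "i < N" "j < N" "i \<noteq> j" for i j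
      proof -
        have "x i - x j \<noteq> 0" using that x by (auto simp: inj_on_def)
        then have "W (x i - x j) < \<infinity>" by (intro fin disjI1)
        then show ?thesis by (simp add: enn2ereal_eq_top_iff less_top)
      qed
      moreover have "enn2ereal u \<noteq> - \<infinity>" for u
        using enn2ereal_nonneg[of u] by auto
      ultimately show ?thesis
        unfolding pos_def_matrix_def by (intro conjI allI impI arg_cong[where f = enn2ereal] sym) auto
    qed
  qed
  ultimately show ?thesis using fin by blast
qed

end
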